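(* Let $X\sim\mathrm{IP}(\mu;\delta,\beta,\gamma)$ with $\delta\le 0$, fix a positive integer $n$, and let $g\in\mathcal{H}^{M,n}(X)$, where either $M\ge n$ is an integer or $M=\infty$. For every non-negative integer $m$ with $m\le M$ let \[ S_{m,n}(g)=\sum_{i=1}^{m}a_i\,\mathbb{E}^2\big[q^i(X)g^{(i)}(X)\big]+\sum_{i=1}^{n}(-1)^{i-1}b_i\,\mathbb{E}\big[q^{i}(X)\big(g^{(i)}(X)\big)^2\big], \] \[ a_i=\frac{\binom{m}{i}\prod_{j=m+i}^{m+n+i-1}(1-j\delta)}{(m+n)_i\,\mathbb{E}[q^i(X)]\Big(\prod_{j=i-1}^{2i-2}(1-j\delta)\Big)\prod_{j=m}^{m+n-1}(1-j\delta)},\qquad b_i=\frac{\binom{n}{i}}{(m+n)_i\prod_{j=m}^{m+i-1}(1-j\delta)} \] (the first sum being zero if $m=0$). Then for all integers $m_1,m_2$ with $0\le m_1<m_2\le M$, \[ \big|\mathrm{Var}\,g(X)-S_{m_1,n}(g)\big|\ge \zeta_{m_1,m_2,n}(\delta)\,\big|\mathrm{Var}\,g(X)-S_{m_2,n}(g)\big|, \qquad \zeta_{m_1,m_2,n}(\delta)=\frac{(m_2+n)_n\prod_{j=m_2}^{m_2+n-1}(1-j\delta)}{(m_1+n)_n\prod_{j=m_1}^{m_1+n-1}(1-j\delta)}>1, \] with equality if and only if $g$ is a polynomial of degree at most $n+m_1$ on the support of $X$.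
   Context: A random variable $X$ with density $f$ and finite mean $\mu=\mathbb{E}X$ belongs to the integrated Pearson family, written $X\sim\mathrm{IP}(\mu;\delta,\beta,\gamma)$, if there is a quadratic polynomial $q(x)=\delta x^2+\beta x+\gamma$ (with $|\delta|+|\beta|+|\gamma|>0$) such that $\int_{-\infty}^{x}(\mu-t)f(t)\,dt=q(x)f(x)$ for all $x\in\mathbb{R}$. Let $J(X)=(\alpha,\omega)$ denote the support of $X$. For $x\in\mathbb{R}$ and $k\in\mathbb{N}$, $(x)_k=x(x-1)\cdots(x-k+1)$ with $(x)_0=1$. For non-negative integers $m,n$ with $\ell=\max\{m,n\}$ and $\mathbb{E}|X|^{2\ell}<\infty$, $\mathcal{H}^{m,n}(X)$ is the class of Borel functions $g:(\alpha,\omega)\to\mathbb{R}$ such that: $g\in C^{\ell-1}(\alpha,\omega)$ and $g^{(\ell-1)}$ is absolutely continuous on $(\alpha,\omega)$ with a.s. derivative $g^{(\ell)}$; $\mathbb{E}[q^n(X)(g^{(n)}(X))^2]<\infty$; and $\mathbb{E}[q^i(X)|g^{(i)}(X)|]<\infty$ for $i=n+1,\dots,m$ (if any). Also $\mathcal{H}^{\infty,n}(X)=\bigcap_{m\ge 0}\mathcal{H}^{m,n}(X)$. Empty products equal $1$, and $\mathbb{E}^2[Y]$ means $(\mathbb{E}Y)^2$. *)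

theory Defs
  imports "HOL-Analysis.Analysis" "HOL-Computational_Algebra.Polynomial"
begin

definition falling_fact :: "real \<Rightarrow> nat \<Rightarrow> real" where
  "falling_fact x k = (\<Prod>j<k. x - real j)"

definition qpoly :: "real \<Rightarrow> real \<Rightarrow> real \<Rightarrow> real \<Rightarrow> real" where
  "qpoly \<delta> \<beta> \<gamma> x = \<delta> * x^2 + \<beta> * x + \<gamma>"

definition is_density :: "(real \<Rightarrow> real) \<Rightarrow> bool" where
  "is_density f \<longleftrightarrow> f \<in> borel_measurable borel \<and> (\<forall>x. 0 \<le> f x)
     \<and> integrable lborel f \<and> (LINT x|lborel. f x) = 1"

definition cdf_of :: "(real \<Rightarrow> real) \<Rightarrow> real \<Rightarrow> real" where
  "cdf_of f x = (LINT t:{..x}|lborel. f t)"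

text \<open>Support J(X) = (alpha, omega) of X (X has a density, so the cdf is continuous):
  alpha = inf{x. F x > 0}, omega = sup{x. F x < 1}.\<close>
definition support_int :: "(real \<Rightarrow> real) \<Rightarrow> real set" where
  "support_int f = {x. 0 < cdf_of f x \<and> cdf_of f x < 1}"

definition mean_of :: "(real \<Rightarrow> real) \<Rightarrow> real" where
  "mean_of f = (LINT t|lborel. t * f t)"

definition integrated_pearson ::
  "(real \<Rightarrow> real) \<Rightarrow> real \<Rightarrow> real \<Rightarrow> real \<Rightarrow> real \<Rightarrow> bool" where
  "integrated_pearson f \<mu> \<delta> \<beta> \<gamma> \<longleftrightarrow>
     is_density f \<and> integrable lborel (\<lambda>t. t * f t) \<and> \<mu> = mean_of f \<and>
     \<bar>\<delta>\<bar> + \<bar>\<beta>\<bar> + \<bar>\<gamma>\<bar> > 0 \<and>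
     (\<forall>x. (LINT t:{..x}|lborel. (\<mu> - t) * f t) = qpoly \<delta> \<beta> \<gamma> x * f x)"

text \<open>E[h(X)] is finite, and E[h(X)] (X lives on its support J(X)).\<close>
definition finite_exp :: "(real \<Rightarrow> real) \<Rightarrow> (real \<Rightarrow> real) \<Rightarrow> bool" where
  "finite_exp f h \<longleftrightarrow> set_integrable lborel (support_int f) (\<lambda>x. h x * f x)"

definition expect :: "(real \<Rightarrow> real) \<Rightarrow> (real \<Rightarrow> real) \<Rightarrow> real" where
  "expect f h = (LINT x:support_int f|lborel. h x * f x)"

definition variance_of :: "(real \<Rightarrow> real) \<Rightarrow> (real \<Rightarrow> real) \<Rightarrow> real" where
  "variance_of f g = expect f (\<lambda>x. (g x - expect f g)^2)"

text \<open>F is absolutely continuous on (every compact subinterval of) the open interval J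
  with a.e. derivative F': F(b) - F(a) = int_a^b F' for all a <= b in J.\<close>
definition abs_cont_deriv_on :: "real set \<Rightarrow> (real \<Rightarrow> real) \<Rightarrow> (real \<Rightarrow> real) \<Rightarrow> bool" where
  "abs_cont_deriv_on J F F' \<longleftrightarrow>
     (\<forall>a\<in>J. \<forall>b\<in>J. a \<le> b \<longrightarrow>
        set_integrable lborel {a..b} F' \<and> F b - F a = (LINT t:{a..b}|lborel. F' t))"

text \<open>g = G 0 belongs to H^{m,n}(X), where G i is the i-th derivative g^(i)
  (G l is the a.e. derivative of G (l-1)), l = max m n.\<close>
definition H_class ::
  "(real \<Rightarrow> real) \<Rightarrow> real \<Rightarrow> real \<Rightarrow> real \<Rightarrow> (nat \<Rightarrow> real \<Rightarrow> real) \<Rightarrow> nat \<Rightarrow> nat \<Rightarrow> bool" where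
  "H_class f \<delta> \<beta> \<gamma> G m n \<longleftrightarrow>
     (let l = max m n; J = support_int f; q = qpoly \<delta> \<beta> \<gamma> in
       finite_exp f (\<lambda>x. \<bar>x\<bar> ^ (2 * l)) \<and>
       (\<forall>k. k + 1 < l \<longrightarrow> (\<forall>x\<in>J. (G k has_real_derivative G (Suc k) x) (at x))) \<and>
       (0 < l \<longrightarrow> continuous_on J (G (l - 1)) \<and> abs_cont_deriv_on J (G (l - 1)) (G l)) \<and>
       (\<forall>i\<le>l. G i \<in> borel_measurable borel) \<and>
       finite_exp f (\<lambda>x. q x ^ n * (G n x)^2) \<and>
       (\<forall>i. n + 1 \<le> i \<and> i \<le> m \<longrightarrow> finite_exp f (\<lambda>x. q x ^ i * \<bar>G i x\<bar>)))"

text \<open>H^{M,n}(X) for M a natural number >= n or M = infinity; since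
  H^{M,n} is contained in H^{m,n} for m <= M (when M >= n), this is the
  intersection over all m <= M, which covers both cases uniformly.\<close>
definition H_class_enat ::
  "(real \<Rightarrow> real) \<Rightarrow> real \<Rightarrow> real \<Rightarrow> real \<Rightarrow> (nat \<Rightarrow> real \<Rightarrow> real) \<Rightarrow> enat \<Rightarrow> nat \<Rightarrow> bool" where
  "H_class_enat f \<delta> \<beta> \<gamma> G M n \<longleftrightarrow> (\<forall>m. enat m \<le> M \<longrightarrow> H_class f \<delta> \<beta> \<gamma> G m n)"

definition coef_a :: "(real \<Rightarrow> real) \<Rightarrow> real \<Rightarrow> real \<Rightarrow> real \<Rightarrow> nat \<Rightarrow> nat \<Rightarrow> nat \<Rightarrow> real" where
  "coef_a f \<delta> \<beta> \<gamma> m n i =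
     (real (m choose i) * (\<Prod>j\<in>{m+i..m+n+i-1}. 1 - real j * \<delta>)) /
     (falling_fact (real (m + n)) i * expect f (\<lambda>x. qpoly \<delta> \<beta> \<gamma> x ^ i)
       * (\<Prod>j\<in>{i-1..2*i-2}. 1 - real j * \<delta>) * (\<Prod>j\<in>{m..m+n-1}. 1 - real j * \<delta>))"

definition coef_b :: "real \<Rightarrow> nat \<Rightarrow> nat \<Rightarrow> nat \<Rightarrow> real" where
  "coef_b \<delta> m n i =
     real (n choose i) / (falling_fact (real (m + n)) i * (\<Prod>j\<in>{m..m+i-1}. 1 - real j * \<delta>))"

definition S_mn ::
  "(real \<Rightarrow> real) \<Rightarrow> real \<Rightarrow> real \<Rightarrow> real \<Rightarrow> (nat \<Rightarrow> real \<Rightarrow> real) \<Rightarrow> nat \<Rightarrow> nat \<Rightarrow> real" where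
  "S_mn f \<delta> \<beta> \<gamma> G m n =
     (\<Sum>i=1..m. coef_a f \<delta> \<beta> \<gamma> m n i *
                 (expect f (\<lambda>x. qpoly \<delta> \<beta> \<gamma> x ^ i * G i x))^2)
   + (\<Sum>i=1..n. (-1)^(i-1) * coef_b \<delta> m n i *
                 expect f (\<lambda>x. qpoly \<delta> \<beta> \<gamma> x ^ i * (G i x)^2))"

definition zeta :: "nat \<Rightarrow> nat \<Rightarrow> nat \<Rightarrow> real \<Rightarrow> real" where
  "zeta m1 m2 n \<delta> =
     (falling_fact (real (m2 + n)) n * (\<Prod>j\<in>{m2..m2+n-1}. 1 - real j * \<delta>)) /
     (falling_fact (real (m1 + n)) n * (\<Prod>j\<in>{m1..m1+n-1}. 1 - real j * \<delta>))"

end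

theory Submission
  imports Defs
begin

text \<open>
  With weights \<open>W\<^sub>i = q\<^sup>i f\<close> and \<open>\<lambda>\<^sub>k = k (1 - (k - 1) \<delta>)\<close>, differentiation from \<open>L\<^sup>2(W\<^sub>i)\<close> to \<open>L\<^sup>2(W\<^sub>i\<^sub>+\<^sub>1)\<close>
  has the adjoint \<open>A\<^sub>i r = (d\<^sub>i x - c\<^sub>i) r - q r'\<close>, where \<open>W\<^sub>i\<^sub>+\<^sub>1' = (c\<^sub>i - d\<^sub>i x) W\<^sub>i\<close>. The Rodrigues polynomials
  \<open>P\<^sub>k = A\<^sub>0 \<dots> A\<^sub>k\<^sub>-\<^sub>1 1\<close> are orthogonal, and so are their \<open>i\<close>-th derivatives with respect to \<open>W\<^sub>i\<close>. Expanding \<open>g\<close> in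
  them with coefficients \<open>\<alpha>\<^sub>k\<close>, one has \<open>E[q\<^sup>i (g\<^sup>(\<^sup>i\<^sup>))\<^sup>2] = \<Sum>\<^sub>k \<alpha>\<^sub>k\<^sup>2 \<Prod>\<^sub>r\<^sub><\<^sub>i (\<lambda>\<^sub>k - \<lambda>\<^sub>r)\<close>, and \<open>E[q\<^sup>i g\<^sup>(\<^sup>i\<^sup>)]\<close> is a multiple of \<open>\<alpha>\<^sub>i\<close>.
  The numbers \<open>b\<^sub>i\<close> are the Newton coefficients at the nodes \<open>\<lambda>\<^sub>0, \<lambda>\<^sub>1, \<dots>\<close> of \<open>\<Prod>\<^sub>r (1 - x / \<lambda>\<^sub>r)\<close>, \<open>r = m + 1, \<dots>, m + n\<close>,
  and the \<open>a\<^sub>i\<close> remove the terms \<open>k \<le> m\<close>, so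
  \<open>(-1)\<^sup>n (Var g - S) \<Prod>\<^sub>r \<lambda>\<^sub>r = \<Sum>\<^sub>k\<^sub>>\<^sub>m\<^sub>+\<^sub>n \<alpha>\<^sub>k\<^sup>2 \<Prod>\<^sub>r (\<lambda>\<^sub>k - \<lambda>\<^sub>r)\<close>.
  This is decreasing in \<open>m\<close>, strictly so unless \<open>\<alpha>\<^sub>k = 0\<close> for all \<open>k > m + n\<close>.

  Completeness of the polynomials is obtained from a spectral gap that grows with the degree: a function orthogonal to all
  polynomials of degree \<open>\<le> N\<close> satisfies \<open>(\<lambda>\<^sub>i\<^sub>+\<^sub>N\<^sub>+\<^sub>1 - \<lambda>\<^sub>i) \<parallel>v\<parallel>\<^sup>2 \<le> \<parallel>v'\<parallel>\<^sup>2\<close>, by induction on \<open>N\<close> through the relation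
  \<open>D A\<^sub>i = A\<^sub>i\<^sub>+\<^sub>1 D + d\<^sub>i\<close>.
\<close>

section \<open>Absolutely continuous functions\<close>

text \<open>Two obstacles shape the argument. The class controls the derivative of order n in mean
  square, but those above n only through E[q^i |g^(i)|]; integrability and vanishing boundary terms
  are therefore proved separately for first and for second moments, which is the purpose of the two
  weighted Hardy inequalities. Moreover, the spectral gap bounds a remainder of order i by the
  derivative of order i + 1, so convergence is obtained only below order n, and the infinite series
  is replaced by sums truncated at degree N with explicit remainders. After rescaling, the remainder
  of order n has coefficient 1 for every m: it is dropped when a sign is wanted and cancels when two
  values of m are compared.

  The condition \<delta> \<le> 0 enters three times: q lies below its tangents, so all moments
  exist; the factors 1 - j \<delta> are at least 1; and the eigenvalue gaps are at least k - r,
  which makes remainders decay like 1/N.\<close>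

lemma set_borel_measurable_mult:
  fixes f g :: "'a \<Rightarrow> real"
  assumes "set_borel_measurable M A f" "set_borel_measurable M A g"
  shows "set_borel_measurable M A (\<lambda>x. f x * g x)"
proof -
  have "(\<lambda>x. indicator A x *\<^sub>R (f x * g x)) = (\<lambda>x. (indicator A x *\<^sub>R f x) * (indicator A x *\<^sub>R g x))"
    by (auto simp: indicator_def)
  then show ?thesis
    using borel_measurable_times[of "\<lambda>x. indicator A x *\<^sub>R f x" M "\<lambda>x. indicator A x *\<^sub>R g x"] assms
    by (simp add: set_borel_measurable_def)
qed

lemma set_borel_measurable_abs:
  fixes f :: "'a \<Rightarrow> real"
  assumes "set_borel_measurable M A f"
  shows "set_borel_measurable M A (\<lambda>x. \<bar>f x\<bar>)"
proof -
  have "(\<lambda>x. indicator A x *\<^sub>R \<bar>f x\<bar>) = (\<lambda>x. \<bar>indicator A x *\<^sub>R f x\<bar>)"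
    by (auto simp: indicator_def)
  then show ?thesis
    using borel_measurable_abs[of "\<lambda>x. indicator A x *\<^sub>R f x" M] assms
    by (simp add: set_borel_measurable_def)
qed

lemma set_borel_measurable_lborel_continuous:
  fixes f :: "real \<Rightarrow> real"
  assumes "continuous_on A f" "A \<in> sets borel"
  shows "set_borel_measurable lborel A f"
  using borel_measurable_continuous_on_indicator[OF assms(2,1)]
  by (simp add: set_borel_measurable_def)

lemma set_integrable_imp_measurable:
  "set_integrable M A f \<Longrightarrow> set_borel_measurable M A f"
  by (simp add: set_integrable_def set_borel_measurable_def borel_measurable_integrable)

lemma set_integrable_dominated:
  fixes f g :: "'a \<Rightarrow> real"
  assumes "set_integrable M A f" "set_borel_measurable M A g" "\<And>x. x \<in> A \<Longrightarrow> \<bar>g x\<bar> \<le> f x"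
  shows "set_integrable M A g"
  by (rule set_integrable_bound[OF assms(1,2)]) (use assms(3) in \<open>auto intro!: AE_I2 order_trans[OF assms(3)]\<close>)

lemma set_integral_nonneg_real:
  fixes f :: "'a \<Rightarrow> real"
  assumes "\<And>x. x \<in> A \<Longrightarrow> 0 \<le> f x"
  shows "0 \<le> (LINT x:A|M. f x)"
  unfolding set_lebesgue_integral_def
  by (intro integral_nonneg_AE) (use assms in \<open>auto simp: indicator_def\<close>)

lemma set_integral_mono_set:
  fixes f :: "'a \<Rightarrow> real"
  assumes "set_integrable M B f" "A \<in> sets M" "A \<subseteq> B" "\<And>x. x \<in> B \<Longrightarrow> 0 \<le> f x"
  shows "(LINT x:A|M. f x) \<le> (LINT x:B|M. f x)"
proof -
  have "set_integrable M A f" using assms set_integrable_subset by blast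
  then show ?thesis
    using assms unfolding set_lebesgue_integral_def set_integrable_def
    by (intro integral_mono) (auto simp: indicator_def)
qed

lemma set_integrable_mult_continuous:
  fixes \<phi> h :: "real \<Rightarrow> real"
  assumes "set_integrable lborel {a..b} \<phi>" "continuous_on {a..b} h"
  shows "set_integrable lborel {a..b} (\<lambda>x. \<phi> x * h x)"
proof -
  obtain B where B: "\<And>x. x \<in> {a..b} \<Longrightarrow> \<bar>h x\<bar> \<le> B"
    using compact_imp_bounded[OF compact_continuous_image[OF assms(2) compact_Icc]]
    by (fastforce simp: bounded_iff)
  have "set_integrable lborel {a..b} (\<lambda>x. B * \<bar>\<phi> x\<bar>)"
    using set_integrable_abs[OF assms(1)] by simp
  then show ?thesis
  proof (rule set_integrable_dominated)
    show "set_borel_measurable lborel {a..b} (\<lambda>x. \<phi> x * h x)"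
      using assms by (intro set_borel_measurable_mult set_integrable_imp_measurable
          set_borel_measurable_lborel_continuous) auto
    fix x assume "x \<in> {a..b}"
    then show "\<bar>\<phi> x * h x\<bar> \<le> B * \<bar>\<phi> x\<bar>"
      using mult_right_mono[OF B, of x "\<bar>\<phi> x\<bar>"] by (simp add: abs_mult mult.commute)
  qed
qed

lemma set_integral_combine:
  fixes f :: "real \<Rightarrow> real"
  assumes "set_integrable lborel {a..c} f" "a \<le> b" "b \<le> c"
  shows "(LBINT x:{a..c}. f x) = (LBINT x:{a..b}. f x) + (LBINT x:{b..c}. f x)"
proof -
  have "{a..c} = {a..b} \<union> {b..c}" using assms by auto
  moreover have "AE x in lborel. \<not> (x \<in> {a..b} \<and> x \<in> {b..c})"
    using AE_lborel_singleton[of b] by eventually_elim auto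
  ultimately show ?thesis
    using set_integral_Un_AE[where M=lborel and A="{a..b}" and B="{b..c}" and f=f] assms
      set_integrable_subset[OF assms(1)] by simp
qed

lemma is_interval_Icc_subset:
  fixes J :: "real set"
  assumes "is_interval J" "a \<in> J" "b \<in> J"
  shows "{a..b} \<subseteq> J"
  using assms unfolding is_interval_1 by fastforce

lemma abs_cont_subset:
  "abs_cont_deriv_on J F F' \<Longrightarrow> K \<subseteq> J \<Longrightarrow> abs_cont_deriv_on K F F'"
  unfolding abs_cont_deriv_on_def by (meson subsetD)

lemma abs_cont_integrable:
  "abs_cont_deriv_on J F F' \<Longrightarrow> {a..b} \<subseteq> J \<Longrightarrow> set_integrable lborel {a..b} F'"
  unfolding abs_cont_deriv_on_def
  by (cases "a \<le> b") (auto simp: set_integrable_def subset_iff)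

lemma abs_cont_FTC:
  "abs_cont_deriv_on J F F' \<Longrightarrow> {a..b} \<subseteq> J \<Longrightarrow> a \<le> b \<Longrightarrow> (LBINT t:{a..b}. F' t) = F b - F a"
  unfolding abs_cont_deriv_on_def by (auto simp: subset_iff)

lemma abs_cont_continuous_Icc:
  assumes "abs_cont_deriv_on {a..b} F F'"
  shows "continuous_on {a..b} F"
proof -
  have int: "set_integrable lborel {a..b} F'" using abs_cont_integrable[OF assms] by simp
  have "continuous_on {a..b} (\<lambda>x. F a + integral {a..x} F')"
    using set_borel_integral_eq_integral(1)[OF int]
    by (intro continuous_intros indefinite_integral_continuous_1)
  moreover have "F a + integral {a..x} F' = F x" if "x \<in> {a..b}" for x
  proof -
    have sub: "{a..x} \<subseteq> {a..b}" using that by auto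
    have "set_integrable lborel {a..x} F'" using abs_cont_integrable[OF assms sub] .
    from set_borel_integral_eq_integral(2)[OF this] abs_cont_FTC[OF assms sub] that show ?thesis
      by simp
  qed
  ultimately show ?thesis by (rule continuous_on_eq)
qed

lemma open_interval_Icc_around:
  fixes J :: "real set"
  assumes "open J" "x \<in> J"
  obtains a b where "a < x" "x < b" "{a..b} \<subseteq> J"
proof -
  obtain e where e: "e > 0" "cball x e \<subseteq> J" using assms open_contains_cball by blast
  have "{x - e..x + e} \<subseteq> J" using e by (auto simp: cball_eq_atLeastAtMost)
  then show ?thesis using e by (intro that[of "x - e" "x + e"]) auto
qed

lemma abs_cont_continuous:
  assumes "abs_cont_deriv_on J F F'" "open J"
  shows "continuous_on J F"
proof (intro continuous_at_imp_continuous_on ballI)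
  fix x assume "x \<in> J"
  then obtain a b where ab: "a < x" "x < b" "{a..b} \<subseteq> J"
    using open_interval_Icc_around assms(2) by blast
  have "continuous_on {a..b} F"
    using abs_cont_continuous_Icc abs_cont_subset[OF assms(1) ab(3)] by blast
  then show "isCont F x" using ab
    by (auto intro!: continuous_on_interior[of "{a..b}"] simp: interior_atLeastAtMost_real)
qed

lemma abs_cont_C1:
  assumes "is_interval J" "\<And>x. x \<in> J \<Longrightarrow> (F has_real_derivative F' x) (at x within J)"
    "continuous_on J F'"
  shows "abs_cont_deriv_on J F F'"
  unfolding abs_cont_deriv_on_def
proof (intro ballI impI conjI)
  fix a b :: real assume ab: "a \<in> J" "b \<in> J" "a \<le> b"
  have sub: "{a..b} \<subseteq> J" using is_interval_Icc_subset[OF assms(1) ab(1,2)] .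
  have cont: "continuous_on {a..b} F'" using continuous_on_subset[OF assms(3) sub] .
  show "set_integrable lborel {a..b} F'" using borel_integrable_atLeastAtMost'[OF cont] .
  have "(\<integral>x. indicator {a..b} x *\<^sub>R F' x \<partial>lborel) = F b - F a"
  proof (rule integral_FTC_Icc[OF ab(3) _ cont])
    fix x assume "a \<le> x" "x \<le> b"
    then show "(F has_vector_derivative F' x) (at x within {a..b})"
      using DERIV_subset[OF assms(2) sub] sub
      by (auto simp flip: has_real_derivative_iff_has_vector_derivative)
  qed
  then show "F b - F a = (LBINT t:{a..b}. F' t)" by (simp add: set_lebesgue_integral_def)
qed

text \<open>Fubini for \<open>F' s * H' t\<close> on the triangle \<open>s \<le> t\<close>:
  integrating first over \<open>s\<close> gives the integral of \<open>(F - F a) H'\<close>, first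
  over \<open>t\<close> that of \<open>F' (H b - H)\<close>. Equating the two is the product
  formula.\<close>

lemma abs_cont_mult_Icc:
  assumes F: "abs_cont_deriv_on {a..b} F F'" and H: "abs_cont_deriv_on {a..b} H H'" and ab: "a \<le> b"
  shows "set_integrable lborel {a..b} (\<lambda>x. F' x * H x + F x * H' x)"
    and "(LBINT x:{a..b}. F' x * H x + F x * H' x) = F b * H b - F a * H a"
proof -
  note F' = abs_cont_integrable[OF F order_refl] and H' = abs_cont_integrable[OF H order_refl]
  note cF = abs_cont_continuous_Icc[OF F] and cH = abs_cont_continuous_Icc[OF H]
  have FH: "set_integrable lborel {a..b} (\<lambda>x. F' x * H x)"
    using set_integrable_mult_continuous[OF F' cH] .
  have HF: "set_integrable lborel {a..b} (\<lambda>x. F x * H' x)"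
    using set_integrable_mult_continuous[OF H' cF] by (simp add: mult.commute)
  show "set_integrable lborel {a..b} (\<lambda>x. F' x * H x + F x * H' x)"
    using FH HF by (rule set_integral_add)
  define A where "A s = indicator {a..b} s *\<^sub>R F' s" for s
  define B where "B s = indicator {a..b} s *\<^sub>R H' s" for s
  have A: "integrable lborel A" and B: "integrable lborel B"
    using F' H' unfolding A_def[abs_def] B_def[abs_def] set_integrable_def by auto
  have [measurable]: "A \<in> borel_measurable borel" "B \<in> borel_measurable borel"
    using borel_measurable_integrable[OF A] borel_measurable_integrable[OF B] by simp_all
  have intAB: "integrable (lborel \<Otimes>\<^sub>M lborel) (\<lambda>p. A (fst p) * B (snd p))"
  proof (rule lborel_pair.Fubini_integrable)
    show "integrable lborel (\<lambda>x. \<integral>y. norm (A (fst (x, y)) * B (snd (x, y))) \<partial>lborel)"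
      using A B by (simp add: abs_mult)
    show "AE x in lborel. integrable lborel (\<lambda>y. A (fst (x, y)) * B (snd (x, y)))"
      using B by simp
  qed measurable
  define K where "K s t = A s * B t * (if s \<le> t then 1 else 0)" for s t
  have "integrable (lborel \<Otimes>\<^sub>M lborel) (case_prod K)"
  proof (rule Bochner_Integration.integrable_bound[OF intAB])
    show "case_prod K \<in> borel_measurable (lborel \<Otimes>\<^sub>M lborel)"
      unfolding K_def by measurable
  qed (auto simp: K_def)
  then have Fub: "(\<integral>t. (\<integral>s. K s t \<partial>lborel) \<partial>lborel) = (\<integral>s. (\<integral>t. K s t \<partial>lborel) \<partial>lborel)"
    by (rule lborel_pair.Fubini_integral)
  have 1: "(\<integral>s. K s t \<partial>lborel) = B t * (F t - F a)" for t
  proof (cases "t \<in> {a..b}")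
    case True
    have "(\<integral>s. K s t \<partial>lborel) = (\<integral>s. B t * (indicator {a..t} s *\<^sub>R F' s) \<partial>lborel)"
      using True by (intro Bochner_Integration.integral_cong) (auto simp: K_def A_def indicator_def)
    also have "\<dots> = B t * (LBINT s:{a..t}. F' s)" by (simp add: set_lebesgue_integral_def)
    also have "\<dots> = B t * (F t - F a)" using True abs_cont_FTC[OF F, of a t] by auto
    finally show ?thesis .
  qed (auto simp: K_def B_def)
  have 2: "(\<integral>t. K s t \<partial>lborel) = A s * (H b - H s)" for s
  proof (cases "s \<in> {a..b}")
    case True
    have "(\<integral>t. K s t \<partial>lborel) = (\<integral>t. A s * (indicator {s..b} t *\<^sub>R H' t) \<partial>lborel)"
      using True by (intro Bochner_Integration.integral_cong) (auto simp: K_def B_def indicator_def)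
    also have "\<dots> = A s * (LBINT t:{s..b}. H' t)" by (simp add: set_lebesgue_integral_def)
    also have "\<dots> = A s * (H b - H s)" using True abs_cont_FTC[OF H, of s b] by auto
    finally show ?thesis .
  qed (auto simp: K_def A_def)
  have "(\<integral>t. B t * (F t - F a) \<partial>lborel) = (LBINT t:{a..b}. F t * H' t - F a * H' t)"
    unfolding set_lebesgue_integral_def
    by (intro Bochner_Integration.integral_cong) (auto simp: B_def algebra_simps indicator_def)
  also have "\<dots> = (LBINT t:{a..b}. F t * H' t) - F a * (H b - H a)"
    using HF H' ab by (subst set_integral_diff) (auto simp: abs_cont_FTC[OF H])
  finally have 3: "(\<integral>t. B t * (F t - F a) \<partial>lborel) = \<dots>" .
  have "(\<integral>s. A s * (H b - H s) \<partial>lborel) = (LBINT t:{a..b}. H b * F' t - F' t * H t)"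
    unfolding set_lebesgue_integral_def
    by (intro Bochner_Integration.integral_cong) (auto simp: A_def algebra_simps indicator_def)
  also have "\<dots> = H b * (F b - F a) - (LBINT t:{a..b}. F' t * H t)"
    using FH F' ab by (subst set_integral_diff) (auto simp: abs_cont_FTC[OF F])
  finally have 4: "(\<integral>s. A s * (H b - H s) \<partial>lborel) = \<dots>" .
  show "(LBINT x:{a..b}. F' x * H x + F x * H' x) = F b * H b - F a * H a"
    using Fub 3 4 set_integral_add(2)[OF FH HF] unfolding 1 2 by (simp add: algebra_simps)
qed

lemma abs_cont_mult:
  assumes "is_interval J" "abs_cont_deriv_on J F F'" "abs_cont_deriv_on J H H'"
  shows "abs_cont_deriv_on J (\<lambda>x. F x * H x) (\<lambda>x. F' x * H x + F x * H' x)"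
  unfolding abs_cont_deriv_on_def
proof (intro ballI impI)
  fix a b :: real assume ab: "a \<in> J" "b \<in> J" "a \<le> b"
  have sub: "{a..b} \<subseteq> J" using is_interval_Icc_subset[OF assms(1) ab(1,2)] .
  show "set_integrable lborel {a..b} (\<lambda>x. F' x * H x + F x * H' x) \<and>
      F b * H b - F a * H a = (LBINT t:{a..b}. F' t * H t + F t * H' t)"
    using abs_cont_mult_Icc[OF abs_cont_subset[OF assms(2) sub] abs_cont_subset[OF assms(3) sub] ab(3)]
    by simp
qed

lemma abs_cont_cong:
  assumes "is_interval J" "\<And>x. x \<in> J \<Longrightarrow> F x = H x" "\<And>x. x \<in> J \<Longrightarrow> F' x = H' x"
  shows "abs_cont_deriv_on J F F' \<longleftrightarrow> abs_cont_deriv_on J H H'"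
proof -
  have "(set_integrable lborel {a..b} F' \<and> F b - F a = (LBINT t:{a..b}. F' t)) =
    (set_integrable lborel {a..b} H' \<and> H b - H a = (LBINT t:{a..b}. H' t))"
    if ab: "a \<in> J" "b \<in> J" "a \<le> b" for a b
  proof -
    have sub: "{a..b} \<subseteq> J" using is_interval_Icc_subset[OF assms(1) ab(1,2)] .
    have "set_integrable lborel {a..b} F' = set_integrable lborel {a..b} H'"
      using sub assms(3) by (intro set_integrable_cong) auto
    moreover have "(LBINT t:{a..b}. F' t) = (LBINT t:{a..b}. H' t)"
      using sub assms(3) by (intro set_lebesgue_integral_cong) auto
    ultimately show ?thesis using assms(2) ab by simp
  qed
  then show ?thesis unfolding abs_cont_deriv_on_def by (intro ball_cong refl imp_cong)
qed

lemma abs_cont_diff: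
  assumes "abs_cont_deriv_on J F F'" "abs_cont_deriv_on J H H'"
  shows "abs_cont_deriv_on J (\<lambda>x. F x - H x) (\<lambda>x. F' x - H' x)"
  unfolding abs_cont_deriv_on_def
proof (intro ballI impI)
  fix a b :: real assume "a \<in> J" "b \<in> J" "a \<le> b"
  then have F: "set_integrable lborel {a..b} F'" "F b - F a = (LBINT t:{a..b}. F' t)"
    and H: "set_integrable lborel {a..b} H'" "H b - H a = (LBINT t:{a..b}. H' t)"
    using assms unfolding abs_cont_deriv_on_def by blast+
  then show "set_integrable lborel {a..b} (\<lambda>x. F' x - H' x) \<and>
      F b - H b - (F a - H a) = (LBINT t:{a..b}. F' t - H' t)"
    using set_integral_diff[OF F(1) H(1)] by linarith
qed

lemma abs_cont_poly:
  assumes "is_interval J"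
  shows "abs_cont_deriv_on J (poly p) (poly (pderiv p))"
  by (rule abs_cont_C1[OF assms]) (auto intro: DERIV_subset[OF poly_DERIV] continuous_intros)

section \<open>Intervals exhausted by compact subintervals\<close>

lemma set_integral_pos_Icc:
  fixes h :: "real \<Rightarrow> real"
  assumes "a < b" "continuous_on {a..b} h" "\<And>x. x \<in> {a..b} \<Longrightarrow> 0 < h x"
  shows "0 < (LBINT x:{a..b}. h x)"
proof -
  obtain m where m: "m \<in> {a..b}" "\<And>x. x \<in> {a..b} \<Longrightarrow> h m \<le> h x"
    using continuous_attains_inf[OF compact_Icc _ assms(2)] assms(1) by (auto simp: less_imp_le)
  have "(LBINT x:{a..b}. h m) \<le> (LBINT x:{a..b}. h x)"
    using assms m by (intro set_integral_mono borel_integrable_atLeastAtMost') auto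
  moreover have "(LBINT x:{a..b}. h m) = (b - a) * h m"
    using assms(1) by (simp add: set_lebesgue_integral_def)
  ultimately show ?thesis using assms(1) assms(3)[OF m(1)]
    by (smt (verit) mult_pos_pos)
qed

text \<open>Both endpoint sequences are treated at once: a tail integral over the side of \<open>x\<close> that points
  away from the interior point \<open>c\<close> vanishes along either of them.\<close>

definition tail_set :: "real set \<Rightarrow> real \<Rightarrow> real \<Rightarrow> real set" where
  "tail_set J c x = (if c \<le> x then J \<inter> {x..} else J \<inter> {..x})"

text \<open>Limits at the ends of \<open>J\<close>, finite or infinite, are always taken along
  \<open>l\<close> and \<open>u\<close>; on each compact \<open>{l n..u n}\<close> continuous
  functions are integrable and the fundamental theorem applies.\<close>

locale exhausted_interval =
  fixes J :: "real set" and l u :: "nat \<Rightarrow> real"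
  assumes J_eq: "J = (\<Union>n. {l n..u n})"
    and inc_u: "incseq u" and dec_l: "decseq l" and l_less_u: "\<And>n. l n < u n"
    and open_J: "open J"
begin

lemma J_borel [measurable]: "J \<in> sets borel"
  using open_J by simp

lemma Icc_subset: "{l n..u n} \<subseteq> J"
  using J_eq by auto

lemma endpoints_in: "l n \<in> J" "u n \<in> J"
  using Icc_subset[of n] l_less_u[of n] by auto

lemma incseq_Icc: "incseq (\<lambda>n. {l n..u n})"
  using inc_u dec_l unfolding incseq_def decseq_def by (fastforce intro: order_trans)

lemma interval_J: "is_interval J"
  unfolding is_interval_1
proof (intro allI impI ballI)
  fix a b x assume ab: "a \<in> J" "b \<in> J" and x: "a \<le> x \<and> x \<le> b"
  obtain m n where "a \<in> {l m..u m}" "b \<in> {l n..u n}" using ab J_eq by auto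
  then have "a \<in> {l (max m n)..u (max m n)}" "b \<in> {l (max m n)..u (max m n)}"
    using incseq_Icc unfolding incseq_def by (meson max.cobounded1 max.cobounded2 subsetD)+
  then show "x \<in> J" using x Icc_subset[of "max m n"] by (meson atLeastAtMost_iff order_trans subsetD)
qed

lemma Icc_in_J: "a \<in> J \<Longrightarrow> b \<in> J \<Longrightarrow> {a..b} \<subseteq> J"
  using is_interval_Icc_subset[OF interval_J] .

lemma eventually_surround:
  assumes "x \<in> J"
  shows "eventually (\<lambda>n. l n < x \<and> x < u n) sequentially"
proof -
  obtain a b where ab: "a < x" "x < b" "{a..b} \<subseteq> J"
    using open_interval_Icc_around[OF open_J assms] .
  then have "a \<in> J" "b \<in> J" by auto
  then obtain i j where i: "a \<in> {l i..u i}" and j: "b \<in> {l j..u j}" using J_eq by auto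
  have "l n < x \<and> x < u n" if "n \<ge> max i j" for n
  proof -
    have "a \<in> {l n..u n}" "b \<in> {l n..u n}"
      using i j that incseq_Icc unfolding incseq_def by (meson max.bounded_iff subsetD)+
    then show ?thesis using ab by auto
  qed
  then show ?thesis unfolding eventually_sequentially by blast
qed

lemma integral_exhaust:
  fixes h :: "real \<Rightarrow> real"
  assumes "set_integrable lborel J h"
  shows "(\<lambda>n. LBINT x:{l n..u n}. h x) \<longlonglongrightarrow> (LBINT x:J. h x)"
  using set_integral_cont_up[of "\<lambda>n. {l n..u n}" lborel h] incseq_Icc assms
  by (simp flip: J_eq)

lemma indicator_exhaust:
  "(\<lambda>n. indicator {l n..u n} x *\<^sub>R h x) \<longlonglongrightarrow> indicator J x *\<^sub>R (h x :: real)"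
proof (cases "x \<in> J")
  case True
  have "eventually (\<lambda>n. indicator {l n..u n} x *\<^sub>R h x = indicator J x *\<^sub>R h x) sequentially"
    using eventually_surround[OF True] by eventually_elim (use True in auto)
  then show ?thesis by (rule tendsto_eventually)
next
  case False
  then have "x \<notin> {l n..u n}" for n using Icc_subset by blast
  then show ?thesis using False by simp
qed

lemma measurable_exhaust:
  fixes h :: "real \<Rightarrow> real"
  assumes "\<And>n. set_borel_measurable lborel {l n..u n} h"
  shows "set_borel_measurable lborel J h"
  unfolding set_borel_measurable_def
proof (rule borel_measurable_LIMSEQ_real)
  show "(\<lambda>x. indicator {l n..u n} x *\<^sub>R h x) \<in> borel_measurable lborel" for n
    using assms[of n] by (simp add: set_borel_measurable_def)
qed (rule indicator_exhaust)

lemma abs_cont_measurable: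
  "abs_cont_deriv_on J F F' \<Longrightarrow> set_borel_measurable lborel J F'"
  by (intro measurable_exhaust set_integrable_imp_measurable abs_cont_integrable[OF _ Icc_subset])

lemma continuous_measurable:
  "continuous_on J h \<Longrightarrow> set_borel_measurable lborel J (h :: real \<Rightarrow> real)"
  by (rule set_borel_measurable_lborel_continuous) measurable

text \<open>Monotone convergence. A bound that holds only eventually is enough, since the integrals
  increase with \<open>n\<close>; callers may thus assume that \<open>{l n..u n}\<close> already
  surrounds a given point.\<close>

lemma integrable_exhaust:
  fixes h :: "real \<Rightarrow> real"
  assumes int: "\<And>n. set_integrable lborel {l n..u n} h"
    and nonneg: "\<And>x. x \<in> J \<Longrightarrow> 0 \<le> h x"
    and bound: "eventually (\<lambda>n. (LBINT x:{l n..u n}. h x) \<le> C) sequentially"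
  shows "set_integrable lborel J h"
proof -
  let ?I = "\<lambda>n. LBINT x:{l n..u n}. h x"
  have mono: "incseq ?I"
    unfolding incseq_def
  proof (intro allI impI)
    fix m n :: nat assume mn: "m \<le> n"
    show "?I m \<le> ?I n"
    proof (rule set_integral_mono_set[OF int])
      show "{l m..u m} \<subseteq> {l n..u n}" using incseq_Icc mn by (simp add: incseq_def)
      show "0 \<le> h x" if "x \<in> {l n..u n}" for x using nonneg Icc_subset[of n] that by blast
    qed simp
  qed
  obtain N where N: "\<And>n. n \<ge> N \<Longrightarrow> ?I n \<le> C" using bound unfolding eventually_sequentially by blast
  have "?I n \<le> C" for n
    using N[of "max n N"] mono[unfolded incseq_def, rule_format, of n "max n N"] by simp
  then obtain L where L: "?I \<longlonglongrightarrow> L"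
    using incseq_convergent[OF mono] by blast
  show ?thesis
    unfolding set_integrable_def
  proof (rule integrable_monotone_convergence[where f="\<lambda>n x. indicator {l n..u n} x *\<^sub>R h x"])
    show "integrable lborel (\<lambda>x. indicator {l n..u n} x *\<^sub>R h x)" for n
      using int by (simp add: set_integrable_def)
    show "AE x in lborel. mono (\<lambda>n. indicator {l n..u n} x *\<^sub>R h x)"
    proof (intro AE_I2 monoI)
      fix x and m n :: nat assume "m \<le> n"
      then have "{l m..u m} \<subseteq> {l n..u n}" using incseq_Icc by (simp add: incseq_def)
      then show "indicator {l m..u m} x *\<^sub>R h x \<le> indicator {l n..u n} x *\<^sub>R h x"
        using nonneg[of x] Icc_subset[of n] by (auto simp: indicator_def)
    qed
    show "AE x in lborel. (\<lambda>n. indicator {l n..u n} x *\<^sub>R h x) \<longlonglongrightarrow> indicator J x *\<^sub>R h x"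
      by (intro AE_I2 indicator_exhaust)
    show "(\<lambda>n. integral\<^sup>L lborel (\<lambda>x. indicator {l n..u n} x *\<^sub>R h x)) \<longlonglongrightarrow> L"
      using L by (simp add: set_lebesgue_integral_def)
    show "(\<lambda>x. indicator J x *\<^sub>R h x) \<in> borel_measurable lborel"
      using measurable_exhaust[OF set_integrable_imp_measurable[OF int]]
      by (simp add: set_borel_measurable_def)
  qed
qed

lemma tail_subset: "tail_set J c x \<subseteq> J"
  by (auto simp: tail_set_def)

lemma tail_borel [measurable]: "tail_set J c x \<in> sets borel"
  by (auto simp: tail_set_def)

lemma tail_far: "t \<in> tail_set J c x \<Longrightarrow> \<bar>x - c\<bar> \<le> \<bar>t - c\<bar>"
  by (auto simp: tail_set_def split: if_splits)

lemma tail_integral_tendsto: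
  fixes h :: "real \<Rightarrow> real"
  assumes h: "set_integrable lborel J h" and c: "c \<in> J" and z: "z = l \<or> z = u"
  shows "(\<lambda>n. LBINT x:tail_set J c (z n). h x) \<longlonglongrightarrow> 0"
proof -
  have "(\<lambda>n. LBINT x:tail_set J c (z n). h x) \<longlonglongrightarrow> integral\<^sup>L lborel (\<lambda>x::real. 0::real)"
    unfolding set_lebesgue_integral_def
  proof (rule integral_dominated_convergence[where w="\<lambda>x. indicator J x * \<bar>h x\<bar>"])
    show "integrable lborel (\<lambda>x. indicator J x * \<bar>h x\<bar>)"
      using set_integrable_abs[OF h] by (simp add: set_integrable_def)
    show "(\<lambda>x. indicator (tail_set J c (z n)) x *\<^sub>R h x) \<in> borel_measurable lborel" for n
      using set_integrable_imp_measurable[OF set_integrable_subset[OF h _ tail_subset]]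
      by (simp add: set_borel_measurable_def)
    show "AE x in lborel. norm (indicator (tail_set J c (z n)) x *\<^sub>R h x) \<le> indicator J x * \<bar>h x\<bar>" for n
      using tail_subset by (intro AE_I2) (auto simp: indicator_def)
    show "AE x in lborel. (\<lambda>n. indicator (tail_set J c (z n)) x *\<^sub>R h x) \<longlonglongrightarrow> 0"
    proof (intro AE_I2)
      fix x
      show "(\<lambda>n. indicator (tail_set J c (z n)) x *\<^sub>R h x) \<longlonglongrightarrow> 0"
      proof (cases "x \<in> J")
        case True
        have "eventually (\<lambda>n. indicator (tail_set J c (z n)) x *\<^sub>R h x = 0) sequentially"
          using eventually_surround[OF True] eventually_surround[OF c]
          by eventually_elim (use z in \<open>auto simp: tail_set_def\<close>)
        then show ?thesis by (rule tendsto_eventually)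
      next
        case False
        then have "x \<notin> tail_set J c (z n)" for n using tail_subset by blast
        then show ?thesis by simp
      qed
    qed
  qed simp
  then show ?thesis by simp
qed

lemma abs_cont_integral_zero:
  assumes "abs_cont_deriv_on J F F'" "set_integrable lborel J F'"
    and "(\<lambda>n. F (l n)) \<longlonglongrightarrow> 0" "(\<lambda>n. F (u n)) \<longlonglongrightarrow> 0"
  shows "(LBINT x:J. F' x) = 0"
proof -
  have "(\<lambda>n. F (u n) - F (l n)) \<longlonglongrightarrow> 0 - 0" using assms by (intro tendsto_diff)
  moreover have "F (u n) - F (l n) = (LBINT x:{l n..u n}. F' x)" for n
    using abs_cont_FTC[OF assms(1) Icc_subset] l_less_u[of n] by simp
  ultimately show ?thesis using integral_exhaust[OF assms(2)] LIMSEQ_unique by auto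
qed

text \<open>A function vanishing at both ends is recovered, up to sign, from either side, so the
  tail pointing away from \<open>c\<close> can be used everywhere. This serves both for
  \<open>W (Suc i)\<close>, whose derivative is the drift times \<open>W i\<close>, and for the
  primitive that solves the Stein equation.\<close>

lemma abs_cont_tail:
  assumes ac: "abs_cont_deriv_on J F F'" and int: "set_integrable lborel J F'"
    and lim: "(\<lambda>n. F (l n)) \<longlonglongrightarrow> 0" "(\<lambda>n. F (u n)) \<longlonglongrightarrow> 0" and x: "x \<in> J"
  shows "(LBINT t:tail_set J c x. F' t) = (if c \<le> x then - F x else F x)"
proof -
  have right: "(LBINT t:J \<inter> {x..}. F' t) = - F x"
  proof -
    have "(\<lambda>n. LBINT t:{x..u n}. F' t) \<longlonglongrightarrow> (LBINT t:(\<Union>n. {x..u n}). F' t)"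
    proof (rule set_integral_cont_up)
      show "incseq (\<lambda>n. {x..u n})" using inc_u by (fastforce simp: incseq_def)
      show "set_integrable lborel (\<Union>n. {x..u n}) F'"
        using Icc_in_J[OF x endpoints_in(2)] by (intro set_integrable_subset[OF int]) auto
    qed auto
    moreover have "(\<Union>n. {x..u n}) = J \<inter> {x..}"
    proof (intro equalityI subsetI)
      fix y assume "y \<in> J \<inter> {x..}"
      then obtain n where "y < u n" "x \<le> y"
        using eventually_surround[of y] by (auto dest: eventually_happens)
      then show "y \<in> (\<Union>n. {x..u n})" by (auto intro!: exI[of _ n])
    next
      fix y assume "y \<in> (\<Union>n. {x..u n})"
      then obtain n where "y \<in> {x..u n}" by blast
      then show "y \<in> J \<inter> {x..}" using Icc_in_J[OF x endpoints_in(2)[of n]] by auto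
    qed
    ultimately have *: "(\<lambda>n. LBINT t:{x..u n}. F' t) \<longlonglongrightarrow> (LBINT t:J \<inter> {x..}. F' t)" by simp
    have "eventually (\<lambda>n. F (u n) - F x = (LBINT t:{x..u n}. F' t)) sequentially"
      using eventually_surround[OF x]
    proof eventually_elim
      case (elim n)
      then show ?case using abs_cont_FTC[OF ac Icc_in_J[OF x endpoints_in(2)], of n] by simp
    qed
    moreover have "(\<lambda>n. F (u n) - F x) \<longlonglongrightarrow> 0 - F x" using lim by (intro tendsto_diff) auto
    ultimately have "(\<lambda>n. LBINT t:{x..u n}. F' t) \<longlonglongrightarrow> 0 - F x" by (rule Lim_transform_eventually[rotated])
    then show ?thesis using LIMSEQ_unique[OF *] by simp
  qed
  have total: "(LBINT t:J. F' t) = 0" using abs_cont_integral_zero[OF ac int lim] .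
  have "(LBINT t:(J \<inter> {..x}) \<union> (J \<inter> {x..}). F' t) =
      (LBINT t:J \<inter> {..x}. F' t) + (LBINT t:J \<inter> {x..}. F' t)"
  proof (rule set_integral_Un_AE)
    show "AE t in lborel. \<not> (t \<in> J \<inter> {..x} \<and> t \<in> J \<inter> {x..})"
      using AE_lborel_singleton[of x] by eventually_elim auto
  qed (auto intro!: set_integrable_subset[OF int])
  moreover have "(J \<inter> {..x}) \<union> (J \<inter> {x..}) = J" by auto
  ultimately show ?thesis using total right by (simp add: tail_set_def)
qed

end

section \<open>The weights of an integrated Pearson density\<close>

text \<open>The analysis up to the residuals rests on these facts about \<open>f\<close> and
  \<open>q\<close> on the support; the last section derives them from the integral identity, for a
  density that is a priori only measurable.\<close>

locale pearson_weight = exhausted_interval +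
  fixes f :: "real \<Rightarrow> real" and \<mu> \<delta> \<beta> \<gamma> :: real
  assumes delta: "\<delta> \<le> 0"
    and f_cont: "continuous_on J f"
    and f_pos: "\<And>x. x \<in> J \<Longrightarrow> 0 < f x"
    and q_pos: "\<And>x. x \<in> J \<Longrightarrow> 0 < qpoly \<delta> \<beta> \<gamma> x"
    and qf_deriv: "\<And>x. x \<in> J \<Longrightarrow>
      ((\<lambda>x. qpoly \<delta> \<beta> \<gamma> x * f x) has_real_derivative (\<mu> - x) * f x) (at x)"
    and f_int: "set_integrable lborel J f"
    and qf_lim: "(\<lambda>n. qpoly \<delta> \<beta> \<gamma> (l n) * f (l n)) \<longlonglongrightarrow> 0"
      "(\<lambda>n. qpoly \<delta> \<beta> \<gamma> (u n) * f (u n)) \<longlonglongrightarrow> 0"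
    and mass: "(LBINT x:J. f x) = 1"
begin

abbreviation q :: "real \<Rightarrow> real" where "q \<equiv> qpoly \<delta> \<beta> \<gamma>"

definition W :: "nat \<Rightarrow> real \<Rightarrow> real" where "W i x = q x ^ i * f x"

definition dd :: "nat \<Rightarrow> real" where "dd i = 1 - 2 * real i * \<delta>"

definition cc :: "nat \<Rightarrow> real" where "cc i = \<mu> + real i * \<beta>"

text \<open>The zero of the drift \<open>cc i - dd i * x\<close>: the maximum point of
  \<open>W (Suc i)\<close> and the mean of the normalised weight \<open>W i\<close>. The Hardy
  inequalities are centred here because \<open>W (Suc i)\<close> decreases away from it.\<close>

definition ctr :: "nat \<Rightarrow> real" where "ctr i = cc i / dd i"

definition qp :: "real poly" where "qp = [:\<gamma>, \<beta>, \<delta>:]"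

lemma poly_qp [simp]: "poly qp x = q x"
  by (simp add: qp_def qpoly_def power2_eq_square algebra_simps)

lemma dd_ge_1: "1 \<le> dd i"
  using delta by (simp add: dd_def mult_nonneg_nonpos)

lemma drift_eq: "cc i - dd i * x = dd i * (ctr i - x)"
  using dd_ge_1[of i] by (simp add: ctr_def field_simps)

lemma W_pos: "x \<in> J \<Longrightarrow> 0 < W i x"
  by (simp add: W_def f_pos q_pos)

lemma W_0: "W 0 = f" by (auto simp: W_def)

lemma W_Suc: "W (Suc i) x = q x * W i x" by (simp add: W_def)

lemma q_cont: "continuous_on S q"
  unfolding qpoly_def[abs_def] by (intro continuous_intros)

lemma W_cont: "continuous_on J (W i)"
  unfolding W_def[abs_def] by (intro continuous_intros q_cont f_cont)

lemma W_deriv: "x \<in> J \<Longrightarrow> (W (Suc i) has_real_derivative (cc i - dd i * x) * W i x) (at x)"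
proof (induction i)
  case 0
  then show ?case using qf_deriv[of x] by (simp add: W_def[abs_def] cc_def dd_def)
next
  case (Suc i)
  have q': "(q has_real_derivative (2 * \<delta> * x + \<beta>)) (at x)"
    unfolding qpoly_def[abs_def] by (auto intro!: derivative_eq_intros)
  have "((\<lambda>x. q x * W (Suc i) x) has_real_derivative
      (2 * \<delta> * x + \<beta>) * W (Suc i) x + q x * ((cc i - dd i * x) * W i x)) (at x)"
    using DERIV_mult[OF q' Suc.IH[OF Suc.prems]] by (simp add: algebra_simps)
  moreover have "(2 * \<delta> * x + \<beta>) * W (Suc i) x + q x * ((cc i - dd i * x) * W i x) =
      (cc (Suc i) - dd (Suc i) * x) * W (Suc i) x"
    by (simp add: W_Suc cc_def dd_def algebra_simps)
  ultimately show ?case by (simp add: W_def[abs_def] mult.assoc)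
qed

lemma abs_cont_W: "abs_cont_deriv_on J (W (Suc i)) (\<lambda>x. (cc i - dd i * x) * W i x)"
  by (rule abs_cont_C1[OF interval_J])
     (auto intro!: has_field_derivative_at_within W_deriv continuous_intros W_cont)

lemma abs_cont_poly_W:
  "abs_cont_deriv_on J (\<lambda>x. poly p x * W (Suc i) x)
     (\<lambda>x. poly (pderiv p) x * W (Suc i) x + poly p x * ((cc i - dd i * x) * W i x))"
  by (rule abs_cont_mult[OF interval_J abs_cont_poly[OF interval_J] abs_cont_W])

lemma continuous_Icc_integrable:
  "continuous_on J h \<Longrightarrow> {a..b} \<subseteq> J \<Longrightarrow> set_integrable lborel {a..b} (h :: real \<Rightarrow> real)"
  by (meson borel_integrable_atLeastAtMost' continuous_on_subset)

lemma mean_in_J: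
  assumes "(\<lambda>n. W (Suc i) (l n)) \<longlonglongrightarrow> 0" "(\<lambda>n. W (Suc i) (u n)) \<longlonglongrightarrow> 0"
  shows "ctr i \<in> J"
proof (rule ccontr)
  text \<open>Otherwise \<open>W\<^sub>i\<^sub>+\<^sub>1\<close> is monotone and positive, and cannot vanish at both ends.\<close>
  assume nJ: "ctr i \<notin> J"
  have W': "(W (Suc i) has_real_derivative dd i * (ctr i - x) * W i x) (at x)" if "x \<in> J" for x
    using W_deriv[OF that, of i] unfolding drift_eq .
  have dW: "0 \<le> dd i * W i x" if "x \<in> J" for x using dd_ge_1[of i] W_pos[OF that, of i] by simp
  have pos: "0 < W (Suc i) x" if "x \<in> J" for x by (rule W_pos[OF that])
  show False
  proof (cases "ctr i < l 0")
    case True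
    have lt: "ctr i < x" if "x \<in> J" for x
      using True nJ Icc_in_J[OF that endpoints_in(1)[of 0]] by (force simp: not_le[symmetric])
    have "W (Suc i) (l 0) \<le> W (Suc i) (l n)" for n
    proof (rule DERIV_nonpos_imp_nonincreasing[where f="W (Suc i)"])
      show "l n \<le> l 0" using dec_l by (simp add: decseq_def)
      show "\<exists>y. (W (Suc i) has_real_derivative y) (at x) \<and> y \<le> 0" if "l n \<le> x" "x \<le> l 0" for x
      proof -
        have x: "x \<in> J" using that Icc_in_J[OF endpoints_in(1) endpoints_in(1), of n 0] by auto
        have "(ctr i - x) * (dd i * W i x) \<le> 0" using lt[OF x] by (intro mult_nonpos_nonneg[OF _ dW[OF x]]) simp
        then show ?thesis using W'[OF x] by (auto simp: mult_ac)
      qed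
    qed
    then show False using LIMSEQ_le_const[OF assms(1), of "W (Suc i) (l 0)"] pos[OF endpoints_in(1)[of 0]] by auto
  next
    case False
    have lt: "x < ctr i" if "x \<in> J" for x
      using False nJ Icc_in_J[OF endpoints_in(1)[of 0] that] by (force simp: not_le[symmetric])
    have "W (Suc i) (u 0) \<le> W (Suc i) (u n)" for n
    proof (rule DERIV_nonneg_imp_nondecreasing[where f="W (Suc i)"])
      show "u 0 \<le> u n" using inc_u by (simp add: incseq_def)
      show "\<exists>y. (W (Suc i) has_real_derivative y) (at x) \<and> 0 \<le> y" if "u 0 \<le> x" "x \<le> u n" for x
      proof -
        have x: "x \<in> J" using that Icc_in_J[OF endpoints_in(2) endpoints_in(2), of 0 n] by auto
        have "0 \<le> (ctr i - x) * (dd i * W i x)" using lt[OF x] by (intro mult_nonneg_nonneg[OF _ dW[OF x]]) simp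
        then show ?thesis using W'[OF x] by (auto simp: mult_ac)
      qed
    qed
    then show False using LIMSEQ_le_const[OF assms(2), of "W (Suc i) (u 0)"] pos[OF endpoints_in(2)[of 0]] by auto
  qed
qed

lemma mu_in_J: "\<mu> \<in> J"
  using mean_in_J[of 0] qf_lim by (simp add: W_def[abs_def] ctr_def cc_def dd_def)

text \<open>Taylor expansion at \<open>c\<close>, whose quadratic term has the sign of \<delta> and
  is dropped. The resulting linear upper bound is the source of all moments.\<close>

lemma q_le: "q x \<le> \<bar>2 * \<delta> * c + \<beta>\<bar> * \<bar>x - c\<bar> + \<bar>q c\<bar>"
proof -
  have "q x = \<delta> * (x - c)^2 + (2 * \<delta> * c + \<beta>) * (x - c) + q c"
    by (simp add: qpoly_def power2_eq_square algebra_simps)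
  moreover have "\<delta> * (x - c)^2 \<le> 0" using delta by (simp add: mult_nonpos_nonneg)
  moreover have "(2 * \<delta> * c + \<beta>) * (x - c) \<le> \<bar>2 * \<delta> * c + \<beta>\<bar> * \<bar>x - c\<bar>"
    unfolding abs_mult[symmetric] by simp
  ultimately show ?thesis by linarith
qed

text \<open>Integrating \<open>((x - \<mu>)\<^sup>k q f)'\<close> with \<open>k\<close> odd, where \<open>\<delta> \<le> 0\<close> bounds \<open>q\<close> by a linear function.\<close>

lemma even_moment: "set_integrable lborel J (\<lambda>x. (x - \<mu>) ^ (2 * j) * f x)"
proof (induction j)
  case 0
  then show ?case using f_int by simp
next
  case (Suc i)
  define k where "k = Suc (2 * i)"
  define y where "y x = x - \<mu>" for x
  define b where "b = \<bar>2 * \<delta> * \<mu> + \<beta>\<bar>"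
  define C where "C = real k * (real k * b^2 + \<bar>q \<mu>\<bar>)"
  let ?M = "LBINT x:J. y x ^ (2 * i) * f x"
  have IH: "set_integrable lborel J (\<lambda>x. y x ^ (2 * i) * f x)" using Suc by (simp add: y_def)
  have nonneg: "0 \<le> y x ^ (2 * j) * f x" if "x \<in> J" for x j
    using f_pos[OF that] zero_le_even_power[of "2 * j" "y x"] by simp
  \<comment> \<open>Bounding \<open>k b |y|\<close> by \<open>y^2 / 2 + (k b)^2 / 2\<close> leaves
    the new moment with the factor 1/2; on a compact piece, where it is finite, it is absorbed into
    the left-hand side.\<close>
  have pw: "real k * y x ^ (2 * i) * q x \<le> y x ^ (k + 1) / 2 + C * y x ^ (2 * i)" for x
  proof -
    have "2 * (real k * b) * \<bar>y x\<bar> \<le> (real k * b)^2 + \<bar>y x\<bar>^2" by (rule sum_squares_bound)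
    moreover have "real k * q x \<le> real k * (b * \<bar>y x\<bar> + \<bar>q \<mu>\<bar>)"
      using q_le[of x \<mu>] by (intro mult_left_mono) (auto simp: b_def y_def)
    moreover have "0 \<le> (real k * b)^2" by simp
    ultimately have "real k * q x \<le> y x ^ 2 / 2 + C"
      by (simp add: C_def power2_eq_square algebra_simps)
    moreover have "0 \<le> y x ^ (2 * i)" by simp
    ultimately have "y x ^ (2 * i) * (real k * q x) \<le> y x ^ (2 * i) * (y x ^ 2 / 2 + C)" by (rule mult_left_mono)
    then show ?thesis
      by (simp add: k_def power2_eq_square algebra_simps)
  qed
  have ac: "abs_cont_deriv_on J (\<lambda>x. y x ^ k * W (Suc 0) x)
     (\<lambda>x. k * y x ^ (2 * i) * q x * f x - y x ^ (k + 1) * f x)"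
  proof (rule abs_cont_C1[OF interval_J])
    fix x assume x: "x \<in> J"
    have y': "((\<lambda>x. y x ^ k) has_real_derivative real k * y x ^ (k - 1)) (at x)"
      unfolding y_def by (auto intro!: derivative_eq_intros)
    have k1: "k - 1 = 2 * i" by (simp add: k_def)
    have "real k * y x ^ (2 * i) * W (Suc 0) x + (cc 0 - dd 0 * x) * W 0 x * y x ^ k =
        k * y x ^ (2 * i) * q x * f x - y x ^ (k + 1) * f x"
      by (simp add: W_def cc_def dd_def y_def left_diff_distrib right_diff_distrib mult_ac)
    then have "((\<lambda>x. y x ^ k * W (Suc 0) x) has_real_derivative
        k * y x ^ (2 * i) * q x * f x - y x ^ (k + 1) * f x) (at x)"
      using DERIV_mult[OF y'[unfolded k1] W_deriv[OF x, of 0]] by (simp only:)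
    then show "((\<lambda>x. y x ^ k * W (Suc 0) x) has_real_derivative
        k * y x ^ (2 * i) * q x * f x - y x ^ (k + 1) * f x) (at x within J)"
      by (rule has_field_derivative_at_within)
  qed (unfold y_def, intro continuous_intros f_cont q_cont)
  have int: "set_integrable lborel {l n..u n} (\<lambda>x. y x ^ m * f x)" for n m
    unfolding y_def by (intro continuous_Icc_integrable Icc_subset continuous_intros f_cont)
  have "eventually (\<lambda>n. (LBINT x:{l n..u n}. y x ^ (k + 1) * f x) \<le> 2 * (C * ?M)) sequentially"
    using eventually_surround[OF mu_in_J]
  proof eventually_elim
    case (elim n)
    let ?I = "LBINT x:{l n..u n}. y x ^ (k + 1) * f x"
    have intD: "set_integrable lborel {l n..u n} (\<lambda>x. k * y x ^ (2 * i) * q x * f x)"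
      unfolding y_def by (intro continuous_Icc_integrable Icc_subset continuous_intros f_cont q_cont)
    have "(LBINT x:{l n..u n}. k * y x ^ (2 * i) * q x * f x - y x ^ (k + 1) * f x) =
        y (u n) ^ k * W (Suc 0) (u n) - y (l n) ^ k * W (Suc 0) (l n)"
      using abs_cont_FTC[OF ac Icc_subset] l_less_u[of n] by simp
    \<comment> \<open>Both boundary terms may be discarded: \<open>y\<close> is positive at
      \<open>u n\<close> and negative at \<open>l n\<close>, and \<open>k\<close> is odd.\<close>
    moreover have "0 \<le> y (u n) ^ k * W (Suc 0) (u n)"
      using elim W_pos[OF endpoints_in(2), of "Suc 0" n] by (simp add: y_def)
    moreover have "y (l n) ^ k * W (Suc 0) (l n) \<le> 0"
      using elim W_pos[OF endpoints_in(1), of "Suc 0" n]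
      by (intro mult_nonpos_nonneg) (auto simp: y_def k_def mult_le_0_iff)
    ultimately have "?I \<le> (LBINT x:{l n..u n}. k * y x ^ (2 * i) * q x * f x)"
      using set_integral_diff(2)[OF intD int[of n "k + 1"]] by simp
    also have "\<dots> \<le> (LBINT x:{l n..u n}. (1/2) * (y x ^ (k + 1) * f x) + C * (y x ^ (2 * i) * f x))"
    proof (rule set_integral_mono[OF intD])
      show "set_integrable lborel {l n..u n} (\<lambda>x. (1/2) * (y x ^ (k + 1) * f x) + C * (y x ^ (2 * i) * f x))"
        using int by (intro set_integral_add(1) set_integrable_mult_right)
      fix x assume "x \<in> {l n..u n}"
      then have "0 < f x" using Icc_subset[of n] f_pos by blast
      then show "k * y x ^ (2 * i) * q x * f x \<le> (1/2) * (y x ^ (k + 1) * f x) + C * (y x ^ (2 * i) * f x)"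
        using mult_right_mono[OF pw[of x], of "f x"] by (simp add: algebra_simps)
    qed
    also have "\<dots> = (1/2) * ?I + C * (LBINT x:{l n..u n}. y x ^ (2 * i) * f x)"
      using int[of n "k+1"] int[of n "2 * i"] by (subst set_integral_add(2)) auto
    also have "(LBINT x:{l n..u n}. y x ^ (2 * i) * f x) \<le> ?M"
      by (rule set_integral_mono_set[OF IH _ Icc_subset nonneg]) simp
    finally show ?case by (simp add: C_def mult_left_mono)
  qed
  then have "set_integrable lborel J (\<lambda>x. y x ^ (k + 1) * f x)"
    using nonneg[of _ "Suc i"] by (intro integrable_exhaust[OF int]) (auto simp: k_def)
  then show ?case by (simp add: y_def k_def)
qed

section \<open>Moments, polynomial integrability and decay at the ends\<close>

lemma abs_moment: "set_integrable lborel J (\<lambda>x. \<bar>x - \<mu>\<bar> ^ j * f x)"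
proof (rule set_integrable_dominated)
  show "set_integrable lborel J (\<lambda>x. f x + (x - \<mu>) ^ (2 * j) * f x)"
    using f_int even_moment by (rule set_integral_add(1))
  show "set_borel_measurable lborel J (\<lambda>x. \<bar>x - \<mu>\<bar> ^ j * f x)"
    by (intro continuous_measurable continuous_intros f_cont)
  fix x assume x: "x \<in> J"
  have "\<bar>x - \<mu>\<bar> ^ j \<le> 1 + (\<bar>x - \<mu>\<bar> ^ j)^2"
    using zero_le_power2[of "\<bar>x - \<mu>\<bar> ^ j - 1"] zero_le_power[OF abs_ge_zero, of "x - \<mu>" j]
    unfolding power2_diff one_power2 by linarith
  also have "(\<bar>x - \<mu>\<bar> ^ j)^2 = (x - \<mu>) ^ (2 * j)"
    by (metis power_even_abs even_mult_iff even_numeral power_mult mult.commute)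
  finally have "\<bar>x - \<mu>\<bar> ^ j * f x \<le> (1 + (x - \<mu>) ^ (2 * j)) * f x"
    using f_pos[OF x] by (intro mult_right_mono) auto
  then show "\<bar>\<bar>x - \<mu>\<bar> ^ j * f x\<bar> \<le> f x + (x - \<mu>) ^ (2 * j) * f x"
    using f_pos[OF x] by (simp add: abs_mult algebra_simps)
qed

lemma poly_centred: "poly p x = (\<Sum>i\<le>degree p. coeff (pcompose p [:\<mu>, 1:]) i * (x - \<mu>) ^ i)"
proof -
  have "poly p x = poly (pcompose p [:\<mu>, 1:]) (x - \<mu>)" by (simp add: poly_pcompose)
  also have "\<dots> = (\<Sum>i\<le>degree p. coeff (pcompose p [:\<mu>, 1:]) i * (x - \<mu>) ^ i)"
    by (simp add: poly_altdef degree_pcompose)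
  finally show ?thesis .
qed

lemma poly_W_integrable: "set_integrable lborel J (\<lambda>x. poly p x * W i x)"
proof -
  have f: "set_integrable lborel J (\<lambda>x. poly r x * f x)" for r
  proof -
    have "set_integrable lborel J (\<lambda>x. (x - \<mu>) ^ i * f x)" for i
    proof (rule set_integrable_dominated[OF abs_moment[of i]])
      show "set_borel_measurable lborel J (\<lambda>x. (x - \<mu>) ^ i * f x)"
        by (intro continuous_measurable continuous_intros f_cont)
    qed (simp add: abs_mult power_abs f_pos less_imp_le)
    then have "set_integrable lborel J (\<lambda>x. coeff (pcompose r [:\<mu>, 1:]) i * ((x - \<mu>) ^ i * f x))" for i
      by (intro set_integrable_mult_right)
    then have "set_integrable lborel J (\<lambda>x. \<Sum>i\<le>degree r. coeff (pcompose r [:\<mu>, 1:]) i * ((x - \<mu>) ^ i * f x))"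
      unfolding set_integrable_def scaleR_sum_right by (intro Bochner_Integration.integrable_sum)
    then show ?thesis by (simp add: poly_centred[of r] sum_distrib_right mult.assoc)
  qed
  show ?thesis using f[of "p * qp ^ i"] by (simp add: W_def mult.assoc poly_power)
qed

lemma W_integrable: "set_integrable lborel J (W i)"
  using poly_W_integrable[of 1] by simp

text \<open>\<open>W (Suc 0) x\<close> is the first absolute moment of \<open>f\<close> about \<mu>
  over the tail beyond \<open>x\<close>, and on that tail \<open>\<bar>x - \<mu>\<bar> ^ k\<close>
  is at most \<open>\<bar>t - \<mu>\<bar> ^ k\<close>. The product is therefore bounded by a tail of
  a convergent moment. Higher weights only add the polynomial factor \<open>q ^ i\<close>.\<close>

lemma poly_W_bdry:
  assumes z: "z = l \<or> z = u"
  shows "(\<lambda>n. poly p (z n) * W (Suc i) (z n)) \<longlonglongrightarrow> 0"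
proof -
  have zJ: "z n \<in> J" for n using z endpoints_in by auto
  have int: "set_integrable lborel J (\<lambda>x. (cc 0 - dd 0 * x) * W 0 x)"
    using poly_W_integrable[of "[:cc 0, - dd 0:]" 0] by (simp add: mult.commute)
  have lim: "(\<lambda>n. W (Suc 0) (l n)) \<longlonglongrightarrow> 0" "(\<lambda>n. W (Suc 0) (u n)) \<longlonglongrightarrow> 0"
    using qf_lim by (simp_all add: W_def)
  have W1: "W (Suc 0) x = (LBINT t:tail_set J \<mu> x. \<bar>t - \<mu>\<bar> * f t)" if x: "x \<in> J" for x
  proof -
    have "(LBINT t:tail_set J \<mu> x. \<bar>t - \<mu>\<bar> * f t) =
      (LBINT t:tail_set J \<mu> x. (if \<mu> \<le> x then -1 else 1) * ((cc 0 - dd 0 * t) * W 0 t))"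
      by (rule set_lebesgue_integral_cong) (auto simp: tail_set_def cc_def dd_def W_def algebra_simps)
    also have "\<dots> = W (Suc 0) x"
      using abs_cont_tail[OF abs_cont_W int lim x] by simp
    finally show ?thesis ..
  qed
  have pw: "(\<lambda>n. \<bar>z n - \<mu>\<bar> ^ k * W (Suc 0) (z n)) \<longlonglongrightarrow> 0" for k
  proof (rule tendsto_sandwich[of "\<lambda>_. 0"])
    show "(\<lambda>n. LBINT t:tail_set J \<mu> (z n). \<bar>t - \<mu>\<bar> ^ Suc k * f t) \<longlonglongrightarrow> 0"
      by (rule tail_integral_tendsto[OF abs_moment mu_in_J z])
    show "\<forall>\<^sub>F n in sequentially. 0 \<le> \<bar>z n - \<mu>\<bar> ^ k * W (Suc 0) (z n)"
      using W_pos[OF zJ] by (intro always_eventually allI mult_nonneg_nonneg) (auto intro: less_imp_le)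
    show "\<forall>\<^sub>F n in sequentially. \<bar>z n - \<mu>\<bar> ^ k * W (Suc 0) (z n) \<le>
        (LBINT t:tail_set J \<mu> (z n). \<bar>t - \<mu>\<bar> ^ Suc k * f t)"
    proof (intro always_eventually allI)
      fix n
      have i: "set_integrable lborel (tail_set J \<mu> (z n)) (\<lambda>t. \<bar>t - \<mu>\<bar> ^ j * f t)" for j
        using set_integrable_subset[OF abs_moment _ tail_subset] by simp
      have "(LBINT t:tail_set J \<mu> (z n). \<bar>z n - \<mu>\<bar> ^ k * (\<bar>t - \<mu>\<bar> * f t)) \<le>
        (LBINT t:tail_set J \<mu> (z n). \<bar>t - \<mu>\<bar> ^ Suc k * f t)"
      proof (rule set_integral_mono)
        show "set_integrable lborel (tail_set J \<mu> (z n)) (\<lambda>t. \<bar>z n - \<mu>\<bar> ^ k * (\<bar>t - \<mu>\<bar> * f t))"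
          using i[of 1] by simp
        show "set_integrable lborel (tail_set J \<mu> (z n)) (\<lambda>t. \<bar>t - \<mu>\<bar> ^ Suc k * f t)" by (rule i)
        fix t assume t: "t \<in> tail_set J \<mu> (z n)"
        then have "0 < f t" using f_pos tail_subset by blast
        then show "\<bar>z n - \<mu>\<bar> ^ k * (\<bar>t - \<mu>\<bar> * f t) \<le> \<bar>t - \<mu>\<bar> ^ Suc k * f t"
          using power_mono[OF tail_far[OF t], of k]
          by (auto intro!: mult_right_mono simp: mult.assoc[symmetric] mult.commute[of _ "\<bar>t - \<mu>\<bar>"] mult_left_mono)
      qed
      then show "\<bar>z n - \<mu>\<bar> ^ k * W (Suc 0) (z n) \<le> (LBINT t:tail_set J \<mu> (z n). \<bar>t - \<mu>\<bar> ^ Suc k * f t)"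
        by (simp add: W1[OF zJ])
    qed
  qed simp
  have "(\<lambda>n. (z n - \<mu>) ^ k * W (Suc 0) (z n)) \<longlonglongrightarrow> 0" for k
    by (rule tendsto_rabs_zero_cancel)
       (use pw[of k] W_pos[OF zJ, of "Suc 0"] in \<open>simp add: abs_mult power_abs less_imp_le\<close>)
  then have "(\<lambda>n. \<Sum>k\<le>degree r. coeff (pcompose r [:\<mu>, 1:]) k * ((z n - \<mu>) ^ k * W (Suc 0) (z n))) \<longlonglongrightarrow>
      (\<Sum>k\<le>degree r. coeff (pcompose r [:\<mu>, 1:]) k * 0)" for r
    by (intro tendsto_intros)
  then have "(\<lambda>n. poly r (z n) * W (Suc 0) (z n)) \<longlonglongrightarrow> 0" for r
    by (simp add: poly_centred[of r] sum_distrib_right mult.assoc)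
  from this[of "p * qp ^ i"] show ?thesis by (simp add: W_def mult_ac poly_power)
qed

lemma W_bdry:
  "(\<lambda>n. W (Suc i) (l n)) \<longlonglongrightarrow> 0" "(\<lambda>n. W (Suc i) (u n)) \<longlonglongrightarrow> 0"
  using poly_W_bdry[of l 1] poly_W_bdry[of u 1] by simp_all

lemma ctr_in_J: "ctr i \<in> J"
  by (rule mean_in_J[OF W_bdry])

end

section \<open>Weighted Hardy inequality for first moments\<close>

text \<open>First \<open>m\<close> makes \<open>\<tau> m\<close> small, then \<open>n\<close> makes
  \<open>b m * e n\<close> small; \<open>b\<close> may be unbounded. In the applications an estimate
  is started at a point indexed by \<open>m\<close> near the end, and \<open>b m\<close> comes from
  the value of the function there.\<close>

lemma double_limit_zero:
  fixes a e \<tau> b :: "nat \<Rightarrow> real"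
  assumes bound: "\<forall>\<^sub>F m in sequentially. \<forall>\<^sub>F n in sequentially. a n \<le> \<tau> m + b m * e n"
    and "\<tau> \<longlonglongrightarrow> 0" "e \<longlonglongrightarrow> 0" "\<And>n. 0 \<le> a n"
  shows "a \<longlonglongrightarrow> 0"
proof (rule LIMSEQ_I)
  fix r :: real assume r: "0 < r"
  have "\<forall>\<^sub>F m in sequentially. \<tau> m < r / 2" using order_tendstoD(2)[OF assms(2), of "r/2"] r by simp
  then have "\<forall>\<^sub>F m in sequentially. \<tau> m < r / 2 \<and> (\<forall>\<^sub>F n in sequentially. a n \<le> \<tau> m + b m * e n)"
    using bound by (rule eventually_conj)
  then obtain m where m: "\<tau> m < r / 2" "\<forall>\<^sub>F n in sequentially. a n \<le> \<tau> m + b m * e n"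
    by (auto dest: eventually_happens)
  have "(\<lambda>n. b m * e n) \<longlonglongrightarrow> b m * 0" using assms(3) by (intro tendsto_intros)
  then have "\<forall>\<^sub>F n in sequentially. b m * e n < r / 2" using r by (intro order_tendstoD(2)) auto
  with m(2) have "\<forall>\<^sub>F n in sequentially. norm (a n - 0) < r"
    by eventually_elim (use m(1) assms(4) in \<open>auto simp: abs_of_nonneg\<close>)
  then show "\<exists>no. \<forall>n\<ge>no. norm (a n - 0) < r" by (simp add: eventually_sequentially)
qed

lemma abs_cont_indefinite_right:
  assumes "set_integrable lborel {c..b} g"
  shows "abs_cont_deriv_on {c..b} (\<lambda>x. LBINT t:{c..x}. g t) (g :: real \<Rightarrow> real)"
  unfolding abs_cont_deriv_on_def
proof (intro ballI impI conjI)
  fix x y assume xy: "x \<in> {c..b}" "y \<in> {c..b}" "x \<le> y"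
  have "set_integrable lborel {c..y} g" using xy by (intro set_integrable_subset[OF assms]) auto
  from set_integral_combine[OF this, of x] xy
  show "(LBINT t:{c..y}. g t) - (LBINT t:{c..x}. g t) = (LBINT t:{x..y}. g t)" by simp
  show "set_integrable lborel {x..y} g" using xy by (intro set_integrable_subset[OF assms]) auto
qed

lemma abs_cont_indefinite_left:
  assumes "set_integrable lborel {a..c} g"
  shows "abs_cont_deriv_on {a..c} (\<lambda>x. LBINT t:{x..c}. g t) (\<lambda>x. - (g x :: real))"
  unfolding abs_cont_deriv_on_def
proof (intro ballI impI conjI)
  fix x y assume xy: "x \<in> {a..c}" "y \<in> {a..c}" "x \<le> y"
  have "set_integrable lborel {x..c} g" using xy by (intro set_integrable_subset[OF assms]) auto
  from set_integral_combine[OF this, of y] xy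
  show "(LBINT t:{y..c}. g t) - (LBINT t:{x..c}. g t) = (LBINT t:{x..y}. - g t)"
    using set_integrable_subset[OF assms, of "{x..y}"] by (simp add: set_integral_uminus)
  show "set_integrable lborel {x..y} (\<lambda>x. - g x)"
    using set_integrable_mult_right[of "-1" lborel "{x..y}" g] xy set_integrable_subset[OF assms, of "{x..y}"] by auto
qed

context pearson_weight
begin

definition KK :: "nat \<Rightarrow> nat \<Rightarrow> real" where
  "KK i j = (real j * \<bar>2 * \<delta> * ctr i + \<beta>\<bar>)^2 + 2 * real j * \<bar>q (ctr i)\<bar> + 1"

text \<open>A smooth replacement for \<open>(1 + \<bar>x\<bar>) ^ j\<close>; the constant is so large that
  \<open>- (\<psi> W\<^sub>i\<^sub>+\<^sub>1)'\<close> has the sign of \<open>x - ctr i\<close> on all of \<open>J\<close>.\<close>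

definition rad :: "nat \<Rightarrow> nat \<Rightarrow> real \<Rightarrow> real" where
  "rad i j x = sqrt (KK i j + (x - ctr i)^2)"

text \<open>The relative rate of decrease of \<open>rad ^ j * W (Suc i)\<close>: the drift
  contributes \<open>dd i\<close>, differentiating \<open>rad ^ j\<close> subtracts the quotient,
  and \<open>KK\<close> is chosen to keep that quotient at most 1/2.\<close>

definition EE :: "nat \<Rightarrow> nat \<Rightarrow> real \<Rightarrow> real" where
  "EE i j x = dd i - real j * q x / (KK i j + (x - ctr i)^2)"

lemma KK_ge_1: "1 \<le> KK i j"
  by (simp add: KK_def)

lemma rad_ge_1: "1 \<le> rad i j x"
  unfolding rad_def using KK_ge_1[of i j] by (simp add: add_increasing2)

lemma rad_ge_abs: "\<bar>x - ctr i\<bar> \<le> rad i j x"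
  unfolding rad_def using KK_ge_1[of i j] by (intro real_le_rsqrt) simp

lemma rad_sq: "rad i j x ^ 2 = KK i j + (x - ctr i)^2"
  unfolding rad_def using KK_ge_1[of i j] by (simp add: add_nonneg_nonneg)

lemma EE_ge_half: "1 / 2 \<le> EE i j x"
proof -
  let ?y = "\<bar>x - ctr i\<bar>" and ?b = "\<bar>2 * \<delta> * ctr i + \<beta>\<bar>" and ?D = "KK i j + (x - ctr i)^2"
  have "real j * q x \<le> real j * (?b * ?y + \<bar>q (ctr i)\<bar>)"
    using q_le[of x "ctr i"] by (intro mult_left_mono) auto
  moreover have "2 * (real j * ?b) * ?y \<le> (real j * ?b)^2 + ?y^2" by (rule sum_squares_bound)
  ultimately have "2 * (real j * q x) \<le> ?D" by (simp add: KK_def algebra_simps)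
  moreover have "0 < ?D" using KK_ge_1[of i j] by (simp add: add_pos_nonneg)
  ultimately have "real j * q x / ?D \<le> 1 / 2" by (simp add: field_simps)
  then show ?thesis using dd_ge_1[of i] unfolding EE_def by linarith
qed

lemma rad_cont: "continuous_on S (rad i j)"
  unfolding rad_def[abs_def] by (intro continuous_intros)

lemma EE_cont: "continuous_on S (EE i j)"
proof -
  have "KK i j + (x - ctr i)^2 \<noteq> 0" for x
    using KK_ge_1[of i j] zero_le_power2[of "x - ctr i"] by linarith
  then show ?thesis unfolding EE_def[abs_def] by (intro continuous_intros q_cont) auto
qed

lemma abs_cont_rad_W:
  "abs_cont_deriv_on J (\<lambda>x. rad i j x ^ j * W (Suc i) x)
     (\<lambda>x. - ((x - ctr i) * EE i j x * (rad i j x ^ j * W i x)))"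
proof (rule abs_cont_C1[OF interval_J])
  fix x assume x: "x \<in> J"
  let ?r = "rad i j x"
  have r0: "?r > 0" using rad_ge_1[of i j x] by linarith
  have D0: "KK i j + (x - ctr i)^2 > 0" using KK_ge_1[of i j] by (simp add: add_pos_nonneg)
  have r': "(rad i j has_real_derivative (x - ctr i) / ?r) (at x)"
    unfolding rad_def[abs_def] using D0 by (auto intro!: derivative_eq_intros simp: field_simps)
  have "((\<lambda>x. rad i j x ^ j * W (Suc i) x) has_real_derivative
     real j * ?r ^ (j - 1) * ((x - ctr i) / ?r) * W (Suc i) x + (cc i - dd i * x) * W i x * ?r ^ j) (at x)"
    using DERIV_mult[OF DERIV_power[OF r', of j] W_deriv[OF x, of i]] by (simp add: mult_ac)
  moreover have "real j * ?r ^ (j - 1) * ((x - ctr i) / ?r) * W (Suc i) x + (cc i - dd i * x) * W i x * ?r ^ j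
     = - ((x - ctr i) * EE i j x * (?r ^ j * W i x))"
  proof -
    have "real j * ?r ^ (j - 1) / ?r = real j * ?r ^ j / ?r^2"
      using r0 by (cases j) (auto simp: power2_eq_square field_simps)
    moreover have "real j * ?r ^ (j - 1) * ((x - ctr i) / ?r) = (x - ctr i) * (real j * ?r ^ (j - 1) / ?r)"
      by simp
    ultimately have *: "real j * ?r ^ (j - 1) * ((x - ctr i) / ?r) = (x - ctr i) * (real j * ?r ^ j / ?r^2)"
      by simp
    define e where "e = real j * q x / ?r^2"
    have **: "real j * ?r ^ (j - 1) * ((x - ctr i) / ?r) * W (Suc i) x = (x - ctr i) * e * (?r ^ j * W i x)"
      unfolding * by (simp add: e_def W_Suc)
    have E: "EE i j x = dd i - e" by (simp add: EE_def rad_sq e_def)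
    show ?thesis unfolding drift_eq ** E by (simp add: algebra_simps)
  qed
  ultimately show "((\<lambda>x. rad i j x ^ j * W (Suc i) x) has_real_derivative
     - ((x - ctr i) * EE i j x * (?r ^ j * W i x))) (at x within J)"
    by (simp add: has_field_derivative_at_within)
qed (intro continuous_intros EE_cont rad_cont W_cont)

text \<open>\<open>x\<close> is beyond \<open>c\<close> as seen from the centre. The disjunction
  lets one estimate serve both ends of \<open>J\<close>; for \<open>c = ctr i\<close> every
  \<open>x\<close> qualifies.\<close>

definition outward :: "nat \<Rightarrow> real \<Rightarrow> real \<Rightarrow> bool" where
  "outward i c x \<longleftrightarrow> ctr i \<le> c \<and> c \<le> x \<or> x \<le> c \<and> c \<le> ctr i"

definition seg :: "real \<Rightarrow> real \<Rightarrow> real set" where "seg c x = {min c x..max c x}"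

lemma seg_subset: "c \<in> J \<Longrightarrow> x \<in> J \<Longrightarrow> seg c x \<subseteq> J"
  unfolding seg_def by (intro Icc_in_J) (auto simp: min_def max_def)

lemma seg_Icc: "c \<le> x \<Longrightarrow> seg c x = {c..x}" "x \<le> c \<Longrightarrow> seg c x = {x..c}"
  by (auto simp: seg_def)

text \<open>Let \<open>V\<close> be the variation of \<open>v\<close> from \<open>c\<close>, and
  integrate the derivative of \<open>V * rad ^ j * W (Suc i)\<close>. Nothing remains at
  \<open>c\<close>, and the weight decreases outwards, so the boundary term at \<open>b\<close> and
  the integral of \<open>V\<close> against the rate of decrease are nonnegative and add up to
  \<open>I\<close>. Then use \<open>\<bar>v - v c\<bar> \<le> V\<close> and
  \<open>EE \<ge> 1 / 2\<close>.\<close>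

lemma tail_L1:
  fixes j :: nat
  assumes v: "abs_cont_deriv_on J v v'" and cb: "c \<in> J" "b \<in> J" "outward i c b"
  defines "I \<equiv> LBINT x:seg c b. \<bar>v' x\<bar> * (rad i j x ^ j * W (Suc i) x)"
  shows "\<bar>v b - v c\<bar> * (rad i j b ^ j * W (Suc i) b) \<le> I"
    and "(LBINT x:seg c b. \<bar>v x - v c\<bar> * (\<bar>x - ctr i\<bar> * (rad i j x ^ j * W i x))) \<le> 2 * I"
proof -
  let ?S = "seg c b"
  have sub: "?S \<subseteq> J" using seg_subset cb by blast
  let ?P = "\<lambda>x. rad i j x ^ j * W (Suc i) x" and ?Q = "\<lambda>x. \<bar>x - ctr i\<bar> * (rad i j x ^ j * W i x)"
  \<comment> \<open>Orientation: 1 to the right of the centre, -1 to the left. It converts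
    \<open>x - ctr i\<close> into its absolute value, so both sides share one computation.\<close>
  define e :: real where "e = (if c \<le> b \<and> ctr i \<le> c then 1 else -1)"
  have sgn: "x - ctr i = e * \<bar>x - ctr i\<bar>" if "x \<in> ?S" for x
    using that cb(3) by (auto simp: seg_def outward_def e_def split: if_splits)
  define V where "V x = (LBINT t:seg c x. \<bar>v' t\<bar>)" for x
  have intv: "set_integrable lborel ?S (\<lambda>t. \<bar>v' t\<bar>)"
    using set_integrable_abs[OF abs_cont_integrable[OF v sub[unfolded seg_def]]] by (simp add: seg_def)
  have V: "abs_cont_deriv_on ?S V (\<lambda>t. e * \<bar>v' t\<bar>)"
  proof (cases "c \<le> b \<and> ctr i \<le> c")
    case True
    have "abs_cont_deriv_on ?S V (\<lambda>t. \<bar>v' t\<bar>) \<longleftrightarrow> abs_cont_deriv_on ?S (\<lambda>x. LBINT t:{c..x}. \<bar>v' t\<bar>) (\<lambda>t. \<bar>v' t\<bar>)"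
      using True by (intro abs_cont_cong) (auto simp: seg_Icc V_def)
    then show ?thesis using abs_cont_indefinite_right[of c b] intv True by (simp add: seg_Icc e_def)
  next
    case False
    then have bc: "b \<le> c" and e: "e = - 1" using cb(3) by (auto simp: outward_def e_def)
    have "abs_cont_deriv_on ?S V (\<lambda>t. - \<bar>v' t\<bar>) \<longleftrightarrow> abs_cont_deriv_on ?S (\<lambda>x. LBINT t:{x..c}. \<bar>v' t\<bar>) (\<lambda>t. - \<bar>v' t\<bar>)"
      using bc by (intro abs_cont_cong) (auto simp: seg_Icc V_def)
    then show ?thesis using abs_cont_indefinite_left[of b c] intv bc by (simp add: seg_Icc e)
  qed
  have V0: "V c = 0"
    using set_integral_combine[of c c "\<lambda>t. \<bar>v' t\<bar>" c] set_integrable_subset[OF intv, of "{c..c}"]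
    by (simp add: V_def seg_def)
  have vV: "\<bar>v x - v c\<bar> \<le> V x" if x: "x \<in> ?S" for x
  proof -
    have xJ: "x \<in> J" using sub x by blast
    have "\<bar>v x - v c\<bar> = \<bar>LBINT t:seg c x. v' t\<bar>"
      using abs_cont_FTC[OF v Icc_in_J[OF cb(1) xJ]] abs_cont_FTC[OF v Icc_in_J[OF xJ cb(1)]]
      by (cases "c \<le> x") (auto simp: seg_Icc)
    then show ?thesis
      using integral_abs_bound[of lborel "\<lambda>t. indicator (seg c x) t *\<^sub>R v' t"]
      by (simp add: V_def set_lebesgue_integral_def abs_mult)
  qed
  have Q0: "0 \<le> ?Q x" if "x \<in> ?S" for x
    using that sub W_pos[of x i] rad_ge_1[of i j x] by (intro mult_nonneg_nonneg) (auto intro: less_imp_le)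
  have P0: "0 \<le> ?P b" using cb W_pos[of b "Suc i"] rad_ge_1[of i j b] by (intro mult_nonneg_nonneg) auto
  note prod = abs_cont_mult_Icc[OF V[unfolded seg_def] abs_cont_subset[OF abs_cont_rad_W[of i j] sub[unfolded seg_def]]]
  have Pc: "continuous_on ?S ?P"
    by (intro continuous_intros rad_cont continuous_on_subset[OF W_cont sub])
  have i1: "set_integrable lborel ?S (\<lambda>x. \<bar>v' x\<bar> * ?P x)"
    using set_integrable_mult_continuous[OF intv[unfolded seg_def] Pc[unfolded seg_def]] by (simp add: seg_def)
  have i2: "set_integrable lborel ?S (\<lambda>x. V x * (EE i j x * ?Q x))"
    unfolding seg_def using sub[unfolded seg_def]
    by (intro borel_integrable_atLeastAtMost' continuous_intros abs_cont_continuous_Icc[OF V[unfolded seg_def]]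
        rad_cont EE_cont continuous_on_subset[OF W_cont])
  have "(LBINT x:?S. e * (\<bar>v' x\<bar> * ?P x - V x * (EE i j x * ?Q x))) =
      (LBINT x:?S. e * \<bar>v' x\<bar> * ?P x + V x * - ((x - ctr i) * EE i j x * (rad i j x ^ j * W i x)))"
  proof (intro set_lebesgue_integral_cong allI impI)
    have "e * (A * P - V * (E * (Y * R))) = e * A * P + V * - (D * E * R)" if "D = e * Y" for A P V E Y R D
      using that by (simp add: algebra_simps)
    then show "e * (\<bar>v' x\<bar> * ?P x - V x * (EE i j x * ?Q x)) =
        e * \<bar>v' x\<bar> * ?P x + V x * - ((x - ctr i) * EE i j x * (rad i j x ^ j * W i x))" if "x \<in> ?S" for x
      using sgn[OF that] by blast
  qed (simp add: seg_def)
  also have "\<dots> = V (max c b) * ?P (max c b) - V (min c b) * ?P (min c b)"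
    unfolding seg_def by (rule prod(2)) simp
  also have "\<dots> = e * (V b * ?P b)"
    using V0 cb(3) by (auto simp: e_def outward_def max_def min_def)
  finally have eq: "I - (LBINT x:?S. V x * (EE i j x * ?Q x)) = V b * ?P b"
    using set_integral_diff(2)[OF i1 i2] by (simp add: I_def e_def split: if_splits)
  have bS: "b \<in> ?S" by (simp add: seg_def)
  have VE: "\<bar>v x - v c\<bar> * ?Q x \<le> 2 * (V x * (EE i j x * ?Q x))" "0 \<le> V x * (EE i j x * ?Q x)" if x: "x \<in> ?S" for x
  proof -
    have V0: "0 \<le> V x" using vV[OF x] by linarith
    have "\<bar>v x - v c\<bar> * ?Q x \<le> V x * ?Q x" using vV[OF x] Q0[OF x] by (rule mult_right_mono)
    also have "V x * ?Q x = 2 * (V x * (1 / 2 * ?Q x))" by simp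
    also have "\<dots> \<le> 2 * (V x * (EE i j x * ?Q x))"
      by (intro mult_left_mono mult_right_mono EE_ge_half V0 Q0[OF x]) simp
    finally show "\<bar>v x - v c\<bar> * ?Q x \<le> 2 * (V x * (EE i j x * ?Q x))" .
    show "0 \<le> V x * (EE i j x * ?Q x)"
      using EE_ge_half[of i j x] by (intro mult_nonneg_nonneg[OF V0] mult_nonneg_nonneg[OF _ Q0[OF x]]) auto
  qed
  have "0 \<le> (LBINT x:?S. V x * (EE i j x * ?Q x))" by (intro set_integral_nonneg_real VE(2))
  moreover have "\<bar>v b - v c\<bar> * ?P b \<le> V b * ?P b" by (rule mult_right_mono[OF vV[OF bS] P0])
  ultimately show "\<bar>v b - v c\<bar> * ?P b \<le> I" using eq by linarith
  have "0 \<le> V b * ?P b" using vV[OF bS] by (intro mult_nonneg_nonneg[OF _ P0]) linarith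
  then have le: "(LBINT x:?S. V x * (EE i j x * ?Q x)) \<le> I" using eq by simp
  have "(LBINT x:?S. \<bar>v x - v c\<bar> * ?Q x) \<le> (LBINT x:?S. 2 * (V x * (EE i j x * ?Q x)))"
  proof (rule set_integral_mono[OF _ _ VE(1)])
    show "set_integrable lborel ?S (\<lambda>x. \<bar>v x - v c\<bar> * ?Q x)"
      unfolding seg_def using sub[unfolded seg_def] by (intro borel_integrable_atLeastAtMost' continuous_intros rad_cont
          continuous_on_subset[OF W_cont] continuous_on_subset[OF abs_cont_continuous[OF v open_J]])
  qed (use i2 in auto)
  also have "\<dots> \<le> 2 * I" using le by simp
  finally show "(LBINT x:?S. \<bar>v x - v c\<bar> * ?Q x) \<le> 2 * I" .
qed

end

section \<open>Differentiation and its adjoint\<close>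

lemma poly_bound: "\<exists>C\<ge>0. \<forall>x::real. \<bar>poly p x\<bar> \<le> C * (1 + \<bar>x\<bar>) ^ degree p"
proof (induction p)
  case 0
  then show ?case by (intro exI[of _ 0]) auto
next
  case (pCons a p)
  then obtain C where C: "C \<ge> 0" "\<And>x. \<bar>poly p x\<bar> \<le> C * (1 + \<bar>x\<bar>) ^ degree p" by blast
  show ?case
  proof (cases "p = 0")
    case True
    then show ?thesis by (intro exI[of _ "\<bar>a\<bar>"]) auto
  next
    case False
    have "\<bar>poly (pCons a p) x\<bar> \<le> (\<bar>a\<bar> + C) * (1 + \<bar>x\<bar>) ^ degree (pCons a p)" for x
    proof -
      let ?t = "1 + \<bar>x\<bar>"
      have "\<bar>poly (pCons a p) x\<bar> \<le> \<bar>a\<bar> + \<bar>x\<bar> * \<bar>poly p x\<bar>"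
        by (simp add: abs_mult[symmetric] abs_triangle_ineq)
      also have "\<dots> \<le> \<bar>a\<bar> * ?t ^ Suc (degree p) + ?t * (C * ?t ^ degree p)"
        using C mult_left_mono[OF one_le_power[of ?t "Suc (degree p)"], of "\<bar>a\<bar>"]
        by (intro add_mono mult_mono) auto
      finally show ?thesis using False by (simp add: algebra_simps)
    qed
    then show ?thesis using C(1) by (intro exI[of _ "\<bar>a\<bar> + C"]) auto
  qed
qed

context pearson_weight
begin

definition Ast :: "nat \<Rightarrow> real poly \<Rightarrow> real poly" where
  "Ast i r = r * [:- cc i, dd i:] - qp * pderiv r"

lemma abs_power_le_poly: "(1 + \<bar>x\<bar>) ^ k \<le> poly ([:2, 0, 1:] ^ k) (x :: real)"
proof -
  have "1 + \<bar>x\<bar> \<le> 2 + x * x"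
    using zero_le_power2[of "\<bar>x\<bar> - 1"] unfolding power2_diff one_power2 by (simp add: power2_eq_square)
  then show ?thesis by (simp add: poly_power power_mono)
qed

lemma abs_power_W_integrable: "set_integrable lborel J (\<lambda>x. (1 + \<bar>x\<bar>) ^ k * W i x)"
proof (rule set_integrable_dominated[OF poly_W_integrable])
  show "set_borel_measurable lborel J (\<lambda>x. (1 + \<bar>x\<bar>) ^ k * W i x)"
    by (intro continuous_measurable continuous_intros W_cont)
  show "\<bar>(1 + \<bar>x\<bar>) ^ k * W i x\<bar> \<le> poly ([:2, 0, 1:] ^ k) x * W i x" if "x \<in> J" for x
    using mult_right_mono[OF abs_power_le_poly[of x k], of "W i x"] W_pos[OF that, of i]
    by (simp add: abs_mult)
qed

text \<open>\<open>rad i j\<close> varies with \<open>i\<close> and \<open>j\<close>. The comparable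
  weight \<open>wt\<close> does not, so that estimates along the chain of weights can be
  composed.\<close>

definition wt :: "nat \<Rightarrow> real \<Rightarrow> real" where "wt k x = (1 + \<bar>x\<bar>) ^ k"

lemma wt_nonneg [simp]: "0 \<le> wt k x" and wt_Suc: "wt (Suc k) x = (1 + \<bar>x\<bar>) * wt k x"
  by (auto simp: wt_def)

lemma rad_le_wt: "\<exists>C\<ge>0. \<forall>x. rad i j x ^ k \<le> C * wt k x"
proof -
  define C where "C = sqrt (KK i j) + \<bar>ctr i\<bar> + 1"
  have sq: "0 \<le> sqrt (KK i j)" using KK_ge_1[of i j] by simp
  have "rad i j x \<le> C * (1 + \<bar>x\<bar>)" for x
  proof -
    have "rad i j x \<le> sqrt (KK i j) + sqrt ((x - ctr i)^2)"
      unfolding rad_def using KK_ge_1[of i j] by (intro sqrt_add_le_add_sqrt) auto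
    also have "\<dots> \<le> sqrt (KK i j) + \<bar>ctr i\<bar> + \<bar>x\<bar>" by simp
    also have "\<dots> \<le> C * (1 + \<bar>x\<bar>)" using sq by (simp add: C_def algebra_simps add_increasing2)
    finally show ?thesis .
  qed
  then have "rad i j x ^ k \<le> C ^ k * wt k x" for x
    unfolding wt_def power_mult_distrib[symmetric] using rad_ge_1[of i j x] by (intro power_mono) auto
  moreover have "0 \<le> C ^ k" using sq by (simp add: C_def)
  ultimately show ?thesis by blast
qed

lemma wt_le_rad: "wt k x \<le> (2 + \<bar>ctr i\<bar>) ^ k * rad i j x ^ k"
proof -
  have "1 + \<bar>x\<bar> \<le> 1 + \<bar>ctr i\<bar> + \<bar>x - ctr i\<bar>" by simp
  also have "\<dots> \<le> (2 + \<bar>ctr i\<bar>) * rad i j x"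
    using rad_ge_1[of i j x] rad_ge_abs[of x i j] mult_left_mono[OF rad_ge_1[of i j x], of "\<bar>ctr i\<bar>"]
    by (simp add: algebra_simps)
  finally show ?thesis unfolding wt_def power_mult_distrib[symmetric] by (intro power_mono) auto
qed

lemma rad_W_bdry:
  assumes z: "z = l \<or> z = u"
  shows "(\<lambda>n. rad i j (z n) ^ j * W (Suc i) (z n)) \<longlonglongrightarrow> 0"
proof -
  have zJ: "z n \<in> J" for n using z endpoints_in by auto
  obtain C where C: "C \<ge> 0" "\<And>x. rad i j x ^ j \<le> C * wt j x" using rad_le_wt by blast
  show ?thesis
  proof (rule tendsto_sandwich[of "\<lambda>_. 0"])
    show "(\<lambda>n. poly (smult C ([:2, 0, 1:] ^ j)) (z n) * W (Suc i) (z n)) \<longlonglongrightarrow> 0"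
      by (rule poly_W_bdry[OF z])
    show "\<forall>\<^sub>F n in sequentially. 0 \<le> rad i j (z n) ^ j * W (Suc i) (z n)"
    proof (intro always_eventually allI mult_nonneg_nonneg)
      fix n show "0 \<le> rad i j (z n) ^ j" using rad_ge_1[of i j "z n"] by simp
      show "0 \<le> W (Suc i) (z n)" using W_pos[OF zJ] by (rule less_imp_le)
    qed
    show "\<forall>\<^sub>F n in sequentially. rad i j (z n) ^ j * W (Suc i) (z n) \<le>
        poly (smult C ([:2, 0, 1:] ^ j)) (z n) * W (Suc i) (z n)"
    proof (intro always_eventually allI mult_right_mono)
      fix n
      have "rad i j (z n) ^ j \<le> C * wt j (z n)" by (rule C(2))
      also have "\<dots> \<le> C * poly ([:2, 0, 1:] ^ j) (z n)"
        unfolding wt_def by (rule mult_left_mono[OF abs_power_le_poly C(1)])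
      finally show "rad i j (z n) ^ j \<le> poly (smult C ([:2, 0, 1:] ^ j)) (z n)" by simp
      show "0 \<le> W (Suc i) (z n)" using W_pos[OF zJ] by (rule less_imp_le)
    qed
  qed simp
qed

lemma rad_W_integrable:
  assumes v: "abs_cont_deriv_on J v v'"
    and int: "set_integrable lborel J (\<lambda>x. \<bar>v' x\<bar> * (wt j x * W (Suc i) x))"
  shows "set_integrable lborel J (\<lambda>x. \<bar>v' x\<bar> * (rad i j x ^ j * W (Suc i) x))"
proof -
  obtain C where C: "C \<ge> 0" "\<And>x. rad i j x ^ j \<le> C * wt j x" using rad_le_wt by blast
  have "set_integrable lborel J (\<lambda>x. C * (\<bar>v' x\<bar> * (wt j x * W (Suc i) x)))" using int by simp
  then show ?thesis
  proof (rule set_integrable_dominated)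
    show "set_borel_measurable lborel J (\<lambda>x. \<bar>v' x\<bar> * (rad i j x ^ j * W (Suc i) x))"
      by (intro set_borel_measurable_mult[OF set_borel_measurable_abs[OF abs_cont_measurable[OF v]]]
          continuous_measurable continuous_intros W_cont rad_cont)
    fix x assume x: "x \<in> J"
    have "\<bar>v' x\<bar> * (rad i j x ^ j * W (Suc i) x) \<le> \<bar>v' x\<bar> * (C * wt j x * W (Suc i) x)"
      using C W_pos[OF x, of "Suc i"] by (intro mult_left_mono mult_right_mono) auto
    moreover have "0 \<le> \<bar>v' x\<bar> * (rad i j x ^ j * W (Suc i) x)"
      using rad_ge_1[of i j x] W_pos[OF x, of "Suc i"] by (intro mult_nonneg_nonneg) auto
    ultimately show "\<bar>\<bar>v' x\<bar> * (rad i j x ^ j * W (Suc i) x)\<bar> \<le> C * (\<bar>v' x\<bar> * (wt j x * W (Suc i) x))"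
      by (simp add: mult_ac)
  qed
qed

text \<open>Passing from \<open>v'\<close> to \<open>v\<close> gains one power of
  \<open>1 + \<bar>x\<bar>\<close>: exactly the power that \<open>Ast\<close> adds to the degree of
  a polynomial. Away from the centre this is \<open>tail_L1\<close>; near it the factor
  \<open>\<bar>x - s\<bar>\<close> degenerates, and boundedness of \<open>v\<close> on a compact
  interval is used.\<close>

lemma hardy_L1:
  assumes v: "abs_cont_deriv_on J v v'"
    and int: "set_integrable lborel J (\<lambda>x. \<bar>v' x\<bar> * (wt j x * W (Suc i) x))"
  shows "set_integrable lborel J (\<lambda>x. \<bar>v x\<bar> * (wt (Suc j) x * W i x))"
proof -
  note int' = rad_W_integrable[OF v int]
  define s where "s = ctr i"
  have sJ: "s \<in> J" unfolding s_def by (rule ctr_in_J)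
  have vc: "continuous_on J v" by (rule abs_cont_continuous[OF v open_J])
  let ?I = "LBINT x:J. \<bar>v' x\<bar> * (rad i j x ^ j * W (Suc i) x)"
  let ?g = "\<lambda>x. \<bar>v x - v s\<bar> * (\<bar>x - s\<bar> * (rad i j x ^ j * W i x))"
  have nonneg: "0 \<le> \<bar>v' x\<bar> * (rad i j x ^ j * W (Suc i) x)" if "x \<in> J" for x
    using rad_ge_1[of i j x] W_pos[OF that, of "Suc i"] by (intro mult_nonneg_nonneg) auto
  have gc: "continuous_on J ?g"
    by (intro continuous_intros vc W_cont rad_cont)
  have g: "set_integrable lborel J ?g"
  proof (rule integrable_exhaust)
    show "set_integrable lborel {l n..u n} ?g" for n
      by (rule continuous_Icc_integrable[OF gc Icc_subset])
    show "0 \<le> ?g x" if "x \<in> J" for x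
      using rad_ge_1[of i j x] W_pos[OF that, of i] by (intro mult_nonneg_nonneg) auto
    show "\<forall>\<^sub>F n in sequentially. (LBINT x:{l n..u n}. ?g x) \<le> 4 * ?I"
      using eventually_surround[OF sJ]
    proof eventually_elim
      case (elim n)
      have half: "(LBINT x:seg s y. ?g x) \<le> 2 * ?I" if y: "y \<in> J" for y
      proof -
        have "(LBINT x:seg s y. ?g x) \<le> 2 * (LBINT x:seg s y. \<bar>v' x\<bar> * (rad i j x ^ j * W (Suc i) x))"
          unfolding s_def using linear[of "ctr i" y] by (intro tail_L1(2)[OF v ctr_in_J y]) (auto simp: outward_def)
        also have "\<dots> \<le> 2 * ?I"
          using seg_subset[OF sJ y] nonneg by (intro mult_left_mono set_integral_mono_set[OF int']) (auto simp: seg_def)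
        finally show ?thesis .
      qed
      have 1: "(LBINT x:{s..u n}. ?g x) \<le> 2 * ?I" and 2: "(LBINT x:{l n..s}. ?g x) \<le> 2 * ?I"
        using half[OF endpoints_in(2)[of n]] half[OF endpoints_in(1)[of n]] elim by (simp_all add: seg_Icc)
      show ?case
        using set_integral_combine[OF continuous_Icc_integrable[OF gc Icc_subset], of n s] elim 1 2 by simp
    qed
  qed
  obtain a b where ab: "a < s" "s < b" "{a..b} \<subseteq> J" using open_interval_Icc_around[OF open_J sJ] .
  obtain M where M: "\<And>x. x \<in> {a..b} \<Longrightarrow> \<bar>v x\<bar> \<le> M"
    using compact_imp_bounded[OF compact_continuous_image[OF continuous_on_subset[OF vc ab(3)] compact_Icc]]
    by (fastforce simp: bounded_iff)
  have M0: "0 \<le> M" using M[of s] ab by (auto intro: order_trans[OF abs_ge_zero])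
  define \<eta> where "\<eta> = min (s - a) (b - s)"
  have \<eta>: "0 < \<eta>" using ab by (simp add: \<eta>_def)
  define C where "C = (2 + \<bar>s\<bar>) ^ Suc j * sqrt (KK i j / \<eta>^2 + 1)"
  have C0: "0 \<le> C" using KK_ge_1[of i j] by (simp add: C_def)
  have "set_integrable lborel J (\<lambda>x. C * ?g x + (\<bar>v s\<bar> + M) * (wt (Suc j) x * W i x))"
    using g abs_power_W_integrable[of "Suc j" i] unfolding wt_def by (intro set_integral_add(1)) auto
  then show ?thesis
  proof (rule set_integrable_dominated)
    show "set_borel_measurable lborel J (\<lambda>x. \<bar>v x\<bar> * (wt (Suc j) x * W i x))"
      unfolding wt_def by (intro continuous_measurable continuous_intros vc W_cont)
    fix x assume x: "x \<in> J"
    have w0: "0 \<le> wt (Suc j) x * W i x" using W_pos[OF x, of i] by simp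
    have g0: "0 \<le> ?g x" using rad_ge_1[of i j x] W_pos[OF x, of i] by (intro mult_nonneg_nonneg) auto
    have "\<bar>v x\<bar> * (wt (Suc j) x * W i x) \<le> C * ?g x + (\<bar>v s\<bar> + M) * (wt (Suc j) x * W i x)"
    proof (cases "x \<in> {a..b}")
      case True
      have "\<bar>v x\<bar> * (wt (Suc j) x * W i x) \<le> (\<bar>v s\<bar> + M) * (wt (Suc j) x * W i x)"
        using M[OF True] w0 by (intro mult_right_mono) auto
      then show ?thesis using g0 C0 by (simp add: add_increasing)
    next
      case False
      have far: "\<eta> \<le> \<bar>x - s\<bar>" using False by (auto simp: \<eta>_def)
      define A where "A = KK i j / \<eta>^2"
      have A0: "0 \<le> A" using KK_ge_1[of i j] by (simp add: A_def)
      have "rad i j x ^ 2 = A * \<eta>^2 + (x - s)^2" using \<eta> by (simp add: rad_sq s_def A_def)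
      also have "\<dots> \<le> A * (x - s)^2 + (x - s)^2"
        using power_mono[OF far, of 2] \<eta> A0 by (intro add_right_mono mult_left_mono) auto
      also have "\<dots> = (A + 1) * (x - s)^2" by (simp add: distrib_right)
      also have "\<dots> = (sqrt (A + 1) * \<bar>x - s\<bar>)^2"
        using A0 by (simp add: power_mult_distrib)
      finally have r: "rad i j x \<le> sqrt (KK i j / \<eta>^2 + 1) * \<bar>x - s\<bar>"
        unfolding A_def[symmetric] using A0 by (intro power2_le_imp_le[of "rad i j x"] mult_nonneg_nonneg) auto
      have "wt (Suc j) x \<le> (2 + \<bar>s\<bar>) ^ Suc j * rad i j x ^ Suc j" unfolding s_def by (rule wt_le_rad)
      also have "\<dots> = (2 + \<bar>s\<bar>) ^ Suc j * (rad i j x * rad i j x ^ j)" by simp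
      also have "\<dots> \<le> (2 + \<bar>s\<bar>) ^ Suc j * (sqrt (KK i j / \<eta>^2 + 1) * \<bar>x - s\<bar> * rad i j x ^ j)"
        using r rad_ge_1[of i j x] by (intro mult_left_mono mult_right_mono) auto
      finally have wt: "wt (Suc j) x \<le> C * (\<bar>x - s\<bar> * rad i j x ^ j)" by (simp add: C_def mult.assoc)
      have "\<bar>v x - v s\<bar> * (wt (Suc j) x * W i x) \<le> \<bar>v x - v s\<bar> * (C * (\<bar>x - s\<bar> * rad i j x ^ j) * W i x)"
        using wt W_pos[OF x, of i] by (intro mult_left_mono mult_right_mono) auto
      also have "\<dots> = C * ?g x" by (simp add: mult_ac)
      finally have 1: "\<bar>v x - v s\<bar> * (wt (Suc j) x * W i x) \<le> C * ?g x" .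
      have "\<bar>v x\<bar> * (wt (Suc j) x * W i x) \<le> (\<bar>v x - v s\<bar> + (\<bar>v s\<bar> + M)) * (wt (Suc j) x * W i x)"
        using w0 M0 by (intro mult_right_mono) auto
      then show ?thesis using 1 by (simp add: algebra_simps)
    qed
    then show "\<bar>\<bar>v x\<bar> * (wt (Suc j) x * W i x)\<bar> \<le> C * ?g x + (\<bar>v s\<bar> + M) * (wt (Suc j) x * W i x)"
      using W_pos[OF x, of i] by (simp add: abs_mult)
  qed
qed

lemma endpoint_tail:
  assumes z: "z = l \<or> z = u"
  shows "\<forall>\<^sub>F m in sequentially. \<forall>n\<ge>m. outward i (z m) (z n) \<and> z m \<noteq> ctr i \<and>
    seg (z m) (z n) \<subseteq> tail_set J (ctr i) (z m)"
  using eventually_surround[OF ctr_in_J[of i]]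
proof eventually_elim
  case (elim m)
  have "z k \<in> J" for k using z endpoints_in by auto
  then have "seg (z m) (z n) \<subseteq> J" for n by (intro seg_subset)
  then show ?case using elim z inc_u dec_l
    by (auto simp: incseq_def decseq_def outward_def tail_set_def seg_def subset_iff split: if_splits)
qed

text \<open>Comparison with an intermediate point: \<open>tail_L1\<close> started at
  \<open>z m\<close> bounds the increment \<open>v (z n) - v (z m)\<close>, weighted at
  \<open>z n\<close>, by a tail integral depending on \<open>m\<close> only. The remaining
  \<open>v (z m)\<close> is multiplied by a weight tending to 0.\<close>

lemma bdry_L1:
  assumes v: "abs_cont_deriv_on J v v'"
    and int: "set_integrable lborel J (\<lambda>x. \<bar>v' x\<bar> * (wt j x * W (Suc i) x))"
    and z: "z = l \<or> z = u"
  shows "(\<lambda>n. \<bar>v (z n)\<bar> * (wt j (z n) * W (Suc i) (z n))) \<longlonglongrightarrow> 0"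
proof -
  have zJ: "z n \<in> J" for n using z endpoints_in by auto
  note int' = rad_W_integrable[OF v int]
  have nonneg: "0 \<le> \<bar>v' x\<bar> * (rad i j x ^ j * W (Suc i) x)" if "x \<in> J" for x
    using rad_ge_1[of i j x] W_pos[OF that, of "Suc i"] by (intro mult_nonneg_nonneg) auto
  have nonnegT: "0 \<le> \<bar>v' x\<bar> * (rad i j x ^ j * W (Suc i) x)" if "x \<in> tail_set J c y" for x c y
    using nonneg that tail_subset[of c y] by blast
  let ?P = "\<lambda>x. rad i j x ^ j * W (Suc i) x"
  let ?T = "\<lambda>m. LBINT x:tail_set J (ctr i) (z m). \<bar>v' x\<bar> * ?P x"
  have P0: "0 \<le> ?P (z n)" for n
    using rad_ge_1[of i j "z n"] W_pos[OF zJ, of "Suc i" n] by (intro mult_nonneg_nonneg) auto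
  have key: "\<bar>v (z n) - v (z m)\<bar> * ?P (z n) \<le> ?T m"
    if "outward i (z m) (z n)" and sp: "seg (z m) (z n) \<subseteq> tail_set J (ctr i) (z m)" for m n
  proof -
    have "(LBINT x:seg (z m) (z n). \<bar>v' x\<bar> * ?P x) \<le> ?T m"
      using sp by (intro set_integral_mono_set set_integrable_subset[OF int' _ tail_subset] nonnegT) (auto simp: seg_def)
    then show ?thesis using tail_L1(1)[OF v zJ zJ that(1), of j] by linarith
  qed
  have rad: "(\<lambda>n. \<bar>v (z n)\<bar> * ?P (z n)) \<longlonglongrightarrow> 0"
  proof (rule double_limit_zero)
    show "?T \<longlonglongrightarrow> 0" by (rule tail_integral_tendsto[OF int' ctr_in_J z])
    show "(\<lambda>n. ?P (z n)) \<longlonglongrightarrow> 0" by (rule rad_W_bdry[OF z])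
    show "\<forall>\<^sub>F m in sequentially. \<forall>\<^sub>F n in sequentially.
        \<bar>v (z n)\<bar> * ?P (z n) \<le> ?T m + \<bar>v (z m)\<bar> * ?P (z n)"
      using endpoint_tail[OF z, of i]
    proof eventually_elim
      case (elim m)
      have "\<bar>v (z n)\<bar> * ?P (z n) \<le> ?T m + \<bar>v (z m)\<bar> * ?P (z n)" if "n \<ge> m" for n
      proof -
        have "\<bar>v (z n)\<bar> * ?P (z n) \<le> (\<bar>v (z n) - v (z m)\<bar> + \<bar>v (z m)\<bar>) * ?P (z n)"
          using P0 by (intro mult_right_mono) auto
        then show ?thesis using key[of m n] elim that by (auto simp: algebra_simps)
      qed
      then show ?case unfolding eventually_sequentially by blast
    qed
    show "0 \<le> \<bar>v (z n)\<bar> * ?P (z n)" for n using P0 by (intro mult_nonneg_nonneg[of "\<bar>v (z n)\<bar>"]) auto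
  qed
  show ?thesis
  proof (rule tendsto_sandwich[of "\<lambda>_. 0"])
    show "(\<lambda>n. (2 + \<bar>ctr i\<bar>) ^ j * (\<bar>v (z n)\<bar> * ?P (z n))) \<longlonglongrightarrow> 0"
      using tendsto_mult_left[OF rad, of "(2 + \<bar>ctr i\<bar>) ^ j"] by simp
    show "\<forall>\<^sub>F n in sequentially. 0 \<le> \<bar>v (z n)\<bar> * (wt j (z n) * W (Suc i) (z n))"
      using W_pos[OF zJ, of "Suc i"] by (intro always_eventually allI mult_nonneg_nonneg) (auto intro: less_imp_le)
    show "\<forall>\<^sub>F n in sequentially. \<bar>v (z n)\<bar> * (wt j (z n) * W (Suc i) (z n)) \<le>
        (2 + \<bar>ctr i\<bar>) ^ j * (\<bar>v (z n)\<bar> * ?P (z n))"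
    proof (intro always_eventually allI)
      fix n
      have "\<bar>v (z n)\<bar> * (wt j (z n) * W (Suc i) (z n)) \<le>
        \<bar>v (z n)\<bar> * ((2 + \<bar>ctr i\<bar>) ^ j * rad i j (z n) ^ j * W (Suc i) (z n))"
        using W_pos[OF zJ, of "Suc i" n] by (intro mult_left_mono mult_right_mono wt_le_rad) auto
      then show "\<bar>v (z n)\<bar> * (wt j (z n) * W (Suc i) (z n)) \<le>
        (2 + \<bar>ctr i\<bar>) ^ j * (\<bar>v (z n)\<bar> * ?P (z n))" by (simp add: mult_ac)
    qed
  qed simp
qed

lemma poly_mult_integrable:
  assumes h: "set_borel_measurable lborel J h"
    and int: "set_integrable lborel J (\<lambda>x. \<bar>h x\<bar> * (wt j x * W i x))" and deg: "degree r \<le> j"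
  shows "set_integrable lborel J (\<lambda>x. h x * (poly r x * W i x))"
proof -
  obtain C where C: "C \<ge> 0" "\<And>x. \<bar>poly r x\<bar> \<le> C * (1 + \<bar>x\<bar>) ^ degree r" using poly_bound by blast
  have "set_integrable lborel J (\<lambda>x. C * (\<bar>h x\<bar> * (wt j x * W i x)))" using int by simp
  then show ?thesis
  proof (rule set_integrable_dominated)
    show "set_borel_measurable lborel J (\<lambda>x. h x * (poly r x * W i x))"
      by (intro set_borel_measurable_mult[OF h] continuous_measurable continuous_intros W_cont)
    fix x assume x: "x \<in> J"
    have "\<bar>poly r x\<bar> \<le> C * wt j x"
      using C(2)[of x] mult_left_mono[OF power_increasing[OF deg, of "1 + \<bar>x\<bar>"] C(1)] by (simp add: wt_def)
    then have "\<bar>h x\<bar> * (\<bar>poly r x\<bar> * W i x) \<le> \<bar>h x\<bar> * (C * wt j x * W i x)"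
      using W_pos[OF x, of i] by (intro mult_left_mono mult_right_mono) auto
    then show "\<bar>h x * (poly r x * W i x)\<bar> \<le> C * (\<bar>h x\<bar> * (wt j x * W i x))"
      using W_pos[OF x, of i] by (simp add: abs_mult mult_ac)
  qed
qed

lemma poly_Ast: "poly (Ast i r) x * W i x = - (poly r x * ((cc i - dd i * x) * W i x)) - poly (pderiv r) x * W (Suc i) x"
  by (simp add: Ast_def W_Suc algebra_simps)

lemma degree_Ast_le: "degree (Ast i r) \<le> Suc (degree r)"
proof -
  have "degree (r * [:- cc i, dd i:]) \<le> degree r + 1"
    by (rule order_trans[OF degree_mult_le]) simp
  moreover have "degree (qp * pderiv r) \<le> Suc (degree r)"
  proof (cases "degree r = 0")
    case True
    then have "pderiv r = 0" by (simp add: pderiv_eq_0_iff)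
    then show ?thesis by simp
  next
    case False
    have "degree qp \<le> 2" by (simp add: qp_def)
    then show ?thesis using degree_mult_le[of qp "pderiv r"] False by (simp add: degree_pderiv)
  qed
  ultimately show ?thesis unfolding Ast_def by (intro degree_diff_le) auto
qed

text \<open>By \<open>poly_Ast\<close>, the derivative of \<open>poly r * W (Suc i)\<close> is
  \<open>- poly (Ast i r) * W i\<close>; integrate the derivative of
  \<open>v * poly r * W (Suc i)\<close>. Integrability is assumed for \<open>v'\<close> alone:
  \<open>hardy_L1\<close> supplies it for \<open>v\<close>, and \<open>bdry_L1\<close> the boundary
  limits.\<close>

lemma adjoint_L1:
  assumes v: "abs_cont_deriv_on J v v'"
    and int: "set_integrable lborel J (\<lambda>x. \<bar>v' x\<bar> * (wt j x * W (Suc i) x))"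
    and deg: "degree r \<le> j"
  shows "(LBINT x:J. v x * (poly (Ast i r) x * W i x)) = (LBINT x:J. v' x * (poly r x * W (Suc i) x))"
proof -
  have vc: "continuous_on J v" by (rule abs_cont_continuous[OF v open_J])
  have i1: "set_integrable lborel J (\<lambda>x. v' x * (poly r x * W (Suc i) x))"
    by (rule poly_mult_integrable[OF abs_cont_measurable[OF v] int deg])
  have i2: "set_integrable lborel J (\<lambda>x. v x * (poly (Ast i r) x * W i x))"
    using degree_Ast_le[of i r] deg
    by (intro poly_mult_integrable[OF continuous_measurable[OF vc] hardy_L1[OF v int]]) auto
  have eq: "v' x * (poly r x * W (Suc i) x) +
      v x * (poly (pderiv r) x * W (Suc i) x + poly r x * ((cc i - dd i * x) * W i x)) =
      v' x * (poly r x * W (Suc i) x) - v x * (poly (Ast i r) x * W i x)" for x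
    unfolding poly_Ast by (simp add: algebra_simps)
  have ac: "abs_cont_deriv_on J (\<lambda>x. v x * (poly r x * W (Suc i) x))
     (\<lambda>x. v' x * (poly r x * W (Suc i) x) - v x * (poly (Ast i r) x * W i x))"
    using abs_cont_mult[OF interval_J v abs_cont_poly_W[of r i]] unfolding eq .
  have lim: "(\<lambda>n. v (z n) * (poly r (z n) * W (Suc i) (z n))) \<longlonglongrightarrow> 0" if z: "z = l \<or> z = u" for z
  proof -
    have zJ: "z n \<in> J" for n using z endpoints_in by auto
    obtain C where C: "C \<ge> 0" "\<And>x. \<bar>poly r x\<bar> \<le> C * (1 + \<bar>x\<bar>) ^ degree r" using poly_bound by blast
    have le: "norm (v (z n) * (poly r (z n) * W (Suc i) (z n))) \<le> C * (\<bar>v (z n)\<bar> * (wt j (z n) * W (Suc i) (z n)))" for n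
    proof -
      have "\<bar>poly r (z n)\<bar> \<le> C * wt j (z n)"
        using C(2)[of "z n"] mult_left_mono[OF power_increasing[OF deg, of "1 + \<bar>z n\<bar>"] C(1)] by (simp add: wt_def)
      then have "\<bar>v (z n)\<bar> * (\<bar>poly r (z n)\<bar> * W (Suc i) (z n)) \<le> \<bar>v (z n)\<bar> * (C * wt j (z n) * W (Suc i) (z n))"
        using W_pos[OF zJ, of "Suc i" n] by (intro mult_left_mono mult_right_mono) auto
      then show ?thesis using W_pos[OF zJ, of "Suc i" n] by (simp add: abs_mult mult_ac)
    qed
    have "(\<lambda>n. C * (\<bar>v (z n)\<bar> * (wt j (z n) * W (Suc i) (z n)))) \<longlonglongrightarrow> 0"
      using tendsto_mult_left[OF bdry_L1[OF v int z], of C] by simp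
    then show ?thesis by (rule Lim_null_comparison[OF always_eventually[OF allI[OF le]]])
  qed
  have "(LBINT x:J. v' x * (poly r x * W (Suc i) x) - v x * (poly (Ast i r) x * W i x)) = 0"
    by (rule abs_cont_integral_zero[OF ac set_integral_diff(1)[OF i1 i2] lim lim]) auto
  then show ?thesis using set_integral_diff(2)[OF i1 i2] by simp
qed

end

section \<open>Weighted Hardy inequality for second moments\<close>

lemma weighted_Cauchy_Schwarz:
  fixes h k w :: "'a \<Rightarrow> real"
  assumes meas: "set_borel_measurable M A h" "set_borel_measurable M A k" "set_borel_measurable M A w"
    and w: "\<And>x. x \<in> A \<Longrightarrow> 0 \<le> w x"
    and h2: "set_integrable M A (\<lambda>x. h x ^ 2 * w x)" and k2: "set_integrable M A (\<lambda>x. k x ^ 2 * w x)"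
  shows "set_integrable M A (\<lambda>x. h x * k x * w x)"
    and "(LINT x:A|M. h x * k x * w x)^2 \<le> (LINT x:A|M. h x ^ 2 * w x) * (LINT x:A|M. k x ^ 2 * w x)"
proof -
  have "set_integrable M A (\<lambda>x. h x ^ 2 * w x + k x ^ 2 * w x)" using h2 k2 by (rule set_integral_add(1))
  then show hk: "set_integrable M A (\<lambda>x. h x * k x * w x)"
  proof (rule set_integrable_dominated)
    show "set_borel_measurable M A (\<lambda>x. h x * k x * w x)"
      using meas by (intro set_borel_measurable_mult)
    fix x assume x: "x \<in> A"
    have "2 * (\<bar>h x\<bar> * \<bar>k x\<bar>) \<le> h x ^ 2 + k x ^ 2"
      using sum_squares_bound[of "\<bar>h x\<bar>" "\<bar>k x\<bar>"] by simp
    then have "\<bar>h x\<bar> * \<bar>k x\<bar> \<le> h x ^ 2 + k x ^ 2"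
      using mult_nonneg_nonneg[of "\<bar>h x\<bar>" "\<bar>k x\<bar>"] by linarith
    from mult_right_mono[OF this w[OF x]] show "\<bar>h x * k x * w x\<bar> \<le> h x ^ 2 * w x + k x ^ 2 * w x"
      using w[OF x] by (simp add: abs_mult algebra_simps)
  qed
  let ?a = "LINT x:A|M. h x ^ 2 * w x" and ?b = "LINT x:A|M. h x * k x * w x" and ?c = "LINT x:A|M. k x ^ 2 * w x"
  have quad: "0 \<le> ?a - 2 * t * ?b + t^2 * ?c" for t
  proof -
    have "0 \<le> (LINT x:A|M. (h x - t * k x)^2 * w x)"
      using w by (intro set_integral_nonneg_real) auto
    also have "\<dots> = (LINT x:A|M. (h x ^ 2 * w x - (2 * t) * (h x * k x * w x)) + t^2 * (k x ^ 2 * w x))"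
      by (simp add: power2_eq_square algebra_simps)
    also have "\<dots> = ?a - 2 * t * ?b + t^2 * ?c"
      using h2 hk k2 by (simp add: set_integral_add(2) set_integral_diff)
    finally show ?thesis .
  qed
  show "?b^2 \<le> ?a * ?c"
  proof (cases "?c = 0")
    case True
    have "?b = 0"
    proof (rule ccontr)
      assume b: "?b \<noteq> 0"
      \<comment> \<open>When \<open>?c = 0\<close> the quadratic is affine in \<open>t\<close>; at
        this \<open>t\<close> it equals -1.\<close>
      show False using quad[of "(?a + 1) / (2 * ?b)"] True b by simp
    qed
    then show ?thesis using True by simp
  next
    case False
    moreover have "0 \<le> ?c" using w by (intro set_integral_nonneg_real) auto
    ultimately have c: "0 < ?c" by linarith
    have "0 \<le> ?a - 2 * (?b / ?c) * ?b + (?b / ?c)^2 * ?c" by (rule quad)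
    also have "\<dots> = ?a - ?b^2 / ?c" using c by (simp add: field_simps power2_eq_square)
    finally show ?thesis using c by (simp add: field_simps)
  qed
qed

context pearson_weight
begin

abbreviation nrm :: "nat \<Rightarrow> (real \<Rightarrow> real) \<Rightarrow> real" where
  "nrm i h \<equiv> LBINT x:J. h x ^ 2 * W i x"

abbreviation ip :: "nat \<Rightarrow> (real \<Rightarrow> real) \<Rightarrow> (real \<Rightarrow> real) \<Rightarrow> real" where
  "ip i h k \<equiv> LBINT x:J. h x * k x * W i x"

definition L2 :: "nat \<Rightarrow> (real \<Rightarrow> real) \<Rightarrow> bool" where
  "L2 i h \<longleftrightarrow> set_borel_measurable lborel J h \<and> set_integrable lborel J (\<lambda>x. h x ^ 2 * W i x)"

lemma W_measurable: "set_borel_measurable lborel J (W i)"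
  by (intro continuous_measurable W_cont)

lemma L2_int: "L2 i h \<Longrightarrow> set_integrable lborel J (\<lambda>x. h x ^ 2 * W i x)"
  by (simp add: L2_def)

lemma nrm_nonneg: "0 \<le> nrm i h"
  by (intro set_integral_nonneg_real mult_nonneg_nonneg) (auto intro: less_imp_le W_pos)

lemma ip_int: "L2 i h \<Longrightarrow> L2 i k \<Longrightarrow> set_integrable lborel J (\<lambda>x. h x * k x * W i x)"
  by (rule weighted_Cauchy_Schwarz) (auto simp: L2_def W_measurable intro: less_imp_le W_pos)

lemma ip_CS: "L2 i h \<Longrightarrow> L2 i k \<Longrightarrow> (ip i h k)^2 \<le> nrm i h * nrm i k"
  by (rule weighted_Cauchy_Schwarz) (auto simp: L2_def W_measurable intro: less_imp_le W_pos)

lemma L2_continuous_bound: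
  assumes "continuous_on J h" "\<And>x. \<bar>h x\<bar> \<le> C * wt k x"
  shows "L2 i h"
  unfolding L2_def
proof
  show "set_borel_measurable lborel J h" by (rule continuous_measurable[OF assms(1)])
  have "set_integrable lborel J (\<lambda>x. C^2 * ((1 + \<bar>x\<bar>) ^ (2 * k) * W i x))"
    using abs_power_W_integrable by simp
  then show "set_integrable lborel J (\<lambda>x. h x ^ 2 * W i x)"
  proof (rule set_integrable_dominated)
    show "set_borel_measurable lborel J (\<lambda>x. h x ^ 2 * W i x)"
      by (intro continuous_measurable continuous_intros assms(1) W_cont)
    fix x assume x: "x \<in> J"
    have "h x ^ 2 \<le> (C * wt k x)^2" using power_mono[OF assms(2)[of x], of 2] by simp
    also have "\<dots> = C^2 * (1 + \<bar>x\<bar>) ^ (2 * k)"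
      by (simp add: wt_def power_mult_distrib power_mult[symmetric] mult.commute)
    finally show "\<bar>h x ^ 2 * W i x\<bar> \<le> C^2 * ((1 + \<bar>x\<bar>) ^ (2 * k) * W i x)"
      using mult_right_mono[of _ _ "W i x"] W_pos[OF x, of i] by (simp add: abs_mult mult.assoc[symmetric])
  qed
qed

lemma L2_poly: "L2 i (poly p)"
proof -
  obtain C where C: "\<And>x. \<bar>poly p x\<bar> \<le> C * (1 + \<bar>x\<bar>) ^ degree p" using poly_bound by blast
  show ?thesis by (rule L2_continuous_bound[of _ C "degree p"]) (use C in \<open>auto simp: wt_def intro: continuous_intros\<close>)
qed

lemma L2_diff:
  assumes "L2 i h" "L2 i k"
  shows "L2 i (\<lambda>x. h x - k x)" and "nrm i (\<lambda>x. h x - k x) = nrm i h - 2 * ip i h k + nrm i k"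
proof -
  have eq: "(h x - k x)^2 * W i x = (h x ^ 2 * W i x - 2 * (h x * k x * W i x)) + k x ^ 2 * W i x" for x
    by (simp add: power2_eq_square algebra_simps)
  note ints = L2_int[OF assms(1)] ip_int[OF assms] L2_int[OF assms(2)]
  have m: "set_borel_measurable lborel J (\<lambda>x. h x - k x)"
  proof -
    have "(\<lambda>x. indicator J x *\<^sub>R h x - indicator J x *\<^sub>R k x) \<in> borel_measurable lborel"
      using assms unfolding L2_def set_borel_measurable_def by (intro borel_measurable_diff) auto
    then show ?thesis by (simp add: set_borel_measurable_def algebra_simps)
  qed
  have "set_integrable lborel J (\<lambda>x. (h x ^ 2 * W i x - 2 * (h x * k x * W i x)) + k x ^ 2 * W i x)"
    using ints by (intro set_integral_add(1) set_integral_diff(1)) auto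
  then show "L2 i (\<lambda>x. h x - k x)" using m unfolding L2_def eq by simp
  show "nrm i (\<lambda>x. h x - k x) = nrm i h - 2 * ip i h k + nrm i k"
    unfolding eq using ints by (simp add: set_integral_add(2) set_integral_diff)
qed

lemma L2_wt_integrable:
  assumes "L2 i h"
  shows "set_integrable lborel J (\<lambda>x. \<bar>h x\<bar> * (wt j x * W i x))"
proof -
  have 1: "L2 i (\<lambda>x. \<bar>h x\<bar>)" using assms by (auto simp: L2_def set_borel_measurable_abs)
  have "L2 i (wt j)"
    by (rule L2_continuous_bound[of _ 1 j]) (auto simp: wt_def[abs_def] intro!: continuous_intros)
  from ip_int[OF 1 this] show ?thesis by (simp add: mult.assoc)
qed

text \<open>Expanding the square of \<open>v' - (v - K) / (x - ctr i)\<close> gives a Hardy inequality away from the centre.\<close>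

lemma hardy_L2_core:
  fixes K :: real
  assumes v: "abs_cont_deriv_on J v v'" and L: "L2 (Suc i) v'"
    and ab: "{a..b} \<subseteq> J" "a \<le> b" "ctr i \<notin> {a..b}"
  defines "B \<equiv> \<lambda>x. (v x - K)^2 * W (Suc i) x / (x - ctr i)"
  shows "(LBINT x:{a..b}. (v x - K)^2 * W i x) + B b - B a \<le> (LBINT x:{a..b}. v' x ^ 2 * W (Suc i) x)"
proof -
  let ?k = "\<lambda>x. v x - K" and ?y = "\<lambda>x. x - ctr i"
  have ne: "?y x \<noteq> 0" if "x \<in> {a..b}" for x using ab(3) that by auto
  have vab: "abs_cont_deriv_on {a..b} v v'" using abs_cont_subset[OF v ab(1)] .
  have kac: "abs_cont_deriv_on {a..b} ?k v'"
    using vab unfolding abs_cont_deriv_on_def by simp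
  have k2: "abs_cont_deriv_on {a..b} (\<lambda>x. ?k x * ?k x) (\<lambda>x. v' x * ?k x + ?k x * v' x)"
    by (rule abs_cont_mult[OF _ kac kac]) simp
  have wac: "abs_cont_deriv_on {a..b} (\<lambda>x. W (Suc i) x / ?y x)
      (\<lambda>x. - (dd i * W i x) - W (Suc i) x / ?y x ^ 2)"
  proof (rule abs_cont_C1)
    fix x assume x: "x \<in> {a..b}"
    have "((\<lambda>x. W (Suc i) x / ?y x) has_real_derivative
      ((cc i - dd i * x) * W i x * ?y x - W (Suc i) x * 1) / (?y x * ?y x)) (at x)"
      using x ab(1) ne by (intro DERIV_divide W_deriv) (auto intro!: derivative_eq_intros)
    moreover have "((cc i - dd i * x) * W i x * ?y x - W (Suc i) x * 1) / (?y x * ?y x) =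
      - (dd i * W i x) - W (Suc i) x / ?y x ^ 2"
    proof -
      have "(d * (- y) * w * y - V * 1) / (y * y) = - (d * w) - V / y^2" if "y \<noteq> 0" for d y w V :: real
        using that by (simp add: field_simps power2_eq_square)
      from this[OF ne[OF x], of "dd i" "W i x" "W (Suc i) x"] show ?thesis
        unfolding drift_eq by (simp only: minus_diff_eq)
    qed
    ultimately show "((\<lambda>x. W (Suc i) x / ?y x) has_real_derivative
      - (dd i * W i x) - W (Suc i) x / ?y x ^ 2) (at x within {a..b})"
      by (simp add: has_field_derivative_at_within)
  next
    show "continuous_on {a..b} (\<lambda>x. - (dd i * W i x) - W (Suc i) x / ?y x ^ 2)"
      using ne by (intro continuous_intros continuous_on_subset[OF W_cont ab(1)]) auto
  qed simp
  define D where "D x = (v' x * ?k x + ?k x * v' x) * (W (Suc i) x / ?y x) +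
    ?k x * ?k x * (- (dd i * W i x) - W (Suc i) x / ?y x ^ 2)" for x
  have intD: "set_integrable lborel {a..b} D" and D: "(LBINT x:{a..b}. D x) = B b - B a"
    using abs_cont_mult_Icc[OF k2 wac ab(2)]
    unfolding D_def[abs_def] B_def by (auto simp: power2_eq_square)
  have kc: "continuous_on {a..b} (\<lambda>x. ?k x ^ 2 * W i x)"
    by (intro continuous_intros abs_cont_continuous_Icc[OF vab] continuous_on_subset[OF W_cont ab(1)])
  have intk: "set_integrable lborel {a..b} (\<lambda>x. ?k x ^ 2 * W i x)"
    by (rule borel_integrable_atLeastAtMost'[OF kc])
  have intv: "set_integrable lborel {a..b} (\<lambda>x. v' x ^ 2 * W (Suc i) x)"
    using set_integrable_subset[OF L2_int[OF L] _ ab(1)] by simp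
  have "(LBINT x:{a..b}. ?k x ^ 2 * W i x + D x) \<le> (LBINT x:{a..b}. v' x ^ 2 * W (Suc i) x)"
  proof (rule set_integral_mono[OF set_integral_add(1)[OF intk intD] intv])
    fix x assume x: "x \<in> {a..b}"
    then have xJ: "x \<in> J" using ab by auto
    \<comment> \<open>The drift contributes \<open>dd i * ?k x ^ 2 * W i x\<close>; since
      \<open>dd i \<ge> 1\<close>, the surplus over the term wanted is nonnegative.\<close>
    have "0 \<le> (v' x - ?k x / ?y x)^2 * W (Suc i) x + (dd i - 1) * (?k x ^ 2 * W i x)"
      using W_pos[OF xJ, of "Suc i"] W_pos[OF xJ, of i] dd_ge_1[of i]
      by (intro add_nonneg_nonneg mult_nonneg_nonneg) auto
    also have "\<dots> = v' x ^ 2 * W (Suc i) x - (?k x ^ 2 * W i x + D x)"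
    proof -
      have "(a - k / y)^2 * V + (d - 1) * (k^2 * w) =
          a^2 * V - (k^2 * w + ((a * k + k * a) * (V / y) + k * k * (- (d * w) - V / y^2)))"
        if "y \<noteq> 0" for a k y V d w :: real
        using that by (simp add: field_simps power2_eq_square)
      from this[OF ne[OF x], of "v' x" "?k x" "W (Suc i) x" "dd i" "W i x"] show ?thesis
        unfolding D_def .
    qed
    finally show "?k x ^ 2 * W i x + D x \<le> v' x ^ 2 * W (Suc i) x" by simp
  qed
  then show ?thesis using set_integral_add(2)[OF intk intD] D by simp
qed

text \<open>Taking \<open>K = v c\<close> removes the boundary term at \<open>c\<close>, and at
  \<open>b\<close> it has the favourable sign. Dropping either nonnegative quantity on the left
  leaves one of the estimates. With \<open>c\<close> off the centre and \<open>b\<close> further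
  out, the singular point stays outside the segment.\<close>

lemma hardy_L2:
  assumes v: "abs_cont_deriv_on J v v'" and L: "L2 (Suc i) v'"
    and cb: "c \<in> J" "b \<in> J" "outward i c b" "c \<noteq> ctr i"
  shows "(LBINT x:seg c b. (v x - v c)^2 * W i x) \<le> (LBINT x:seg c b. v' x ^ 2 * W (Suc i) x)"
    and "(v b - v c)^2 * W (Suc i) b / \<bar>b - ctr i\<bar> \<le> (LBINT x:seg c b. v' x ^ 2 * W (Suc i) x)"
proof -
  let ?B = "(v b - v c)^2 * W (Suc i) b / \<bar>b - ctr i\<bar>"
  have sub: "seg c b \<subseteq> J" using seg_subset cb by blast
  have core: "(LBINT x:seg c b. (v x - v c)^2 * W i x) + ?B \<le> (LBINT x:seg c b. v' x ^ 2 * W (Suc i) x)"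
  proof (cases "c \<le> b \<and> ctr i \<le> c")
    case True
    then show ?thesis using hardy_L2_core[OF v L, of c b "v c"] sub cb by (simp add: seg_Icc)
  next
    case False
    then have bc: "b \<le> c" "c < ctr i" using cb(3,4) by (auto simp: outward_def)
    then have "\<bar>b - ctr i\<bar> = - (b - ctr i)" by simp
    then have "?B = - ((v b - v c)^2 * W (Suc i) b / (b - ctr i))" by (simp only: minus_divide_right)
    then show ?thesis using hardy_L2_core[OF v L, of b c "v c"] sub bc by (simp add: seg_Icc)
  qed
  have "0 \<le> ?B" using W_pos[OF cb(2), of "Suc i"] by simp
  then show "(LBINT x:seg c b. (v x - v c)^2 * W i x) \<le> (LBINT x:seg c b. v' x ^ 2 * W (Suc i) x)"
    using core by linarith
  have "0 \<le> (LBINT x:seg c b. (v x - v c)^2 * W i x)"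
    using sub W_pos[of _ i] by (intro set_integral_nonneg_real) (auto simp: less_imp_le)
  then show "?B \<le> (LBINT x:seg c b. v' x ^ 2 * W (Suc i) x)" using core by linarith
qed

text \<open>\<open>hardy_L2\<close> controls \<open>v - v a\<close> and \<open>v - v b\<close> on
  the two outer pieces, where \<open>a\<close> and \<open>b\<close> lie on either side of the
  centre; the piece between them is compact, and the constants \<open>v a\<close>,
  \<open>v b\<close> cost only the finite mass of \<open>W i\<close>.\<close>

lemma L2_primitive:
  assumes v: "abs_cont_deriv_on J v v'" and L: "L2 (Suc i) v'"
  shows "L2 i v"
  unfolding L2_def
proof
  have vc: "continuous_on J v" by (rule abs_cont_continuous[OF v open_J])
  then show "set_borel_measurable lborel J v" by (rule continuous_measurable)
  have gc: "continuous_on J (\<lambda>x. v x ^ 2 * W i x)" by (intro continuous_intros vc W_cont)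
  have g0: "0 \<le> v x ^ 2 * W i x" if "x \<in> J" for x using W_pos[OF that, of i] by simp
  obtain a b where ab: "a < ctr i" "ctr i < b" "{a..b} \<subseteq> J"
    using open_interval_Icc_around[OF open_J ctr_in_J] .
  then have abJ: "a \<in> J" "b \<in> J" by auto
  let ?I = "nrm (Suc i) v'"
  have piece: "(LBINT x:{r..s}. v x ^ 2 * W i x) \<le> 2 * ?I + 2 * K^2 * (LBINT x:J. W i x)"
    if rs: "{r..s} \<subseteq> J" and le: "(LBINT x:{r..s}. (v x - K)^2 * W i x) \<le> (LBINT x:{r..s}. v' x ^ 2 * W (Suc i) x)"
    for r s K
  proof -
    have i1: "set_integrable lborel {r..s} (\<lambda>x. (v x - K)^2 * W i x)"
      using rs by (intro continuous_Icc_integrable[of _ r s] continuous_intros vc W_cont)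
    have i2: "set_integrable lborel {r..s} (W i)" using rs by (intro continuous_Icc_integrable[of _ r s] W_cont)
    have "(LBINT x:{r..s}. v x ^ 2 * W i x) \<le>
        (LBINT x:{r..s}. 2 * ((v x - K)^2 * W i x) + 2 * K^2 * W i x)"
    proof (rule set_integral_mono)
      show "set_integrable lborel {r..s} (\<lambda>x. v x ^ 2 * W i x)" by (rule continuous_Icc_integrable[OF gc rs])
      show "set_integrable lborel {r..s} (\<lambda>x. 2 * ((v x - K)^2 * W i x) + 2 * K^2 * W i x)"
        using i1 i2 by (intro set_integral_add(1)) auto
      fix x assume "x \<in> {r..s}"
      then have x: "x \<in> J" using rs by auto
      have "v x ^ 2 \<le> 2 * (v x - K)^2 + 2 * K^2"
        using zero_le_power2[of "v x - 2 * K"] by (simp add: power2_eq_square algebra_simps)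
      from mult_right_mono[OF this, of "W i x"]
      show "v x ^ 2 * W i x \<le> 2 * ((v x - K)^2 * W i x) + 2 * K^2 * W i x"
        using W_pos[OF x, of i] by (simp add: algebra_simps)
    qed
    also have "\<dots> = 2 * (LBINT x:{r..s}. (v x - K)^2 * W i x) + 2 * K^2 * (LBINT x:{r..s}. W i x)"
      using i1 i2 by (subst set_integral_add(2)) auto
    also have "\<dots> \<le> 2 * ?I + 2 * K^2 * (LBINT x:J. W i x)"
    proof (intro add_mono mult_left_mono)
      have "(LBINT x:{r..s}. v' x ^ 2 * W (Suc i) x) \<le> ?I"
        using rs W_pos[of _ "Suc i"] by (intro set_integral_mono_set[OF L2_int[OF L]]) (auto simp: less_imp_le)
      then show "(LBINT x:{r..s}. (v x - K)^2 * W i x) \<le> ?I" using le by linarith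
      show "(LBINT x:{r..s}. W i x) \<le> (LBINT x:J. W i x)"
        using rs W_pos[of _ i] by (intro set_integral_mono_set[OF W_integrable]) (auto simp: less_imp_le)
    qed auto
    finally show ?thesis .
  qed
  show "set_integrable lborel J (\<lambda>x. v x ^ 2 * W i x)"
  proof (rule integrable_exhaust[OF continuous_Icc_integrable[OF gc Icc_subset] g0])
    show "\<forall>\<^sub>F n in sequentially. (LBINT x:{l n..u n}. v x ^ 2 * W i x) \<le>
      (2 * ?I + 2 * (v a)^2 * (LBINT x:J. W i x)) + (LBINT x:{a..b}. v x ^ 2 * W i x) +
      (2 * ?I + 2 * (v b)^2 * (LBINT x:J. W i x))"
      using eventually_surround[OF abJ(1)] eventually_surround[OF abJ(2)]
    proof eventually_elim
      case (elim n)
      have s1: "{l n..a} \<subseteq> J" and s2: "{b..u n} \<subseteq> J" using Icc_in_J abJ endpoints_in by auto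
      have "(LBINT x:{l n..u n}. v x ^ 2 * W i x) = (LBINT x:{l n..a}. v x ^ 2 * W i x) +
          ((LBINT x:{a..b}. v x ^ 2 * W i x) + (LBINT x:{b..u n}. v x ^ 2 * W i x))"
        using set_integral_combine[OF continuous_Icc_integrable[OF gc Icc_subset], of n a]
          set_integral_combine[OF continuous_Icc_integrable[OF gc Icc_in_J[OF abJ(1) endpoints_in(2)]], of b n] elim ab
        by simp
      moreover have "(LBINT x:{l n..a}. v x ^ 2 * W i x) \<le> 2 * ?I + 2 * (v a)^2 * (LBINT x:J. W i x)"
        using elim ab hardy_L2(1)[OF v L abJ(1) endpoints_in(1)[of n]]
        by (intro piece[OF s1]) (auto simp: outward_def seg_Icc)
      moreover have "(LBINT x:{b..u n}. v x ^ 2 * W i x) \<le> 2 * ?I + 2 * (v b)^2 * (LBINT x:J. W i x)"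
        using elim ab hardy_L2(1)[OF v L abJ(2) endpoints_in(2)[of n]]
        by (intro piece[OF s2]) (auto simp: outward_def seg_Icc)
      ultimately show ?case by linarith
    qed
  qed
qed

lemma adjoint_L2:
  assumes "abs_cont_deriv_on J v v'" "L2 (Suc i) v'"
  shows "ip i v (poly (Ast i r)) = ip (Suc i) v' (poly r)"
  using adjoint_L1[OF assms(1) L2_wt_integrable[OF assms(2)] order_refl] by (simp add: mult.assoc)

section \<open>Tail masses and boundary decay in mean square\<close>

definition tail_mass :: "nat \<Rightarrow> real \<Rightarrow> real" where
  "tail_mass i x = (LBINT t:tail_set J (ctr i) x. W i t)"

lemma tail_mass_nonneg: "0 \<le> tail_mass i x"
  unfolding tail_mass_def using tail_subset W_pos[of _ i]
  by (intro set_integral_nonneg_real) (auto simp: less_imp_le subset_iff)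

text \<open>A Mills ratio bound. Beyond \<open>x\<close> the drift has size at least
  \<open>dd i * \<bar>x - ctr i\<bar>\<close>, and integrated against \<open>W i\<close> over the
  tail its size gives exactly \<open>W (Suc i) x\<close>.\<close>

lemma tail_mass_le:
  assumes x: "x \<in> J"
  shows "dd i * \<bar>x - ctr i\<bar> * tail_mass i x \<le> W (Suc i) x"
proof -
  let ?T = "tail_set J (ctr i) x"
  have int: "set_integrable lborel J (\<lambda>t. (cc i - dd i * t) * W i t)"
    using poly_W_integrable[of "[:cc i, - dd i:]" i] by (simp add: mult.commute)
  have intT: "set_integrable lborel ?T (\<lambda>t. dd i * (\<bar>t - ctr i\<bar> * W i t))"
  proof -
    have "set_integrable lborel J (\<lambda>t. \<bar>(cc i - dd i * t) * W i t\<bar>)" by (rule set_integrable_abs[OF int])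
    then have "set_integrable lborel ?T (\<lambda>t. \<bar>(cc i - dd i * t) * W i t\<bar>)"
      by (rule set_integrable_subset[OF _ _ tail_subset]) simp
    moreover have "\<bar>(cc i - dd i * t) * W i t\<bar> = dd i * (\<bar>t - ctr i\<bar> * W i t)" if "t \<in> ?T" for t
      unfolding drift_eq using dd_ge_1[of i] W_pos[of t i] that tail_subset[of "ctr i" x]
      by (auto simp: abs_mult abs_minus_commute)
    ultimately show ?thesis by (simp cong: set_integrable_cong)
  qed
  have "dd i * \<bar>x - ctr i\<bar> * tail_mass i x = (LBINT t:?T. dd i * (\<bar>x - ctr i\<bar> * W i t))"
    by (simp add: tail_mass_def mult.assoc)
  also have "\<dots> \<le> (LBINT t:?T. dd i * (\<bar>t - ctr i\<bar> * W i t))"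
  proof (rule set_integral_mono[OF _ intT])
    show "set_integrable lborel ?T (\<lambda>t. dd i * (\<bar>x - ctr i\<bar> * W i t))"
      using set_integrable_subset[OF W_integrable _ tail_subset] by simp
    fix t assume t: "t \<in> ?T"
    then have "t \<in> J" using tail_subset by blast
    then show "dd i * (\<bar>x - ctr i\<bar> * W i t) \<le> dd i * (\<bar>t - ctr i\<bar> * W i t)"
      using tail_far[OF t] W_pos[of t i] dd_ge_1[of i] by (intro mult_left_mono mult_right_mono) auto
  qed
  also have "\<dots> = (LBINT t:?T. (if ctr i \<le> x then -1 else 1) * ((cc i - dd i * t) * W i t))"
    unfolding drift_eq by (rule set_lebesgue_integral_cong) (auto simp: tail_set_def)
  also have "\<dots> = W (Suc i) x"
    using abs_cont_tail[OF abs_cont_W int W_bdry x, of "ctr i"] by simp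
  finally show ?thesis .
qed

lemma tail_mass_bdry: "z = l \<or> z = u \<Longrightarrow> (\<lambda>n. tail_mass i (z n)) \<longlonglongrightarrow> 0"
  unfolding tail_mass_def by (rule tail_integral_tendsto[OF W_integrable ctr_in_J])

text \<open>\<open>tail_mass\<close> is the weight left over when the Cauchy-Schwarz inequality is
  applied to a tail. It is at most \<open>W (Suc i) / \<bar>x - ctr i\<bar>\<close>, the weight in
  the boundary part of \<open>hardy_L2\<close>; the comparison with an intermediate point then runs
  as for first moments.\<close>

lemma bdry_L2:
  assumes v: "abs_cont_deriv_on J v v'" and L: "L2 (Suc i) v'" and z: "z = l \<or> z = u"
  shows "(\<lambda>n. v (z n) ^ 2 * tail_mass i (z n)) \<longlonglongrightarrow> 0"
proof (rule double_limit_zero)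
  have zJ: "z n \<in> J" for n using z endpoints_in by auto
  let ?g = "\<lambda>x. v' x ^ 2 * W (Suc i) x"
  let ?T = "\<lambda>m. LBINT x:tail_set J (ctr i) (z m). ?g x"
  have g0: "0 \<le> ?g x" if "x \<in> tail_set J c y" for x c y
    using W_pos[of x "Suc i"] tail_subset[of c y] that by (auto simp: less_imp_le)
  have key: "(v (z n) - v (z m))^2 * tail_mass i (z n) \<le> ?T m"
    if mn: "outward i (z m) (z n)" "z m \<noteq> ctr i" and sp: "seg (z m) (z n) \<subseteq> tail_set J (ctr i) (z m)" for m n
  proof -
    have y0: "0 < \<bar>z n - ctr i\<bar>" using mn by (auto simp: outward_def)
    have "1 * (\<bar>z n - ctr i\<bar> * tail_mass i (z n)) \<le> dd i * (\<bar>z n - ctr i\<bar> * tail_mass i (z n))"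
      using dd_ge_1[of i] tail_mass_nonneg[of i "z n"] by (intro mult_right_mono) auto
    then have "\<bar>z n - ctr i\<bar> * tail_mass i (z n) \<le> W (Suc i) (z n)"
      using tail_mass_le[OF zJ, of i n] unfolding mult.assoc by linarith
    then have "tail_mass i (z n) \<le> W (Suc i) (z n) / \<bar>z n - ctr i\<bar>"
      using y0 by (simp add: pos_le_divide_eq mult.commute)
    then have "(v (z n) - v (z m))^2 * tail_mass i (z n) \<le> (v (z n) - v (z m))^2 * (W (Suc i) (z n) / \<bar>z n - ctr i\<bar>)"
      by (intro mult_left_mono) auto
    also have "\<dots> \<le> (LBINT x:seg (z m) (z n). ?g x)"
      unfolding times_divide_eq_right by (rule hardy_L2(2)[OF v L zJ zJ mn])
    also have "\<dots> \<le> ?T m"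
      using sp by (intro set_integral_mono_set set_integrable_subset[OF L2_int[OF L] _ tail_subset] g0) (auto simp: seg_def)
    finally show ?thesis .
  qed
  show "(\<lambda>m. 2 * ?T m) \<longlonglongrightarrow> 0"
    using tendsto_mult_left[OF tail_integral_tendsto[OF L2_int[OF L] ctr_in_J z], of 2] by simp
  show "(\<lambda>n. tail_mass i (z n)) \<longlonglongrightarrow> 0" by (rule tail_mass_bdry[OF z])
  show "\<forall>\<^sub>F m in sequentially. \<forall>\<^sub>F n in sequentially.
      v (z n) ^ 2 * tail_mass i (z n) \<le> 2 * ?T m + 2 * v (z m) ^ 2 * tail_mass i (z n)"
    using endpoint_tail[OF z, of i]
  proof eventually_elim
    case (elim m)
    have "v (z n) ^ 2 * tail_mass i (z n) \<le> 2 * ?T m + 2 * v (z m) ^ 2 * tail_mass i (z n)" if "n \<ge> m" for n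
    proof -
      have "v (z n) ^ 2 \<le> 2 * (v (z n) - v (z m))^2 + 2 * v (z m) ^ 2"
        using zero_le_power2[of "v (z n) - 2 * v (z m)"] by (simp add: power2_eq_square algebra_simps)
      from mult_right_mono[OF this tail_mass_nonneg[of i "z n"]]
      show ?thesis using key[of m n] elim that by (auto simp: algebra_simps)
    qed
    then show ?case unfolding eventually_sequentially by blast
  qed
  show "0 \<le> v (z n) ^ 2 * tail_mass i (z n)" for n using tail_mass_nonneg by simp
qed

end

section \<open>Stein solutions and the spectral gap\<close>

lemma tendsto_zero_of_square:
  fixes g :: "nat \<Rightarrow> real"
  assumes "(\<lambda>n. g n ^ 2) \<longlonglongrightarrow> 0"
  shows "g \<longlonglongrightarrow> 0"
proof (rule tendsto_rabs_zero_cancel)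
  show "(\<lambda>n. \<bar>g n\<bar>) \<longlonglongrightarrow> 0" using tendsto_real_sqrt[OF assms] by simp
qed

lemma ex_poly_antiderivative:
  fixes r :: "real poly"
  obtains R where "pderiv R = r" "degree R \<le> Suc (degree r)"
proof
  let ?R = "\<Sum>k\<le>degree r. monom (coeff r k / real (Suc k)) (Suc k)"
  have "pderiv ?R = (\<Sum>k\<le>degree r. monom (coeff r k) k)"
    by (simp add: higher_pderiv_sum[of 1, simplified] pderiv_monom)
  also have "\<dots> = r" by (rule poly_as_sum_of_monoms)
  finally show "pderiv ?R = r" .
  show "degree ?R \<le> Suc (degree r)"
    by (intro degree_sum_le) (auto intro: order_trans[OF degree_monom_le])
qed

context pearson_weight
begin

text \<open>With \<open>U\<close> the primitive of \<open>v * W i\<close>, which vanishes at both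
  ends as \<open>v\<close> has mean zero, \<open>w = - U / W (Suc i)\<close> solves
  \<open>A\<^sub>i w = v\<close>. The energy identity is the commutation relation of
  \<open>D\<close> and \<open>A\<^sub>i\<close> in integrated form. The pointwise bound is the
  Cauchy-Schwarz inequality on a tail; it makes boundary terms vanish later.\<close>

lemma stein:
  assumes vc: "continuous_on J v" and L: "L2 i v" and zero: "(LBINT x:J. v x * W i x) = 0"
  obtains w w' where "abs_cont_deriv_on J w w'" "L2 (Suc i) w" "L2 (Suc (Suc i)) w'"
    "dd i * nrm (Suc i) w + nrm (Suc (Suc i)) w' = nrm i v"
    "abs_cont_deriv_on J (\<lambda>x. w x * W (Suc i) x) (\<lambda>x. - (v x * W i x))"
    "\<And>x. x \<in> J \<Longrightarrow> (w x * W (Suc i) x)^2 \<le> nrm i v * tail_mass i x"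
proof -
  let ?g = "\<lambda>x. v x * W i x" and ?s = "ctr i"
  have one: "L2 i (\<lambda>_. 1)" 
  proof -
    have "poly 1 = (\<lambda>_. 1 :: real)" by auto
    then show ?thesis using L2_poly[of i 1] by simp
  qed
  have gint: "set_integrable lborel J ?g" using ip_int[OF L one] by simp
  define U where "U x = (LBINT t:J \<inter> {..x}. ?g t)" for x
  have subint: "set_integrable lborel A ?g" if "A \<in> sets borel" "A \<subseteq> J" for A
    using set_integrable_subset[OF gint] that by simp
  have U: "abs_cont_deriv_on J U ?g"
    unfolding abs_cont_deriv_on_def
  proof (intro ballI impI conjI)
    fix a b assume ab: "a \<in> J" "b \<in> J" "a \<le> b"
    have sub: "{a..b} \<subseteq> J" using Icc_in_J ab by blast
    show "set_integrable lborel {a..b} ?g" using sub by (intro subint) auto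
    have "(LBINT t:(J \<inter> {..a}) \<union> {a..b}. ?g t) = (LBINT t:J \<inter> {..a}. ?g t) + (LBINT t:{a..b}. ?g t)"
    proof (rule set_integral_Un_AE)
      show "AE t in lborel. \<not> (t \<in> J \<inter> {..a} \<and> t \<in> {a..b})"
        using AE_lborel_singleton[of a] by eventually_elim auto
    qed (use sub in \<open>auto intro!: subint\<close>)
    moreover have "(J \<inter> {..a}) \<union> {a..b} = J \<inter> {..b}" using ab sub by auto
    ultimately show "U b - U a = (LBINT t:{a..b}. ?g t)" by (simp add: U_def)
  qed
  have Ul: "(\<lambda>n. U (l n)) \<longlonglongrightarrow> 0"
  proof (rule Lim_transform_eventually)
    show "(\<lambda>n. LBINT x:tail_set J ?s (l n). ?g x) \<longlonglongrightarrow> 0"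
      by (rule tail_integral_tendsto[OF gint ctr_in_J]) simp
    show "\<forall>\<^sub>F n in sequentially. (LBINT x:tail_set J ?s (l n). ?g x) = U (l n)"
      using eventually_surround[OF ctr_in_J[of i]] by eventually_elim (simp add: U_def tail_set_def)
  qed
  have Uu: "(\<lambda>n. U (u n)) \<longlonglongrightarrow> 0"
  proof (rule Lim_transform_eventually)
    show "(\<lambda>n. - (LBINT x:tail_set J ?s (u n). ?g x)) \<longlonglongrightarrow> 0"
      using tendsto_minus[OF tail_integral_tendsto[OF gint ctr_in_J, of u i]] by simp
    show "\<forall>\<^sub>F n in sequentially. - (LBINT x:tail_set J ?s (u n). ?g x) = U (u n)"
      using eventually_surround[OF ctr_in_J[of i]]
    proof eventually_elim
      case (elim n)
      have "(LBINT t:(J \<inter> {..u n}) \<union> (J \<inter> {u n..}). ?g t) =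
        (LBINT t:J \<inter> {..u n}. ?g t) + (LBINT t:J \<inter> {u n..}. ?g t)"
      proof (rule set_integral_Un_AE)
        show "AE t in lborel. \<not> (t \<in> J \<inter> {..u n} \<and> t \<in> J \<inter> {u n..})"
          using AE_lborel_singleton[of "u n"] by eventually_elim auto
      qed (auto intro!: subint)
      moreover have "(J \<inter> {..u n}) \<union> (J \<inter> {u n..}) = J" by auto
      ultimately show ?case using zero elim by (simp add: U_def tail_set_def)
    qed
  qed
  have U_sq: "U x ^ 2 \<le> (LBINT t:tail_set J ?s x. v t ^ 2 * W i t) * tail_mass i x" if x: "x \<in> J" for x
  proof -
    let ?T = "tail_set J ?s x"
    have "(LBINT t:?T. ?g t) = (if ?s \<le> x then - U x else U x)"
      by (rule abs_cont_tail[OF U gint Ul Uu x])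
    then have "U x ^ 2 = (LBINT t:?T. v t * 1 * W i t)^2" by simp
    also have "\<dots> \<le> (LBINT t:?T. v t ^ 2 * W i t) * (LBINT t:?T. 1 ^ 2 * W i t)"
    proof (rule weighted_Cauchy_Schwarz)
      show "set_borel_measurable lborel ?T v"
        by (rule set_borel_measurable_lborel_continuous[OF continuous_on_subset[OF vc tail_subset] tail_borel])
      show "set_borel_measurable lborel ?T (W i)"
        by (rule set_borel_measurable_lborel_continuous[OF continuous_on_subset[OF W_cont tail_subset] tail_borel])
      show "set_borel_measurable lborel ?T (\<lambda>t. 1 :: real)"
        by (rule set_borel_measurable_lborel_continuous[OF continuous_on_const tail_borel])
      show "set_integrable lborel ?T (\<lambda>t. v t ^ 2 * W i t)"
        by (rule set_integrable_subset[OF L2_int[OF L] _ tail_subset]) simp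
      show "set_integrable lborel ?T (\<lambda>t. 1 ^ 2 * W i t)"
        using set_integrable_subset[OF W_integrable _ tail_subset] by simp
      show "0 \<le> W i t" if "t \<in> ?T" for t
        using that tail_subset[of ?s x] W_pos[of t i] by (auto intro: less_imp_le)
    qed
    finally show ?thesis by (simp add: tail_mass_def)
  qed
  define w where "w x = U x * (- 1 / W (Suc i) x)" for x
  define w' where "w' x = ?g x * (- 1 / W (Suc i) x) + U x * (((cc i - dd i * x) * W i x) / W (Suc i) x ^ 2)" for x
  have Wne: "W k x \<noteq> 0" if "x \<in> J" for k x using W_pos[OF that, of k] by simp
  have rec: "abs_cont_deriv_on J (\<lambda>x. - 1 / W (Suc i) x) (\<lambda>x. ((cc i - dd i * x) * W i x) / W (Suc i) x ^ 2)"
  proof (rule abs_cont_C1[OF interval_J])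
    fix x assume x: "x \<in> J"
    have "((\<lambda>x. - 1 / W (Suc i) x) has_real_derivative
        (0 * W (Suc i) x - (- 1) * ((cc i - dd i * x) * W i x)) / (W (Suc i) x * W (Suc i) x)) (at x)"
      by (rule DERIV_divide[OF _ W_deriv[OF x] Wne[OF x]]) (auto intro!: derivative_eq_intros)
    then show "((\<lambda>x. - 1 / W (Suc i) x) has_real_derivative ((cc i - dd i * x) * W i x) / W (Suc i) x ^ 2) (at x within J)"
      by (simp add: has_field_derivative_at_within power2_eq_square)
  qed (intro continuous_intros W_cont, use Wne in auto)
  have wac: "abs_cont_deriv_on J w w'"
    using abs_cont_mult[OF interval_J U rec] unfolding w_def[abs_def] w'_def[abs_def] .
  have wc: "continuous_on J w" by (rule abs_cont_continuous[OF wac open_J])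
  have wW: "w x * W (Suc i) x = - U x" if "x \<in> J" for x using Wne[OF that] by (simp add: w_def)
  have v_eq: "v x = - (cc i - dd i * x) * w x - q x * w' x" if x: "x \<in> J" for x
  proof -
    have "q x \<noteq> 0" "W i x \<noteq> 0" using q_pos[OF x] Wne[OF x] by auto
    then show ?thesis by (simp add: w_def w'_def W_Suc field_simps power2_eq_square)
  qed
  have acw: "abs_cont_deriv_on J (\<lambda>x. w x * W (Suc i) x) (\<lambda>x. - (v x * W i x))"
  proof -
    have "abs_cont_deriv_on J (\<lambda>x. - U x) (\<lambda>x. - ?g x)"
    proof -
      have "abs_cont_deriv_on J (\<lambda>x. 0) (\<lambda>x. 0)" by (simp add: abs_cont_deriv_on_def set_integrable_def)
      from abs_cont_diff[OF this U] show ?thesis by simp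
    qed
    then show ?thesis using abs_cont_cong[OF interval_J, of "\<lambda>x. w x * W (Suc i) x" "\<lambda>x. - U x"] wW by simp
  qed
  have tail_le: "(LBINT t:tail_set J ?s x. v t ^ 2 * W i t) \<le> nrm i v" for x
    using W_pos[of _ i] by (intro set_integral_mono_set[OF L2_int[OF L] _ tail_subset]) (auto simp: less_imp_le)
  have wsq: "(w x * W (Suc i) x)^2 \<le> nrm i v * tail_mass i x" if x: "x \<in> J" for x
  proof -
    have "U x ^ 2 \<le> nrm i v * tail_mass i x"
      using U_sq[OF x] mult_right_mono[OF tail_le tail_mass_nonneg, of x i x] by linarith
    then show ?thesis using wW[OF x] by simp
  qed
  text \<open>Integrating \<open>v\<^sup>2 W\<^sub>i = (\<dots>)' + d\<^sub>i w\<^sup>2 W\<^sub>i\<^sub>+\<^sub>1 + w'\<^sup>2 W\<^sub>i\<^sub>+\<^sub>2\<close>; the boundary term is dominated by a tail of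
    the integral of \<open>v\<^sup>2 W\<^sub>i\<close>.\<close>
  define B where "B x = (- (cc i - dd i * x)) * w x * (w x * W (Suc i) x)" for x
  define e where "e x = dd i * (w x ^ 2 * W (Suc i) x) + w' x ^ 2 * W (Suc (Suc i)) x" for x
  have Bac: "abs_cont_deriv_on J B (\<lambda>x. e x - v x ^ 2 * W i x)"
  proof -
    have lin: "abs_cont_deriv_on J (\<lambda>x. - (cc i - dd i * x)) (\<lambda>x. dd i)"
      by (rule abs_cont_C1[OF interval_J]) (auto intro!: derivative_eq_intros continuous_intros)
    have "abs_cont_deriv_on J B (\<lambda>x. (dd i * w x + (- (cc i - dd i * x)) * w' x) * (w x * W (Suc i) x) +
      (- (cc i - dd i * x)) * w x * (- (v x * W i x)))"
      unfolding B_def[abs_def]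
      by (rule abs_cont_mult[OF interval_J abs_cont_mult[OF interval_J lin wac] acw])
    moreover have "(dd i * w x + (- (cc i - dd i * x)) * w' x) * (w x * W (Suc i) x) +
      (- (cc i - dd i * x)) * w x * (- (v x * W i x)) = e x - v x ^ 2 * W i x" if x: "x \<in> J" for x
    proof -
      define d where "d = - (cc i - dd i * x)"
      have vx: "v x = d * w x - q x * w' x" using v_eq[OF x] by (simp add: d_def)
      show ?thesis unfolding e_def d_def[symmetric] vx
        by (simp add: W_Suc power2_eq_square algebra_simps)
    qed
    ultimately show ?thesis
      using abs_cont_cong[OF interval_J, of B B
          "\<lambda>x. (dd i * w x + (- (cc i - dd i * x)) * w' x) * (w x * W (Suc i) x) + (- (cc i - dd i * x)) * w x * (- (v x * W i x))"
          "\<lambda>x. e x - v x ^ 2 * W i x"] by simp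
  qed
  have B_le: "\<bar>B x\<bar> \<le> (LBINT t:tail_set J ?s x. v t ^ 2 * W i t)" if x: "x \<in> J" for x
  proof -
    let ?V = "LBINT t:tail_set J ?s x. v t ^ 2 * W i t"
    have V0: "0 \<le> ?V" using W_pos[of _ i] tail_subset by (intro set_integral_nonneg_real) (auto simp: less_imp_le subset_iff)
    have Wp: "0 < W (Suc i) x" by (rule W_pos[OF x])
    have "\<bar>B x\<bar> * W (Suc i) x = dd i * \<bar>x - ?s\<bar> * (w x * W (Suc i) x)^2"
    proof -
      have "B x * W (Suc i) x = - (dd i * (?s - x)) * (w x * W (Suc i) x)^2"
        unfolding B_def drift_eq by (simp add: power2_eq_square)
      then have "\<bar>B x * W (Suc i) x\<bar> = dd i * \<bar>?s - x\<bar> * (w x * W (Suc i) x)^2"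
        using dd_ge_1[of i] by (simp add: abs_mult)
      then show ?thesis using Wp by (simp add: abs_mult abs_minus_commute)
    qed
    also have "\<dots> \<le> dd i * \<bar>x - ?s\<bar> * (?V * tail_mass i x)"
      using U_sq[OF x] wW[OF x] dd_ge_1[of i] by (intro mult_left_mono) auto
    also have "\<dots> = ?V * (dd i * \<bar>x - ?s\<bar> * tail_mass i x)" by simp
    also have "\<dots> \<le> ?V * W (Suc i) x" by (rule mult_left_mono[OF tail_mass_le[OF x] V0])
    finally show ?thesis using Wp by simp
  qed
  have B_lim: "(\<lambda>n. B (z n)) \<longlonglongrightarrow> 0" if z: "z = l \<or> z = u" for z
  proof (rule Lim_null_comparison)
    show "(\<lambda>n. LBINT t:tail_set J ?s (z n). v t ^ 2 * W i t) \<longlonglongrightarrow> 0"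
      by (rule tail_integral_tendsto[OF L2_int[OF L] ctr_in_J z])
    have "z n \<in> J" for n using z endpoints_in by auto
    then show "\<forall>\<^sub>F n in sequentially. norm (B (z n)) \<le> (LBINT t:tail_set J ?s (z n). v t ^ 2 * W i t)"
      using B_le by (intro always_eventually allI) simp
  qed
  have e0: "0 \<le> dd i * (w x ^ 2 * W (Suc i) x)" "0 \<le> w' x ^ 2 * W (Suc (Suc i)) x" if "x \<in> J" for x
    using W_pos[OF that, of "Suc i"] W_pos[OF that, of "Suc (Suc i)"] dd_ge_1[of i] by auto
  have v2loc: "set_integrable lborel {l n..u n} (\<lambda>x. v x ^ 2 * W i x)" for n
    using set_integrable_subset[OF L2_int[OF L] _ Icc_subset] by simp
  have eloc: "set_integrable lborel {l n..u n} e" for n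
    using set_integral_add(1)[OF abs_cont_integrable[OF Bac Icc_subset] v2loc[of n]] by simp
  have eval: "(LBINT x:{l n..u n}. e x) = (LBINT x:{l n..u n}. v x ^ 2 * W i x) + (B (u n) - B (l n))" for n
    using abs_cont_FTC[OF Bac Icc_subset less_imp_le[OF l_less_u[of n]]] set_integral_diff(2)[OF eloc[of n] v2loc[of n]]
    by linarith
  have lim: "(\<lambda>n. LBINT x:{l n..u n}. e x) \<longlonglongrightarrow> nrm i v + (0 - 0)"
    unfolding eval using B_lim by (intro tendsto_intros integral_exhaust[OF L2_int[OF L]]) auto
  have eint: "set_integrable lborel J e"
  proof (rule integrable_exhaust[OF eloc])
    show "0 \<le> e x" if "x \<in> J" for x using e0[OF that] by (simp add: e_def)
    show "\<forall>\<^sub>F n in sequentially. (LBINT x:{l n..u n}. e x) \<le> nrm i v + 1"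
      using order_tendstoD(2)[OF lim, of "nrm i v + 1"] by (auto elim: eventually_mono)
  qed
  have etot: "(LBINT x:J. e x) = nrm i v"
    using LIMSEQ_unique[OF integral_exhaust[OF eint] lim] by simp
  have w'm: "set_borel_measurable lborel J w'" by (rule abs_cont_measurable[OF wac])
  have i1: "set_integrable lborel J (\<lambda>x. dd i * (w x ^ 2 * W (Suc i) x))"
  proof (rule set_integrable_dominated[OF eint])
    show "set_borel_measurable lborel J (\<lambda>x. dd i * (w x ^ 2 * W (Suc i) x))"
      by (intro continuous_measurable continuous_intros wc W_cont)
    show "\<bar>dd i * (w x ^ 2 * W (Suc i) x)\<bar> \<le> e x" if "x \<in> J" for x
      using e0[OF that] unfolding e_def by linarith
  qed
  then have i1': "set_integrable lborel J (\<lambda>x. w x ^ 2 * W (Suc i) x)"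
    using dd_ge_1[of i] by simp
  have i2: "set_integrable lborel J (\<lambda>x. w' x ^ 2 * W (Suc (Suc i)) x)"
  proof (rule set_integrable_dominated[OF eint])
    show "set_borel_measurable lborel J (\<lambda>x. w' x ^ 2 * W (Suc (Suc i)) x)"
      unfolding power2_eq_square by (intro set_borel_measurable_mult w'm W_measurable)
    show "\<bar>w' x ^ 2 * W (Suc (Suc i)) x\<bar> \<le> e x" if "x \<in> J" for x
      using e0[OF that] unfolding e_def by linarith
  qed
  have tot: "dd i * nrm (Suc i) w + nrm (Suc (Suc i)) w' = nrm i v"
    using set_integral_add(2)[OF i1 i2] etot by (simp add: e_def[abs_def])
  show ?thesis
    by (rule that[OF wac _ _ tot acw wsq]) (auto simp: L2_def i1' i2 w'm continuous_measurable[OF wc])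
qed

text \<open>The adjoint relation for the non-polynomial \<open>w\<close>, from the derivative of
  \<open>w * W (Suc i) * y\<close>. The square of this product is at most
  \<open>C * y ^ 2 * tail_mass i\<close>, which tends to 0 by \<open>bdry_L2\<close>.\<close>

lemma stein_pairing:
  assumes vc: "continuous_on J v" and Lv: "L2 i v" and Lw: "L2 (Suc i) w"
    and ac: "abs_cont_deriv_on J (\<lambda>x. w x * W (Suc i) x) (\<lambda>x. - (v x * W i x))"
    and bd: "\<And>x. x \<in> J \<Longrightarrow> (w x * W (Suc i) x)^2 \<le> C * tail_mass i x"
    and y: "abs_cont_deriv_on J y y'" and Ly': "L2 (Suc i) y'"
  shows "ip (Suc i) w y' = ip i v y"
proof -
  have Ly: "L2 i y" by (rule L2_primitive[OF y Ly'])
  note i1 = ip_int[OF Lw Ly'] and i2 = ip_int[OF Lv Ly]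
  have ac': "abs_cont_deriv_on J (\<lambda>x. w x * W (Suc i) x * y x) (\<lambda>x. w x * y' x * W (Suc i) x - v x * y x * W i x)"
    using abs_cont_mult[OF interval_J ac y] by (simp add: mult_ac)
  have lim: "(\<lambda>n. w (z n) * W (Suc i) (z n) * y (z n)) \<longlonglongrightarrow> 0" if z: "z = l \<or> z = u" for z
  proof (rule tendsto_zero_of_square, rule tendsto_sandwich[of "\<lambda>_. 0"])
    have zJ: "z n \<in> J" for n using z endpoints_in by auto
    show "(\<lambda>n. C * (y (z n) ^ 2 * tail_mass i (z n))) \<longlonglongrightarrow> 0"
      using tendsto_mult_left[OF bdry_L2[OF y Ly' z], of C] by simp
    show "\<forall>\<^sub>F n in sequentially. (w (z n) * W (Suc i) (z n) * y (z n))\<^sup>2 \<le> C * (y (z n) ^ 2 * tail_mass i (z n))"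
    proof (intro always_eventually allI)
      fix n
      show "(w (z n) * W (Suc i) (z n) * y (z n))\<^sup>2 \<le> C * (y (z n) ^ 2 * tail_mass i (z n))"
        using mult_right_mono[OF bd[OF zJ[of n]], of "y (z n) ^ 2"] by (simp add: power_mult_distrib mult_ac)
    qed
  qed auto
  have "(LBINT x:J. w x * y' x * W (Suc i) x - v x * y x * W i x) = 0"
    by (rule abs_cont_integral_zero[OF ac' set_integral_diff(1)[OF i1 i2] lim lim]) auto
  then show ?thesis using set_integral_diff(2)[OF i1 i2] by simp
qed

section \<open>Eigenvalues and the growing spectral gap\<close>

definition lam :: "nat \<Rightarrow> real" where "lam k = real k * (1 - (real k - 1) * \<delta>)"

lemma lam_diff: "lam k - lam r = (real k - real r) * (1 - (real k + real r - 1) * \<delta>)"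
  by (simp add: lam_def algebra_simps)

text \<open>For \<delta> \<le> 0 the second factor in \<open>lam_diff\<close> is at least 1 when
  \<open>r < k\<close>. This linear growth is enough to force the remainders of the expansion to
  0.\<close>

lemma lam_diff_ge: "r \<le> k \<Longrightarrow> real k - real r \<le> lam k - lam r"
proof (cases "r = k")
  case False
  assume "r \<le> k"
  then have "1 \<le> real k + real r" "real r \<le> real k" using False by auto
  then have "(real k + real r - 1) * \<delta> \<le> 0" using delta by (intro mult_nonneg_nonpos) auto
  then have "(real k - real r) * 1 \<le> (real k - real r) * (1 - (real k + real r - 1) * \<delta>)"
    using \<open>real r \<le> real k\<close> by (intro mult_left_mono) auto
  then show ?thesis by (simp add: lam_diff)
qed simp

lemma lam_Suc: "lam (Suc i) - lam i = dd i"
  by (simp add: lam_diff dd_def algebra_simps)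

lemma lam_less: "r < k \<Longrightarrow> lam r < lam k"
  using lam_diff_ge[of r k] by simp

text \<open>Duality: \<open>nrm i v\<close> equals the pairing of \<open>w\<close> with
  \<open>v'\<close>, so its square is at most \<open>nrm (Suc i) w * nrm (Suc i) v'\<close>;
  inserting the bound on \<open>w\<close> and dividing by \<open>nrm i v\<close> carries the same
  constant over to \<open>v'\<close>.\<close>

lemma poincare_step:
  assumes v: "abs_cont_deriv_on J v v'" "L2 (Suc i) v'" and gap: "(lam (i + N + 1) - lam i) * nrm (Suc i) w \<le> nrm i v"
    and w: "L2 (Suc i) w" and pair: "ip (Suc i) w v' = ip i v v"
  shows "(lam (i + N + 1) - lam i) * nrm i v \<le> nrm (Suc i) v'"
proof (cases "nrm i v = 0")
  case False
  let ?L = "lam (i + N + 1) - lam i"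
  have L0: "0 < ?L" using lam_less[of i "i + N + 1"] by simp
  have pos: "0 < nrm i v" using False nrm_nonneg[of v i] by linarith
  have "(nrm i v)^2 \<le> nrm (Suc i) w * nrm (Suc i) v'"
    using ip_CS[OF w v(2)] pair by (simp add: power2_eq_square)
  then have "?L * (nrm i v)^2 \<le> (?L * nrm (Suc i) w) * nrm (Suc i) v'"
    using L0 by (simp add: mult.assoc)
  also have "\<dots> \<le> nrm i v * nrm (Suc i) v'" by (rule mult_right_mono[OF gap nrm_nonneg])
  finally show ?thesis using pos by (simp add: power2_eq_square mult.assoc[symmetric] mult.commute[of "nrm i v"])
qed (simp add: nrm_nonneg)

text \<open>The spectral gap is transported along the chain of weights: the Stein solution of a function
  orthogonal to polynomials of degree \<open>\<le> N + 1\<close> is orthogonal to those of degree \<open>\<le> N\<close> for the next weight.\<close>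

lemma poincare:
  assumes "abs_cont_deriv_on J v v'" "L2 (Suc i) v'" "\<And>p. degree p \<le> N \<Longrightarrow> ip i v (poly p) = 0"
  shows "(lam (i + N + 1) - lam i) * nrm i v \<le> nrm (Suc i) v'"
  using assms
proof (induction N arbitrary: i v v')
  case (0 i v v')
    have vc: "continuous_on J v" by (rule abs_cont_continuous[OF 0(1) open_J])
    have Lv: "L2 i v" by (rule L2_primitive[OF 0(1,2)])
    have "(LBINT x:J. v x * W i x) = 0" using 0(3)[of 1] by simp
    then obtain w w' where w: "abs_cont_deriv_on J w w'" "L2 (Suc i) w" "L2 (Suc (Suc i)) w'"
      "dd i * nrm (Suc i) w + nrm (Suc (Suc i)) w' = nrm i v"
      "abs_cont_deriv_on J (\<lambda>x. w x * W (Suc i) x) (\<lambda>x. - (v x * W i x))"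
      "\<And>x. x \<in> J \<Longrightarrow> (w x * W (Suc i) x)^2 \<le> nrm i v * tail_mass i x"
      using stein[OF vc Lv] by blast
    have "(lam (i + 0 + 1) - lam i) * nrm (Suc i) w \<le> nrm i v"
      using w(4) nrm_nonneg[of w' "Suc (Suc i)"] by (simp add: lam_Suc)
    then show ?case
      by (rule poincare_step[OF 0(1,2) _ w(2) stein_pairing[OF vc Lv w(2,5) _ 0(1,2)]]) (rule w(6))
  next
    case (Suc N i v v')
    have vc: "continuous_on J v" by (rule abs_cont_continuous[OF Suc(2) open_J])
    have Lv: "L2 i v" by (rule L2_primitive[OF Suc(2,3)])
    have "(LBINT x:J. v x * W i x) = 0" using Suc(4)[of 1] by simp
    then obtain w w' where w: "abs_cont_deriv_on J w w'" "L2 (Suc i) w" "L2 (Suc (Suc i)) w'"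
      "dd i * nrm (Suc i) w + nrm (Suc (Suc i)) w' = nrm i v"
      "abs_cont_deriv_on J (\<lambda>x. w x * W (Suc i) x) (\<lambda>x. - (v x * W i x))"
      "\<And>x. x \<in> J \<Longrightarrow> (w x * W (Suc i) x)^2 \<le> nrm i v * tail_mass i x"
      using stein[OF vc Lv] by blast
    have "ip (Suc i) w (poly r) = 0" if r: "degree r \<le> N" for r
    proof -
      obtain R where R: "pderiv R = r" "degree R \<le> Suc (degree r)" by (rule ex_poly_antiderivative)
      have "abs_cont_deriv_on J (poly R) (poly r)" using abs_cont_poly[OF interval_J, of R] R by simp
      have "ip (Suc i) w (poly r) = ip i v (poly R)"
        by (rule stein_pairing[OF vc Lv w(2,5) _ \<open>abs_cont_deriv_on J (poly R) (poly r)\<close> L2_poly]) (rule w(6))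
      then show ?thesis using Suc(4)[of R] R r by simp
    qed
    then have "(lam (Suc i + N + 1) - lam (Suc i)) * nrm (Suc i) w \<le> nrm (Suc (Suc i)) w'"
      by (rule Suc(1)[OF w(1,3)])
    \<comment> \<open>The identity \<open>w(4)\<close> adds
      \<open>dd i = lam (Suc i) - lam i\<close> to the gap of the next weight, and the sum
      telescopes.\<close>
    then have "(lam (i + Suc N + 1) - lam i) * nrm (Suc i) w \<le> nrm i v"
      using w(4) lam_Suc[of i] by (simp add: algebra_simps)
    then show ?case
      by (rule poincare_step[OF Suc(2,3) _ w(2) stein_pairing[OF vc Lv w(2,5) _ Suc(2,3)]]) (rule w(6))
qed

end

section \<open>Rodrigues polynomials and Parseval's identity below the top order\<close>

context pearson_weight
begin

lemma Ast_smult: "Ast i (smult c p) = smult c (Ast i p)"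
proof -
  define a where "a = [:- cc i, dd i:]"
  show ?thesis unfolding Ast_def a_def[symmetric] by (simp add: pderiv_smult smult_diff_right)
qed

lemma pderiv_Ast: "pderiv (Ast i r) = Ast (Suc i) (pderiv r) + smult (dd i) r"
proof -
  define a where "a = [:- cc i, dd i:]"
  have lin: "[:- cc (Suc i), dd (Suc i):] = a - pderiv qp"
    by (simp add: a_def cc_def dd_def qp_def pderiv_pCons algebra_simps)
  have "pderiv a = [:dd i:]" by (simp add: a_def pderiv_pCons)
  then show ?thesis
    unfolding Ast_def lin a_def[symmetric] by (simp add: pderiv_diff pderiv_mult algebra_simps)
qed

text \<open>Unfolded, \<open>Rod i k * W i\<close> is \<open>(-1) ^ k\<close> times the
  \<open>k\<close>-th derivative of \<open>W (i + k)\<close>, which is Rodrigues' formula. The index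
  \<open>i\<close> records the weight, because differentiating the family of \<open>W i\<close>
  leads into that of \<open>W (Suc i)\<close>.\<close>

fun Rod :: "nat \<Rightarrow> nat \<Rightarrow> real poly" where
  "Rod i 0 = 1"
| "Rod i (Suc k) = Ast i (Rod (Suc i) k)"

lemma Rod_eigen: "Ast i (pderiv (Rod i k)) = smult (lam (i + k) - lam i) (Rod i k)"
proof (induction k arbitrary: i)
  case 0
  then show ?case by (simp add: Ast_def)
next
  case (Suc k)
  let ?R = "Rod (Suc i) k"
  have "pderiv (Rod i (Suc k)) = smult (lam (Suc i + k) - lam (Suc i) + dd i) ?R"
    unfolding Rod.simps pderiv_Ast Suc.IH by (simp add: smult_add_left)
  also have "lam (Suc i + k) - lam (Suc i) + dd i = lam (i + Suc k) - lam i"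
    by (simp flip: lam_Suc)
  finally show ?case by (simp add: Ast_smult)
qed

lemma pderiv_Rod: "pderiv (Rod i (Suc k)) = smult (lam (i + Suc k) - lam i) (Rod (Suc i) k)"
proof -
  have "pderiv (Rod i (Suc k)) = smult (lam (Suc i + k) - lam (Suc i) + dd i) (Rod (Suc i) k)"
    unfolding Rod.simps pderiv_Ast Rod_eigen by (simp add: smult_add_left)
  then show ?thesis by (simp flip: lam_Suc)
qed

lemma degree_Rod_le: "degree (Rod i k) \<le> k"
  by (induction k arbitrary: i) (auto intro: order_trans[OF degree_Ast_le])

lemma coeff_Rod_pos: "0 < coeff (Rod i k) k"
proof (induction k arbitrary: i)
  case (Suc k)
  have "real (Suc k) * coeff (Rod i (Suc k)) (Suc k) = (lam (i + Suc k) - lam i) * coeff (Rod (Suc i) k) k"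
    using arg_cong[OF pderiv_Rod[of i k], of "\<lambda>p. coeff p k"] unfolding coeff_pderiv coeff_smult .
  also have "\<dots> > 0" using Suc.IH[of "Suc i"] lam_less[of i "i + Suc k"] by (intro mult_pos_pos) auto
  finally show ?case by (simp add: zero_less_mult_iff)
qed simp

definition NN :: "nat \<Rightarrow> nat \<Rightarrow> real" where "NN i k = (\<Prod>r<i. lam k - lam r)"

lemma NN_zero: "k < i \<Longrightarrow> NN i k = 0"
  by (auto simp: NN_def)

lemma NN_pos: "i \<le> k \<Longrightarrow> 0 < NN i k"
  unfolding NN_def by (intro prod_pos) (auto intro: lam_less)

lemma NN_nonneg: "0 \<le> NN i k"
  using NN_zero[of k i] NN_pos[of i k] by (cases "i \<le> k") auto

lemma higher_pderiv_Rod: "(pderiv ^^ i) (Rod 0 k) = smult (NN i k) (Rod i (k - i))"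
proof (induction i)
  case (Suc i)
  show ?case
  proof (cases "i < k")
    case True
    then have "k - i = Suc (k - Suc i)" by simp
    then have "pderiv (Rod i (k - i)) = smult (lam k - lam i) (Rod (Suc i) (k - Suc i))"
      using pderiv_Rod[of i "k - Suc i"] True by simp
    then show ?thesis using Suc by (simp add: pderiv_smult NN_def mult.commute)
  next
    case False
    then have "NN (Suc i) k = 0" by (intro NN_zero) auto
    moreover have "pderiv (Rod i (k - i)) = 0" using False by simp
    ultimately show ?thesis using Suc by (simp add: pderiv_smult)
  qed
qed (simp add: NN_def)

text \<open>Square integrability is required of the top derivative only; \<open>L2_primitive\<close>
  hands it down to all lower orders, each with its own weight.\<close>

definition chain :: "nat \<Rightarrow> (nat \<Rightarrow> real \<Rightarrow> real) \<Rightarrow> bool" where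
  "chain n G \<longleftrightarrow> (\<forall>k<n. abs_cont_deriv_on J (G k) (G (Suc k))) \<and> L2 n (G n)"

lemma chain_L2:
  assumes "chain n G" "i \<le> n"
  shows "L2 i (G i)"
  using assms(2)
proof (induction rule: inc_induct)
  case (step i)
  then show ?case using L2_primitive[of "G i" "G (Suc i)" i] assms(1) by (simp add: chain_def)
qed (use assms in \<open>simp add: chain_def\<close>)

lemma chain_poly: "chain n (\<lambda>i. poly ((pderiv ^^ i) p))"
  using abs_cont_poly[OF interval_J] by (auto simp: chain_def L2_poly)

lemma chain_diff: "chain n G \<Longrightarrow> chain n G' \<Longrightarrow> chain n (\<lambda>i x. G i x - G' i x)"
  by (auto simp: chain_def abs_cont_diff L2_diff(1))

text \<open>Unnormalised: the squared coefficient along the unit vector is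
  \<open>(cf h k)^2 / ek k\<close>.\<close>

definition cf :: "(real \<Rightarrow> real) \<Rightarrow> nat \<Rightarrow> real" where "cf h k = ip 0 h (poly (Rod 0 k))"

definition ek :: "nat \<Rightarrow> real" where "ek k = nrm 0 (poly (Rod 0 k))"

text \<open>Each \<open>Ast\<close> in \<open>Rod 0 k\<close> is traded for one derivative of the
  function. For \<open>i = k\<close> the polynomial is 1, and the coefficient becomes the integral
  of \<open>G k\<close> against \<open>W k\<close>.\<close>

lemma chain_cf:
  assumes "chain n G" "i \<le> n" "i \<le> k"
  shows "ip i (G i) (poly (Rod i (k - i))) = cf (G 0) k"
  using assms(2,3)
proof (induction i)
  case (Suc i)
  then have k: "k - i = Suc (k - Suc i)" by simp
  have "ip i (G i) (poly (Ast i (Rod (Suc i) (k - Suc i)))) = ip (Suc i) (G (Suc i)) (poly (Rod (Suc i) (k - Suc i)))"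
    using Suc.prems assms(1) chain_L2[OF assms(1), of "Suc i"] by (intro adjoint_L2) (auto simp: chain_def)
  then show ?case using Suc k by simp
qed (simp add: cf_def)

lemma ip_poly_smult: "ip i h (poly (smult c p)) = c * ip i h (poly p)"
proof -
  have "ip i h (poly (smult c p)) = (LBINT x:J. c * (h x * poly p x * W i x))"
    by (simp add: mult_ac)
  then show ?thesis by simp
qed

lemma ip_poly_add:
  assumes "L2 i h"
  shows "ip i h (poly (p + r)) = ip i h (poly p) + ip i h (poly r)"
  using set_integral_add(2)[OF ip_int[OF assms L2_poly[of i p]] ip_int[OF assms L2_poly[of i r]]]
  by (simp add: algebra_simps)

lemma ip_poly_sum:
  "L2 i h \<Longrightarrow> ip i h (poly (\<Sum>k\<in>A. smult (c k) (p k))) = (\<Sum>k\<in>A. c k * ip i h (poly (p k)))"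
  by (induction A rule: infinite_finite_induct) (simp_all add: ip_poly_add ip_poly_smult del: poly_add poly_smult)

lemma chain_ip_higher_pderiv:
  assumes "chain n G" "i \<le> n"
  shows "ip i (G i) (poly ((pderiv ^^ i) (Rod 0 k))) = NN i k * cf (G 0) k"
proof (cases "i \<le> k")
  case True
  then show ?thesis unfolding higher_pderiv_Rod ip_poly_smult using chain_cf[OF assms] by simp
next
  case False
  then show ?thesis unfolding higher_pderiv_Rod ip_poly_smult using NN_zero[of k i] by simp
qed

text \<open>Trading \<open>k\<close> factors for derivatives leaves the \<open>k\<close>-th
  derivative of \<open>Rod 0 j\<close>, which is 0 for \<open>j < k\<close>; symmetry of the inner
  product covers \<open>k < j\<close>, and the diagonal leaves the mass of
  \<open>W k\<close>.\<close>

lemma cf_Rod: "cf (poly (Rod 0 j)) k = (if j = k then NN k k * (LBINT x:J. W k x) else 0)"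
proof -
  have up: "cf (poly (Rod 0 j)) k = NN k j * ip k (poly (Rod k (j - k))) (poly 1)" for j k
  proof -
    have "cf (poly (Rod 0 j)) k = ip k (poly ((pderiv ^^ k) (Rod 0 j))) (poly (Rod k (k - k)))"
      using chain_cf[OF chain_poly, of k k k "Rod 0 j"] by simp
    also have "\<dots> = (LBINT x:J. NN k j * (poly (Rod k (j - k)) x * poly 1 x * W k x))"
      unfolding higher_pderiv_Rod by (simp add: mult_ac)
    finally show ?thesis by simp
  qed
  have sym: "cf (poly (Rod 0 j)) k = cf (poly (Rod 0 k)) j" by (simp add: cf_def mult_ac)
  consider "j < k" | "k < j" | "j = k" by linarith
  then show ?thesis
  proof cases
    case 1 then show ?thesis by (simp add: up NN_zero)
  next
    case 2 then show ?thesis unfolding sym by (simp add: up NN_zero)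
  next
    case 3 then show ?thesis by (simp add: up)
  qed
qed

lemma ek_eq: "ek k = NN k k * (LBINT x:J. W k x)"
  using cf_Rod[of k k] by (simp add: ek_def cf_def power2_eq_square)

lemma W_integral_pos: "0 < (LBINT x:J. W k x)"
proof -
  have "0 < (LBINT x:{l 0..u 0}. W k x)"
    using Icc_subset[of 0] by (intro set_integral_pos_Icc l_less_u continuous_on_subset[OF W_cont]) (auto intro: W_pos)
  also have "\<dots> \<le> (LBINT x:J. W k x)"
    by (intro set_integral_mono_set W_integrable Icc_subset) (auto intro: less_imp_le W_pos)
  finally show ?thesis .
qed

lemma ek_pos: "0 < ek k"
  unfolding ek_eq using NN_pos[of k k] W_integral_pos by simp

section \<open>Projections and decay of the remainders\<close>

definition proj :: "(real \<Rightarrow> real) \<Rightarrow> nat \<Rightarrow> real poly" where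
  "proj h N = (\<Sum>k\<le>N. smult (cf h k / ek k) (Rod 0 k))"

lemma cf_proj: "cf (poly (proj h N)) k = (if k \<le> N then cf h k else 0)"
proof -
  have "cf (poly (proj h N)) k = ip 0 (poly (Rod 0 k)) (poly (proj h N))"
    by (simp add: cf_def mult_ac)
  also have "\<dots> = (\<Sum>j\<le>N. cf h j / ek j * ip 0 (poly (Rod 0 k)) (poly (Rod 0 j)))"
    unfolding proj_def by (rule ip_poly_sum[OF L2_poly])
  also have "\<dots> = (\<Sum>j\<le>N. cf h j / ek j * (if k = j then ek k else 0))"
    using cf_Rod[of k] unfolding cf_def ek_eq by (intro sum.cong) auto
  also have "\<dots> = (\<Sum>j\<le>N. if k = j then cf h j else 0)"
    using ek_pos by (intro sum.cong) (auto simp: less_imp_neq[symmetric])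
  also have "\<dots> = (if k \<le> N then cf h k else 0)" by (simp add: sum.delta')
  finally show ?thesis .
qed

lemma degree_proj: "degree (proj h N) \<le> N"
  unfolding proj_def by (intro degree_sum_le) (auto intro: order_trans[OF degree_smult_le] order_trans[OF degree_Rod_le])

text \<open>A single projection, made for \<open>W 0\<close>, is differentiated. It serves every
  order at once, because the derivatives of the Rodrigues polynomials stay orthogonal for the
  successive weights.\<close>

definition rem :: "(nat \<Rightarrow> real \<Rightarrow> real) \<Rightarrow> nat \<Rightarrow> nat \<Rightarrow> real \<Rightarrow> real" where
  "rem G N i x = G i x - poly ((pderiv ^^ i) (proj (G 0) N)) x"

lemma chain_rem: "chain n G \<Longrightarrow> chain n (rem G N)"
  unfolding rem_def[abs_def] by (intro chain_diff chain_poly)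

lemma ip_proj:
  assumes "chain n G" "i \<le> n"
  shows "ip i (G i) (poly ((pderiv ^^ i) (proj h N))) = (\<Sum>k\<le>N. NN i k * cf (G 0) k * cf h k / ek k)"
proof -
  have "(pderiv ^^ i) (proj h N) = (\<Sum>k\<le>N. smult (cf h k / ek k) ((pderiv ^^ i) (Rod 0 k)))"
    by (simp add: proj_def higher_pderiv_sum higher_pderiv_smult)
  then have "ip i (G i) (poly ((pderiv ^^ i) (proj h N))) =
      (\<Sum>k\<le>N. cf h k / ek k * ip i (G i) (poly ((pderiv ^^ i) (Rod 0 k))))"
    using ip_poly_sum[OF chain_L2[OF assms], of "\<lambda>k. cf h k / ek k" "\<lambda>k. (pderiv ^^ i) (Rod 0 k)" "{..N}"] by simp
  also have "\<dots> = (\<Sum>k\<le>N. NN i k * cf (G 0) k * cf h k / ek k)"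
    unfolding chain_ip_higher_pderiv[OF assms] by (simp add: mult_ac)
  finally show ?thesis .
qed

lemma nrm_rem:
  assumes "chain n G" "i \<le> n"
  shows "nrm i (rem G N i) = nrm i (G i) - (\<Sum>k\<le>N. NN i k * (cf (G 0) k)^2 / ek k)"
proof -
  let ?D = "poly ((pderiv ^^ i) (proj (G 0) N))"
  have "nrm i (rem G N i) = nrm i (G i) - 2 * ip i (G i) ?D + nrm i ?D"
    unfolding rem_def by (rule L2_diff(2)[OF chain_L2[OF assms] L2_poly])
  moreover have "nrm i ?D = (\<Sum>k\<le>N. NN i k * (cf (G 0) k)^2 / ek k)"
  proof -
    have "nrm i ?D = ip i ?D ?D" by (simp add: power2_eq_square)
    also have "\<dots> = (\<Sum>k\<le>N. NN i k * cf (poly (proj (G 0) N)) k * cf (G 0) k / ek k)"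
      using ip_proj[OF chain_poly[of i "proj (G 0) N"] order_refl] by simp
    also have "\<dots> = (\<Sum>k\<le>N. NN i k * (cf (G 0) k)^2 / ek k)"
      by (intro sum.cong) (simp_all add: cf_proj power2_eq_square)
    finally show ?thesis .
  qed
  moreover have "ip i (G i) ?D = (\<Sum>k\<le>N. NN i k * (cf (G 0) k)^2 / ek k)"
    using ip_proj[OF assms] by (simp add: power2_eq_square mult.assoc)
  ultimately show ?thesis by simp
qed

lemma cf_rem:
  assumes "L2 0 (G 0)" "k \<le> N"
  shows "cf (rem G N 0) k = 0"
proof -
  have "cf (rem G N 0) k = (LBINT x:J. G 0 x * poly (Rod 0 k) x * W 0 x - poly (proj (G 0) N) x * poly (Rod 0 k) x * W 0 x)"
    by (simp add: cf_def rem_def algebra_simps)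
  also have "\<dots> = cf (G 0) k - cf (poly (proj (G 0) N)) k"
    unfolding cf_def by (intro set_integral_diff(2) ip_int assms L2_poly)
  finally show ?thesis using assms(2) by (simp add: cf_proj)
qed

text \<open>Elimination of leading coefficients, possible since \<open>Rod 0 d\<close> has degree
  exactly \<open>d\<close> by \<open>coeff_Rod_pos\<close>.\<close>

lemma orthogonal_polys:
  assumes L: "L2 0 h" and cf: "\<And>k. k \<le> N \<Longrightarrow> cf h k = 0" and deg: "degree p \<le> N"
  shows "ip 0 h (poly p) = 0"
proof -
  have "ip 0 h (poly p) = 0" if "d \<le> Suc N" "\<And>i. d \<le> i \<Longrightarrow> coeff p i = 0" for d p
    using that
  proof (induction d arbitrary: p)
    case 0
    then have "p = 0" by (simp add: poly_eq_iff)
    then show ?case by simp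
  next
    case (Suc d)
    define c where "c = coeff p d / coeff (Rod 0 d) d"
    define p' where "p' = p + smult (- c) (Rod 0 d)"
    have "coeff p' i = 0" if "d \<le> i" for i
    proof (cases "i = d")
      case True
      then show ?thesis using coeff_Rod_pos[of 0 d] by (simp add: p'_def c_def)
    next
      case False
      then have "coeff (Rod 0 d) i = 0" using degree_Rod_le[of 0 d] that by (intro coeff_eq_0) auto
      then show ?thesis using Suc.prems(2)[of i] False that by (simp add: p'_def)
    qed
    then have "ip 0 h (poly p') = 0" using Suc by auto
    moreover have "ip 0 h (poly p') = ip 0 h (poly p) + - c * cf h d"
      unfolding p'_def ip_poly_add[OF L] ip_poly_smult cf_def ..
    ultimately show ?case using cf[of d] Suc.prems(1) by simp
  qed
  from this[of "Suc N" p] show ?thesis using deg by (simp add: coeff_eq_0)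
qed

text \<open>The composite \<open>Ast 0 (... (Ast (i - 1) r))\<close>: a polynomial test of the
  \<open>i\<close>-th derivative becomes a polynomial test of the function, at the price of
  \<open>i\<close> degrees.\<close>

fun lift :: "nat \<Rightarrow> real poly \<Rightarrow> real poly" where
  "lift 0 r = r"
| "lift (Suc i) r = lift i (Ast i r)"

lemma degree_lift: "degree (lift i r) \<le> degree r + i"
proof (induction i arbitrary: r)
  case (Suc i)
  then show ?case using degree_Ast_le[of i r] order_trans[OF Suc[of "Ast i r"]] by simp
qed simp

lemma ip_lift:
  assumes "chain n G" "i \<le> n"
  shows "ip i (G i) (poly r) = ip 0 (G 0) (poly (lift i r))"
  using assms(2)
proof (induction i arbitrary: r)
  case (Suc i)
  have "ip i (G i) (poly (Ast i r)) = ip (Suc i) (G (Suc i)) (poly r)"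
    using Suc.prems assms(1) chain_L2[OF assms(1), of "Suc i"] by (intro adjoint_L2) (auto simp: chain_def)
  then show ?case using Suc.IH[of "Ast i r"] Suc.prems by simp
qed simp

text \<open>Polynomials of degree at most \<open>N - i\<close> lift to degree at most
  \<open>N\<close>, so the \<open>i\<close>-th remainder is orthogonal to them and
  \<open>poincare\<close> applies with the gap \<open>lam (Suc N) - lam i\<close>. The estimate
  consumes the derivative of order \<open>Suc i\<close>, which is why it stops below
  \<open>n\<close>.\<close>

lemma nrm_rem_bound:
  assumes G: "chain n G" and i: "i < n" "i \<le> N"
  shows "nrm i (rem G N i) \<le> nrm (Suc i) (G (Suc i)) / (real (Suc N) - real i)"
proof -
  note R = chain_rem[OF G, of N]
  have "ip i (rem G N i) (poly r) = 0" if r: "degree r \<le> N - i" for r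
  proof -
    have deg: "degree (lift i r) \<le> N" using degree_lift[of i r] r i by simp
    have L: "L2 0 (rem G N 0)" using chain_L2[OF R] by simp
    have "cf (rem G N 0) k = 0" if "k \<le> N" for k using cf_rem[where G=G, OF chain_L2[OF G le0] that] by simp
    then have "ip 0 (rem G N 0) (poly (lift i r)) = 0" by (rule orthogonal_polys[OF L _ deg])
    then show ?thesis using ip_lift[OF R, of i r] i by simp
  qed
  then have "(lam (i + (N - i) + 1) - lam i) * nrm i (rem G N i) \<le> nrm (Suc i) (rem G N (Suc i))"
    using R i chain_L2[OF R, of "Suc i"] by (intro poincare) (auto simp: chain_def)
  also have "\<dots> \<le> nrm (Suc i) (G (Suc i))"
  proof -
    have "0 \<le> (\<Sum>k\<le>N. NN (Suc i) k * (cf (G 0) k)^2 / ek k)"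
      using NN_nonneg ek_pos by (intro sum_nonneg) (auto simp: less_imp_le)
    then show ?thesis using nrm_rem[OF G, of "Suc i" N] i by simp
  qed
  finally have 1: "(lam (Suc N) - lam i) * nrm i (rem G N i) \<le> nrm (Suc i) (G (Suc i))" using i by simp
  have "(real (Suc N) - real i) * nrm i (rem G N i) \<le> (lam (Suc N) - lam i) * nrm i (rem G N i)"
    using lam_diff_ge[of i "Suc N"] i by (intro mult_right_mono nrm_nonneg) auto
  with 1 have "(real (Suc N) - real i) * nrm i (rem G N i) \<le> nrm (Suc i) (G (Suc i))" by linarith
  then show ?thesis using i by (simp add: pos_le_divide_eq mult.commute)
qed

lemma nrm_rem_tendsto:
  assumes G: "chain n G" and i: "i < n"
  shows "(\<lambda>N. nrm i (rem G N i)) \<longlonglongrightarrow> 0"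
proof (rule tendsto_sandwich[of "\<lambda>_. 0"])
  show "\<forall>\<^sub>F N in sequentially. nrm i (rem G N i) \<le> nrm (Suc i) (G (Suc i)) / (real (Suc N) - real i)"
    using eventually_ge_at_top[of i] by eventually_elim (rule nrm_rem_bound[OF G i])
  have "filterlim (\<lambda>N. real (Suc N) - real i) at_top sequentially"
  proof -
    have "filterlim (\<lambda>N. (1 - real i) + real N) at_top sequentially"
      by (rule filterlim_tendsto_add_at_top[OF tendsto_const filterlim_real_sequentially])
    then show ?thesis by (simp add: algebra_simps)
  qed
  then show "(\<lambda>N. nrm (Suc i) (G (Suc i)) / (real (Suc N) - real i)) \<longlonglongrightarrow> 0"
    by (rule tendsto_divide_0[OF tendsto_const filterlim_at_top_imp_at_infinity])
qed (auto intro: nrm_nonneg always_eventually)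

end

section \<open>The coefficients\<close>

lemma falling_fact_0 [simp]: "falling_fact x 0 = 1"
  by (simp add: falling_fact_def)

lemma falling_fact_Suc: "falling_fact x (Suc k) = falling_fact x k * (x - real k)"
  by (simp add: falling_fact_def)

lemma falling_fact_Suc_shift: "falling_fact (x + 1) (Suc k) = (x + 1) * falling_fact x k"
  unfolding falling_fact_def by (simp add: prod.lessThan_Suc_shift algebra_simps del: prod.lessThan_Suc)

lemma falling_fact_choose: "falling_fact (real m) i = real (m choose i) * fact i"
  by (simp add: falling_fact_def binomial_gbinomial gbinomial_mult_fact' lessThan_atLeast0)

lemma falling_fact_pos: "i \<le> m \<Longrightarrow> 0 < falling_fact (real m) i"
  unfolding falling_fact_choose by simp

lemma choose_Suc_mult: "real (Suc i) * real (n choose Suc i) = (real n - real i) * real (n choose i)"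
proof (cases "i \<le> n")
  case True
  have "Suc i * (n choose Suc i) = (n - i) * (n choose i)"
    using binomial_absorption[of i n] binomial_absorb_comp[of n i] by simp
  then show ?thesis using True by (metis of_nat_diff of_nat_mult)
qed (simp add: binomial_eq_0)

context pearson_weight
begin

lemma one_minus_pos: "1 \<le> 1 - real j * \<delta>"
  using delta by (simp add: mult_nonneg_nonpos)

lemma prod_one_minus_pos: "0 < (\<Prod>j\<in>A. 1 - real j * \<delta>)"
  by (rule prod_pos) (rule less_le_trans[OF zero_less_one one_minus_pos])

lemma one_minus_ne: "1 - real j * \<delta> \<noteq> 0"
  using one_minus_pos[of j] by simp

definition bc :: "nat \<Rightarrow> nat \<Rightarrow> nat \<Rightarrow> real" where
  "bc m n i = real (n choose i) / (falling_fact (real (m + n)) i * (\<Prod>j\<in>{m..<m+i}. 1 - real j * \<delta>))"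

text \<open>For \<open>m = i = 0\<close> the index set \<open>{m..m + i - 1}\<close> is \<open>{0}\<close> because of truncated subtraction, but
  the extra factor is 1.\<close>

lemma coef_b_eq: "coef_b \<delta> m n i = bc m n i"
proof (cases "m + i = 0")
  case True
  then show ?thesis by (simp add: coef_b_def bc_def)
next
  case False
  then have "{m..m+i-1} = {m..<m+i}" by auto
  then show ?thesis by (simp add: coef_b_def bc_def)
qed

lemma lam_pos: "0 < k \<Longrightarrow> 0 < lam k"
  using lam_less[of 0 k] by (simp add: lam_def)

lemma lam_nat: "lam (Suc k) = (real k + 1) * (1 - real k * \<delta>)"
  by (simp add: lam_def)

text \<open>This is what the Newton coefficients must satisfy when the node
  \<open>lam (Suc (m + n))\<close> joins the product. Over the common denominator
  \<open>F * P * e\<close> it reduces to Pascal's rule and \<open>choose_Suc_mult\<close>.\<close>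

lemma bc_rec:
  assumes "i \<le> n"
  shows "lam (Suc (m + n)) * bc m (Suc n) (Suc i) = bc m n (Suc i) * (lam (Suc (m + n)) - lam (Suc i)) + bc m n i"
proof -
  define F where "F = falling_fact (real (m + n)) i"
  define P where "P = (\<Prod>j\<in>{m..<m+i}. 1 - real j * \<delta>)"
  define e where "e = 1 - real (m + i) * \<delta>"
  have F0: "F > 0" unfolding F_def using assms by (intro falling_fact_pos) simp
  have P0: "P > 0" unfolding P_def by (rule prod_one_minus_pos)
  have e0: "e \<noteq> 0" unfolding e_def by (rule one_minus_ne)
  have PS: "(\<Prod>j\<in>{m..<m+Suc i}. 1 - real j * \<delta>) = P * e" by (simp add: P_def e_def)
  have FS: "falling_fact (real (m + n)) (Suc i) = F * (real (m + n) - real i)" by (simp add: F_def falling_fact_Suc)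
  have FSS: "falling_fact (real (m + Suc n)) (Suc i) = (real (m + n) + 1) * F"
    using falling_fact_Suc_shift[of "real (m + n)" i] by (simp add: F_def add_ac)
  have L: "lam (Suc (m + n)) = (real (m + n) + 1) * (1 - real (m + n) * \<delta>)" by (rule lam_nat)
  have D: "lam (Suc (m + n)) - lam (Suc i) = (real (m + n) - real i) * (1 - (real (m + n) + real i + 1) * \<delta>)"
    by (simp add: lam_diff algebra_simps)
  have lhs: "lam (Suc (m + n)) * bc m (Suc n) (Suc i) = real (Suc n choose Suc i) * (1 - real (m + n) * \<delta>) / (F * P * e)"
  proof -
    have "(c * k) * (a / ((c * F) * (P * e))) = a * k / (F * P * e)" if "c \<noteq> 0" for a c k :: real
      using that by (simp add: mult_ac)
    moreover have "real (m + n) + 1 \<noteq> 0" by linarith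
    ultimately show ?thesis unfolding bc_def PS FSS L by blast
  qed
  have bi: "bc m n i = real (n choose i) * e / (F * P * e)"
    using e0 by (simp add: bc_def F_def P_def)
  have key: "real (Suc n choose Suc i) * (1 - real (m + n) * \<delta>) =
      real (n choose Suc i) * (1 - (real (m + n) + real i + 1) * \<delta>) + real (n choose i) * e"
  proof -
    have "(real i + 1) * real (n choose Suc i) = (real n - real i) * real (n choose i)"
      using choose_Suc_mult[of i n] by (simp add: add.commute)
    then have "\<delta> * ((real i + 1) * real (n choose Suc i)) = \<delta> * ((real n - real i) * real (n choose i))" by simp
    then show ?thesis by (simp add: e_def algebra_simps)
  qed
  show ?thesis
  proof (cases "m + n = i")
    \<comment> \<open>The factor \<open>real (m + n) - real i\<close> is 0 and cannot be cancelled,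
      but here \<open>m = 0\<close> and \<open>i = n\<close>, so \<open>n choose Suc i\<close>
      vanishes as well.\<close>
    case True
    then have zero: "n choose Suc i = 0" using assms by simp
    then have b0: "bc m n (Suc i) = 0" by (simp add: bc_def)
    show ?thesis unfolding lhs key bi b0 zero by simp
  next
    case False
    then have ne: "real (m + n) - real i \<noteq> 0" using assms by linarith
    have "bc m n (Suc i) * (lam (Suc (m + n)) - lam (Suc i)) =
        real (n choose Suc i) * (1 - (real (m + n) + real i + 1) * \<delta>) / (F * P * e)"
      unfolding bc_def PS FS D using ne by simp
    then show ?thesis unfolding lhs key bi by (simp add: add_divide_distrib)
  qed
qed

lemma newton_expansion:
  "(\<Sum>i\<le>n. (-1) ^ i * bc m n i * (\<Prod>r<i. x - lam r)) = (\<Prod>r\<in>{m<..m+n}. 1 - x / lam r)"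
proof (induction n)
  case 0
  show ?case by (simp add: bc_def)
next
  case (Suc n)
  let ?L = "lam (Suc (m + n))" and ?N = "\<lambda>i. \<Prod>r<i. x - lam r"
  have L0: "?L > 0" by (simp add: lam_pos)
  have b0: "bc m k 0 = 1" for k by (simp add: bc_def)
  have bS: "bc m n (Suc n) = 0" by (simp add: bc_def)
  have "{m<..m + Suc n} = insert (Suc (m + n)) {m<..m + n}" by auto
  then have "(\<Prod>r\<in>{m<..m+Suc n}. 1 - x / lam r) = (1 - x / ?L) * (\<Sum>i\<le>n. (-1) ^ i * bc m n i * ?N i)"
    using Suc by simp
  then have "?L * (\<Prod>r\<in>{m<..m+Suc n}. 1 - x / lam r) = (?L * (1 - x / ?L)) * (\<Sum>i\<le>n. (-1) ^ i * bc m n i * ?N i)"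
    by simp
  also have "?L * (1 - x / ?L) = ?L - x" using L0 by (simp add: right_diff_distrib)
  also have "(?L - x) * (\<Sum>i\<le>n. (-1) ^ i * bc m n i * ?N i) = (\<Sum>i\<le>n. (-1) ^ i * bc m n i * (?N i * (?L - x)))"
    by (simp add: sum_distrib_left mult_ac)
  \<comment> \<open>In the \<open>i\<close>-th term \<open>?L - x\<close> is split as
    \<open>(?L - lam i) - (x - lam i)\<close>; the second part advances the Newton basis by one
    node.\<close>
  also have "\<dots> = (\<Sum>i\<le>n. (-1) ^ i * bc m n i * (?L - lam i) * ?N i + (-1) ^ Suc i * bc m n i * ?N (Suc i))"
    by (intro sum.cong) (auto simp: algebra_simps)
  also have "\<dots> = (\<Sum>i\<le>Suc n. (-1) ^ i * bc m n i * (?L - lam i) * ?N i) + (\<Sum>i\<le>n. (-1) ^ Suc i * bc m n i * ?N (Suc i))"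
    unfolding sum.distrib by (simp add: bS)
  also have "\<dots> = ?L + (\<Sum>i\<le>n. (-1) ^ Suc i * (bc m n (Suc i) * (?L - lam (Suc i)) + bc m n i) * ?N (Suc i))"
    by (subst sum.atMost_Suc_shift) (simp add: b0 lam_def[of 0] sum.distrib[symmetric] algebra_simps del: prod.lessThan_Suc)
  also have "\<dots> = ?L + (\<Sum>i\<le>n. (-1) ^ Suc i * (?L * bc m (Suc n) (Suc i)) * ?N (Suc i))"
    by (intro arg_cong2[of _ _ _ _ "(+)"] sum.cong refl) (simp add: bc_rec)
  also have "\<dots> = ?L * (\<Sum>i\<le>Suc n. (-1) ^ i * bc m (Suc n) i * ?N i)"
    by (subst sum.atMost_Suc_shift) (simp add: b0 sum_distrib_left algebra_simps del: prod.lessThan_Suc)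
  finally show ?case using L0 by simp
qed

section \<open>The node products: normalisation, sign and monotonicity\<close>

definition Lam :: "nat \<Rightarrow> nat \<Rightarrow> real" where "Lam m n = (\<Prod>r\<in>{m<..m+n}. lam r)"

definition RR :: "nat \<Rightarrow> nat \<Rightarrow> nat \<Rightarrow> real" where "RR m n k = (\<Prod>r\<in>{m<..m+n}. 1 - lam k / lam r)"

definition TT :: "nat \<Rightarrow> nat \<Rightarrow> nat \<Rightarrow> real" where "TT m n k = (\<Prod>r\<in>{m<..m+n}. lam k - lam r)"

lemma Lam_pos: "0 < Lam m n"
  unfolding Lam_def by (intro prod_pos) (auto intro: lam_pos)

lemma TT_eq: "TT m n k = (-1) ^ n * Lam m n * RR m n k"
proof -
  have "TT m n k = (\<Prod>r\<in>{m<..m+n}. (-1) * (lam r * (1 - lam k / lam r)))"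
    unfolding TT_def
  proof (intro prod.cong refl)
    fix r assume "r \<in> {m<..m+n}"
    then have "lam r > 0" by (intro lam_pos) auto
    then show "lam k - lam r = (-1) * (lam r * (1 - lam k / lam r))" by (simp add: field_simps)
  qed
  then show ?thesis unfolding prod.distrib by (simp add: Lam_def RR_def)
qed

lemma bc_NN: "(\<Sum>i\<le>n. (-1) ^ i * bc m n i * NN i k) = RR m n k"
  unfolding NN_def RR_def by (rule newton_expansion)

lemma Lam_eq: "Lam m n = falling_fact (real (m + n)) n * (\<Prod>j\<in>{m..<m+n}. 1 - real j * \<delta>)"
proof (induction n)
  case 0
  then show ?case by (simp add: Lam_def)
next
  case (Suc n)
  have "{m<..m + Suc n} = insert (Suc (m + n)) {m<..m + n}" by auto
  then have "Lam m (Suc n) = lam (Suc (m + n)) * Lam m n" by (simp add: Lam_def)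
  also have "\<dots> = ((real (m + n) + 1) * falling_fact (real (m + n)) n) * (\<Prod>j\<in>{m..<m+Suc n}. 1 - real j * \<delta>)"
    by (simp add: Suc lam_nat mult_ac)
  finally show ?case using falling_fact_Suc_shift[of "real (m + n)" n] by (simp add: add_ac)
qed

lemma bc_top: "bc m n n = 1 / Lam m n"
  by (simp add: bc_def Lam_eq)

lemma zeta_eq: "0 < n \<Longrightarrow> zeta m1 m2 n \<delta> = Lam m2 n / Lam m1 n"
proof -
  assume "0 < n"
  then have "{m..m+n-1} = {m..<m+n}" for m by auto
  then show ?thesis by (simp add: zeta_def Lam_eq)
qed

lemma Lam_shift: "Lam m n = (\<Prod>t<n. lam (Suc (m + t)))"
proof -
  have "{m<..m+n} = (\<lambda>t. Suc (m + t)) ` {..<n}"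
  proof (intro equalityI subsetI)
    fix r assume "r \<in> {m<..m+n}"
    then show "r \<in> (\<lambda>t. Suc (m + t)) ` {..<n}" by (intro image_eqI[of _ _ "r - Suc m"]) auto
  qed auto
  then show ?thesis unfolding Lam_def by (simp add: prod.reindex inj_on_def)
qed

lemma TT_shift: "TT m n k = (\<Prod>t<n. lam k - lam (Suc (m + t)))"
proof -
  have "{m<..m+n} = (\<lambda>t. Suc (m + t)) ` {..<n}"
  proof (intro equalityI subsetI)
    fix r assume "r \<in> {m<..m+n}"
    then show "r \<in> (\<lambda>t. Suc (m + t)) ` {..<n}" by (intro image_eqI[of _ _ "r - Suc m"]) auto
  qed auto
  then show ?thesis unfolding TT_def by (simp add: prod.reindex inj_on_def)
qed

lemma Lam_less: "m1 < m2 \<Longrightarrow> 0 < n \<Longrightarrow> Lam m1 n < Lam m2 n"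
  unfolding Lam_shift by (intro prod_mono_strict) (auto intro: lam_less less_imp_le[OF lam_pos] lam_pos less_imp_le[OF lam_less])

lemma TT_zero: "m < k \<Longrightarrow> k \<le> m + n \<Longrightarrow> TT m n k = 0"
  unfolding TT_def by (auto intro!: bexI[of _ k])

lemma TT_pos: "m + n < k \<Longrightarrow> 0 < TT m n k"
  unfolding TT_def by (intro prod_pos) (auto intro: lam_less)

lemma TT_less: "m1 < m2 \<Longrightarrow> 0 < n \<Longrightarrow> m2 + n < k \<Longrightarrow> TT m2 n k < TT m1 n k"
  unfolding TT_shift by (intro prod_mono_strict) (auto intro: lam_less less_imp_le[OF lam_less])

text \<open>Each \<open>lam i - lam r\<close> is
  \<open>(i - r) * (1 - (i - 1 + r) * \<delta>)\<close>, which is where the product from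
  \<open>i - 1\<close> to \<open>2 * i - 2\<close> in the denominator of \<open>coef_a\<close> comes
  from; \<open>i > 0\<close> makes the truncated \<open>i - 1\<close> exact.\<close>

lemma NN_diag: "NN i i = fact i * (\<Prod>j\<in>{i-1..2*i-2}. 1 - real j * \<delta>)" if "0 < i"
proof -
  have "{i-1..2*i-2} = (\<lambda>r. i - 1 + r) ` {..<i}"
  proof (intro equalityI subsetI)
    fix j assume "j \<in> {i-1..2*i-2}"
    then show "j \<in> (\<lambda>r. i - 1 + r) ` {..<i}" using that by (intro image_eqI[of _ _ "j - (i - 1)"]) auto
  qed (use that in auto)
  moreover have "inj_on (\<lambda>r. i - 1 + r) {..<i}" using that by (auto simp: inj_on_def)
  ultimately have 1: "(\<Prod>j\<in>{i-1..2*i-2}. 1 - real j * \<delta>) = (\<Prod>r<i. 1 - real (i - 1 + r) * \<delta>)"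
    by (simp only: prod.reindex o_def)
  have "(\<Prod>r<i. real i - real r) = fact i"
    using falling_fact_choose[of i i] by (simp add: falling_fact_def)
  moreover have "NN i i = (\<Prod>r<i. (real i - real r) * (1 - real (i - 1 + r) * \<delta>))"
    unfolding NN_def lam_diff using that by (intro prod.cong) (auto simp: of_nat_diff algebra_simps)
  ultimately show ?thesis unfolding 1 prod.distrib by simp
qed

text \<open>With \<open>NN_diag\<close> and \<open>ek_eq\<close> this identifies
  \<open>coef_a\<close> as \<open>RR m n i / ek i\<close>: precisely the weight of the squared
  \<open>i\<close>-th coefficient in the combination of norms, so the first sum in
  \<open>S_mn\<close> removes it.\<close>

lemma RR_eq:
  assumes "i \<le> m"
  shows "RR m n i = real (m choose i) * fact i * (\<Prod>j\<in>{m+i..<m+n+i}. 1 - real j * \<delta>) /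
    (falling_fact (real (m + n)) i * (\<Prod>j\<in>{m..<m+n}. 1 - real j * \<delta>))"
proof (induction n)
  case 0
  have "falling_fact (real m) i > 0" using assms by (rule falling_fact_pos)
  then show ?case by (simp add: RR_def flip: falling_fact_choose)
next
  case (Suc n)
  let ?e = "1 - real (m + n) * \<delta>" and ?e' = "1 - real (m + n + i) * \<delta>"
  have "{m<..m + Suc n} = insert (Suc (m + n)) {m<..m + n}" by auto
  then have R: "RR m (Suc n) i = (1 - lam i / lam (Suc (m + n))) * RR m n i" by (simp add: RR_def)
  have e0: "?e \<noteq> 0" by (rule one_minus_ne)
  have D: "lam (Suc (m + n)) - lam i = (real (m + n) + 1 - real i) * ?e'" by (simp add: lam_diff algebra_simps)
  have L: "lam (Suc (m + n)) = (real (m + n) + 1) * ?e" by (rule lam_nat)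
  have "lam (Suc (m + n)) > 0" by (simp add: lam_pos)
  then have "1 - lam i / lam (Suc (m + n)) = (lam (Suc (m + n)) - lam i) / lam (Suc (m + n))"
    by (simp add: diff_divide_distrib)
  also have "\<dots> = (real (m + n) + 1 - real i) * ?e' / ((real (m + n) + 1) * ?e)"
    by (rule arg_cong2[OF D L])
  finally have f: "1 - lam i / lam (Suc (m + n)) = (real (m + n) + 1 - real i) * ?e' / ((real (m + n) + 1) * ?e)" .
  have ff: "falling_fact (real (m + Suc n)) i * (real (m + n) + 1 - real i) = (real (m + n) + 1) * falling_fact (real (m + n)) i"
    using falling_fact_Suc_shift[of "real (m + n)" i] falling_fact_Suc[of "real (m + Suc n)" i] by (simp add: add_ac)
  have p: "falling_fact (real (m + Suc n)) i > 0" "falling_fact (real (m + n)) i > 0"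
    using assms by (intro falling_fact_pos; simp)+
  have c0: "real (m + n) + 1 \<noteq> 0" by linarith
  have g: "(real (m + n) + 1 - real i) / (real (m + n) + 1) / falling_fact (real (m + n)) i
      = 1 / falling_fact (real (m + Suc n)) i"
  proof -
    have "b / c / B = 1 / A" if "A * b = c * B" "0 < A" "0 < B" "c \<noteq> 0" for A b c B :: real
      using that by (simp add: field_simps)
    from this[OF ff p c0] show ?thesis .
  qed
  have "RR m (Suc n) i = ((real (m + n) + 1 - real i) / (real (m + n) + 1) / falling_fact (real (m + n)) i) *
     (real (m choose i) * fact i * ((\<Prod>j\<in>{m+i..<m+n+i}. 1 - real j * \<delta>) * ?e') /
      ((\<Prod>j\<in>{m..<m+n}. 1 - real j * \<delta>) * ?e))"
    unfolding R f Suc by (simp add: mult_ac)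
  also have "\<dots> = real (m choose i) * fact i * (\<Prod>j\<in>{m+i..<m+Suc n+i}. 1 - real j * \<delta>) /
    (falling_fact (real (m + Suc n)) i * (\<Prod>j\<in>{m..<m+Suc n}. 1 - real j * \<delta>))"
    unfolding g by simp
  finally show ?case .
qed

end

section \<open>Residuals\<close>

context pearson_weight
begin

text \<open>Beyond order \<open>n\<close> only first moments of the derivatives are available; the weighted Hardy inequality
  supplies the polynomial weights that the Rodrigues polynomials produce.\<close>

lemma cf_eq_top_derivative:
  assumes G: "chain n G" and ac: "\<And>k. k < L \<Longrightarrow> abs_cont_deriv_on J (G k) (G (Suc k))"
    and int: "\<And>i. n < i \<Longrightarrow> i \<le> L \<Longrightarrow> set_integrable lborel J (\<lambda>x. \<bar>G i x\<bar> * W i x)"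
    and m: "m \<le> L"
  shows "(LBINT x:J. G m x * W m x) = cf (G 0) m"
proof (cases "m \<le> n")
  case True
  then show ?thesis using chain_cf[OF G True order_refl] by simp
next
  case False
  \<comment> \<open>Downward induction from \<open>m\<close> to \<open>n\<close>: each step adds one
    to the degree of the polynomial and, through \<open>hardy_L1\<close>, one to the admissible
    power of the weight.\<close>
  have "n \<le> i \<Longrightarrow> set_integrable lborel J (\<lambda>x. \<bar>G i x\<bar> * (wt (m - i) x * W i x)) \<and>
      ip i (G i) (poly (Rod i (m - i))) = (LBINT x:J. G m x * W m x)" if "i \<le> m" for i
    using that
  proof (induction rule: inc_induct)
    case base
    then show ?case using int[of m] False m by (simp add: wt_def)
  next
    case (step i)
    then have IH: "set_integrable lborel J (\<lambda>x. \<bar>G (Suc i) x\<bar> * (wt (m - Suc i) x * W (Suc i) x))"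
      "ip (Suc i) (G (Suc i)) (poly (Rod (Suc i) (m - Suc i))) = (LBINT x:J. G m x * W m x)" by auto
    have k: "m - i = Suc (m - Suc i)" using step.hyps by simp
    have v: "abs_cont_deriv_on J (G i) (G (Suc i))" using step.hyps m by (intro ac) simp
    have "ip i (G i) (poly (Ast i (Rod (Suc i) (m - Suc i)))) = ip (Suc i) (G (Suc i)) (poly (Rod (Suc i) (m - Suc i)))"
      using adjoint_L1[OF v IH(1) degree_Rod_le] by (simp add: mult.assoc)
    then show ?case using hardy_L1[OF v IH(1)] IH(2) unfolding k by simp
  qed
  from this[of n] False have "ip n (G n) (poly (Rod n (m - n))) = (LBINT x:J. G m x * W m x)" by simp
  then show ?thesis using chain_cf[OF G order_refl, of m] False by simp
qed

lemma ek_0: "ek 0 = 1"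
  using mass by (simp add: ek_eq NN_def W_def)

lemma RR_0: "RR m n 0 = 1"
  by (simp add: RR_def lam_def)

text \<open>\<open>VS\<close> is \<open>Var g - S\<close>; \<open>DV\<close> rescales it so that the term of order \<open>n\<close> gets coefficient 1.\<close>

definition VS :: "(nat \<Rightarrow> real \<Rightarrow> real) \<Rightarrow> nat \<Rightarrow> nat \<Rightarrow> real" where
  "VS G m n = nrm 0 (G 0) - (cf (G 0) 0)^2 - ((\<Sum>i=1..m. RR m n i / ek i * (cf (G 0) i)^2)
     + (\<Sum>i=1..n. (-1) ^ (i - 1) * bc m n i * nrm i (G i)))"

text \<open>Bessel's identity \<open>nrm_rem\<close> expands every norm up to degree
  \<open>N\<close>; by \<open>bc_NN\<close> the alternating sum over \<open>i\<close> collects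
  \<open>RR m n k\<close> in front of the \<open>k\<close>-th squared coefficient. The terms
  \<open>k \<le> m\<close> are cancelled by the first sum, with \<open>k = 0\<close> supplied by the
  squared mean.\<close>

lemma VS_eq:
  assumes G: "chain n G" and N: "m \<le> N"
  shows "VS G m n = (\<Sum>k\<in>{m<..N}. RR m n k * ((cf (G 0) k)^2 / ek k)) +
    (\<Sum>i\<le>n. (-1) ^ i * bc m n i * nrm i (rem G N i))"
proof -
  let ?x = "\<lambda>k. (cf (G 0) k)^2 / ek k"
  have "(\<Sum>i\<le>n. (-1) ^ i * bc m n i * nrm i (G i)) = nrm 0 (G 0) - (\<Sum>i=1..n. (-1) ^ (i - 1) * bc m n i * nrm i (G i))"
  proof -
    have "{..n} = insert 0 {1..n}" by auto
    then have "(\<Sum>i\<le>n. (-1) ^ i * bc m n i * nrm i (G i)) = nrm 0 (G 0) + (\<Sum>i=1..n. (-1) ^ i * bc m n i * nrm i (G i))"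
      by (simp add: bc_def)
    also have "(\<Sum>i=1..n. (-1) ^ i * bc m n i * nrm i (G i)) = (\<Sum>i=1..n. - ((-1) ^ (i - 1) * bc m n i * nrm i (G i)))"
    proof (intro sum.cong refl)
      fix i assume "i \<in> {1..n}"
      then obtain j where "i = Suc j" by (cases i) auto
      then show "(-1) ^ i * bc m n i * nrm i (G i) = - ((-1) ^ (i - 1) * bc m n i * nrm i (G i))" by simp
    qed
    finally show ?thesis by (simp add: sum_negf)
  qed
  moreover have "(\<Sum>i=1..m. RR m n i / ek i * (cf (G 0) i)^2) + (cf (G 0) 0)^2 = (\<Sum>k\<le>m. RR m n k * ?x k)"
  proof -
    have "{..m} = insert 0 {1..m}" by auto
    then show ?thesis by (simp add: RR_0 ek_0)
  qed
  moreover have "(\<Sum>k\<le>N. RR m n k * ?x k) = (\<Sum>k\<le>m. RR m n k * ?x k) + (\<Sum>k\<in>{m<..N}. RR m n k * ?x k)"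
  proof -
    have "{..N} = {..m} \<union> {m<..N}" using N by auto
    then show ?thesis by (simp add: sum.union_disjoint ivl_disj_int)
  qed
  moreover have "(\<Sum>i\<le>n. (-1) ^ i * bc m n i * nrm i (G i)) = (\<Sum>k\<le>N. RR m n k * ?x k) +
      (\<Sum>i\<le>n. (-1) ^ i * bc m n i * nrm i (rem G N i))"
  proof -
    have "(\<Sum>i\<le>n. (-1) ^ i * bc m n i * nrm i (G i)) =
      (\<Sum>i\<le>n. (\<Sum>k\<le>N. (-1) ^ i * bc m n i * NN i k * ?x k) + (-1) ^ i * bc m n i * nrm i (rem G N i))"
    proof (intro sum.cong refl)
      fix i assume "i \<in> {..n}"
      then have "nrm i (G i) = (\<Sum>k\<le>N. NN i k * ?x k) + nrm i (rem G N i)" using nrm_rem[OF G, of i N] by simp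
      then show "(-1) ^ i * bc m n i * nrm i (G i) =
        (\<Sum>k\<le>N. (-1) ^ i * bc m n i * NN i k * ?x k) + (-1) ^ i * bc m n i * nrm i (rem G N i)"
        by (simp only: distrib_left sum_distrib_left mult.assoc)
    qed
    also have "\<dots> = (\<Sum>k\<le>N. (\<Sum>i\<le>n. (-1) ^ i * bc m n i * NN i k) * ?x k) +
      (\<Sum>i\<le>n. (-1) ^ i * bc m n i * nrm i (rem G N i))"
      unfolding sum.distrib sum_distrib_right by (subst sum.swap) (rule refl)
    finally show ?thesis unfolding bc_NN .
  qed
  ultimately show ?thesis unfolding VS_def by linarith
qed

definition DV :: "(nat \<Rightarrow> real \<Rightarrow> real) \<Rightarrow> nat \<Rightarrow> nat \<Rightarrow> real" where
  "DV G m n = (-1) ^ n * Lam m n * VS G m n"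

definition tc :: "nat \<Rightarrow> nat \<Rightarrow> nat \<Rightarrow> real" where
  "tc m n i = (-1) ^ n * Lam m n * ((-1) ^ i * bc m n i)"

lemma tc_top: "tc m n n = 1"
  using Lam_pos[of m n] by (simp add: tc_def bc_top power_add[symmetric] mult_2[symmetric])

lemma DV_eq:
  assumes "chain n G" "m \<le> N"
  shows "DV G m n = (\<Sum>k\<in>{m<..N}. TT m n k * ((cf (G 0) k)^2 / ek k)) +
    ((\<Sum>i<n. tc m n i * nrm i (rem G N i)) + nrm n (rem G N n))"
proof -
  have "DV G m n = (\<Sum>k\<in>{m<..N}. TT m n k * ((cf (G 0) k)^2 / ek k)) + (\<Sum>i\<le>n. tc m n i * nrm i (rem G N i))"
    unfolding DV_def VS_eq[OF assms] TT_eq tc_def by (simp only: distrib_left sum_distrib_left mult.assoc)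
  also have "(\<Sum>i\<le>n. tc m n i * nrm i (rem G N i)) = (\<Sum>i<n. tc m n i * nrm i (rem G N i)) + nrm n (rem G N n)"
    by (simp add: lessThan_Suc_atMost[symmetric] tc_top)
  finally show ?thesis .
qed

lemma abs_VS: "0 \<le> DV G m n \<Longrightarrow> \<bar>VS G m n\<bar> = DV G m n / Lam m n"
proof -
  assume "0 \<le> DV G m n"
  then have "DV G m n = \<bar>DV G m n\<bar>" by simp
  also have "\<dots> = Lam m n * \<bar>VS G m n\<bar>"
    using Lam_pos[of m n] by (simp add: DV_def abs_mult power_abs)
  finally show ?thesis using Lam_pos[of m n] by simp
qed

lemma remainder_tendsto:
  assumes "chain n G"
  shows "(\<lambda>N. \<Sum>i<n. c i * nrm i (rem G N i)) \<longlonglongrightarrow> 0"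
proof -
  have "(\<lambda>N. \<Sum>i<n. c i * nrm i (rem G N i)) \<longlonglongrightarrow> (\<Sum>i<n. c i * 0)"
    using assms by (intro tendsto_sum tendsto_mult tendsto_const nrm_rem_tendsto) auto
  then show ?thesis by simp
qed

lemma TT_nonneg: "m < k \<Longrightarrow> 0 \<le> TT m n k"
  using TT_zero[of m k n] TT_pos[of m n k] by (cases "k \<le> m + n") auto

text \<open>The spectral gap gives no decay for the remainder of order \<open>n\<close>, but it
  enters with coefficient 1 and is nonnegative, so it may be dropped. The lower remainders have
  coefficients of alternating sign and disappear in the limit.\<close>

lemma DV_nonneg:
  assumes G: "chain n G"
  shows "0 \<le> DV G m n"
proof (rule LIMSEQ_le_const2[OF remainder_tendsto[OF G]])
  show "\<exists>N. \<forall>k\<ge>N. (\<Sum>i<n. tc m n i * nrm i (rem G k i)) \<le> DV G m n"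
  proof (intro exI allI impI)
    fix N assume N: "m \<le> N"
    have "0 \<le> (\<Sum>k\<in>{m<..N}. TT m n k * ((cf (G 0) k)^2 / ek k))"
      using ek_pos by (intro sum_nonneg mult_nonneg_nonneg TT_nonneg) (auto simp: less_imp_le)
    then show "(\<Sum>i<n. tc m n i * nrm i (rem G N i)) \<le> DV G m n"
      unfolding DV_eq[OF G N] using nrm_nonneg[of "rem G N n" n] by linarith
  qed
qed

text \<open>The guards are essential: \<open>DV G m n\<close> sums over \<open>k > m\<close> only,
  whereas \<open>TT m n k\<close> is nonzero, of sign \<open>(-1) ^ n\<close>, for
  \<open>k \<le> m\<close>.\<close>

definition gap :: "nat \<Rightarrow> nat \<Rightarrow> nat \<Rightarrow> nat \<Rightarrow> real" where
  "gap m1 m2 n k = (if m1 < k then TT m1 n k else 0) - (if m2 < k then TT m2 n k else 0)"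

lemma gap_zero: "m1 < m2 \<Longrightarrow> k \<le> m1 + n \<Longrightarrow> gap m1 m2 n k = 0"
  by (auto simp: gap_def TT_zero)

lemma gap_pos: "m1 < m2 \<Longrightarrow> 0 < n \<Longrightarrow> m1 + n < k \<Longrightarrow> 0 < gap m1 m2 n k"
  using TT_pos[of m1 n k] TT_less[of m1 m2 n k] TT_zero[of m2 k n]
  by (cases "k \<le> m2 + n") (auto simp: gap_def)

lemma gap_nonneg: "m1 < m2 \<Longrightarrow> 0 < n \<Longrightarrow> 0 \<le> gap m1 m2 n k"
  using gap_zero[of m1 m2 k n] gap_pos[of m1 m2 n k] by (cases "k \<le> m1 + n") auto

text \<open>The coefficient of the top-order term is 1 in both residuals, so it cancels in the difference and
  Parseval's identity is only needed below order \<open>n\<close>.\<close>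

lemma DV_diff:
  assumes G: "chain n G" and m: "m1 < m2" and N: "m2 \<le> N"
  shows "DV G m1 n - DV G m2 n = (\<Sum>k\<le>N. gap m1 m2 n k * ((cf (G 0) k)^2 / ek k)) +
    (\<Sum>i<n. (tc m1 n i - tc m2 n i) * nrm i (rem G N i))"
proof -
  have extend: "(\<Sum>k\<in>{m<..N}. TT m n k * y k) = (\<Sum>k\<le>N. (if m < k then TT m n k else 0) * y k)" for m y
    by (intro sum.mono_neutral_cong_left) auto
  have m1N: "m1 \<le> N" using m N by simp
  show ?thesis
    unfolding DV_eq[OF G m1N] DV_eq[OF G N] extend gap_def left_diff_distrib sum_subtractf by linarith
qed

lemma DV_mono:
  assumes G: "chain n G" and m: "m1 < m2" and n: "0 < n"
  shows "DV G m2 n \<le> DV G m1 n"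
proof -
  have "0 \<le> DV G m1 n - DV G m2 n"
  proof (rule LIMSEQ_le_const2[OF remainder_tendsto[OF G]])
    show "\<exists>N. \<forall>k\<ge>N. (\<Sum>i<n. (tc m1 n i - tc m2 n i) * nrm i (rem G k i)) \<le> DV G m1 n - DV G m2 n"
    proof (intro exI allI impI)
      fix N assume N: "m2 \<le> N"
      have "0 \<le> (\<Sum>k\<le>N. gap m1 m2 n k * ((cf (G 0) k)^2 / ek k))"
        using ek_pos m n by (intro sum_nonneg mult_nonneg_nonneg gap_nonneg) (auto simp: less_imp_le)
      then show "(\<Sum>i<n. (tc m1 n i - tc m2 n i) * nrm i (rem G N i)) \<le> DV G m1 n - DV G m2 n"
        unfolding DV_diff[OF G m N] by linarith
    qed
  qed
  then show ?thesis by simp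
qed

lemma DV_eq_iff:
  assumes G: "chain n G" and m: "m1 < m2" and n: "0 < n"
  shows "DV G m1 n = DV G m2 n \<longleftrightarrow> (\<forall>k>m1+n. cf (G 0) k = 0)"
proof
  assume eq: "DV G m1 n = DV G m2 n"
  show "\<forall>k>m1+n. cf (G 0) k = 0"
  proof (intro allI impI)
    fix k assume k: "m1 + n < k"
    let ?t = "\<lambda>k. gap m1 m2 n k * ((cf (G 0) k)^2 / ek k)"
    have t0: "0 \<le> ?t j" for j
      using ek_pos[of j] m n by (intro mult_nonneg_nonneg gap_nonneg) (auto simp: less_imp_le)
    \<comment> \<open>All terms are nonnegative, so this one is at most the partial sum, which
      equals minus the remainders because the residuals agree; these tend to 0.\<close>
    have "?t k \<le> 0"
    proof (rule LIMSEQ_le_const[OF tendsto_minus[OF remainder_tendsto[OF G], unfolded minus_zero]])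
      show "\<exists>N. \<forall>n'\<ge>N. ?t k \<le> - (\<Sum>i<n. (tc m1 n i - tc m2 n i) * nrm i (rem G n' i))"
      proof (intro exI allI impI)
        fix N assume N: "max k m2 \<le> N"
        have "?t k \<le> (\<Sum>j\<le>N. ?t j)" using N t0 by (intro member_le_sum) auto
        then show "?t k \<le> - (\<Sum>i<n. (tc m1 n i - tc m2 n i) * nrm i (rem G N i))"
          using DV_diff[OF G m, of N] N eq by simp
      qed
    qed
    then show "cf (G 0) k = 0"
      using gap_pos[OF m n k] ek_pos[of k] by (simp add: mult_le_0_iff divide_le_0_iff)
  qed
next
  assume z: "\<forall>k>m1+n. cf (G 0) k = 0"
  have t0: "gap m1 m2 n k * ((cf (G 0) k)^2 / ek k) = 0" for k
    using z gap_zero[OF m, of k n] by (cases "k \<le> m1 + n") auto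
  have "(\<lambda>N. DV G m1 n - DV G m2 n) \<longlonglongrightarrow> 0"
  proof (rule Lim_transform_eventually[OF remainder_tendsto[OF G]])
    show "\<forall>\<^sub>F N in sequentially. (\<Sum>i<n. (tc m1 n i - tc m2 n i) * nrm i (rem G N i)) = DV G m1 n - DV G m2 n"
      using eventually_ge_at_top[of m2] by eventually_elim (simp only: DV_diff[OF G m] t0 sum.neutral_const add_0)
  qed
  then show "DV G m1 n = DV G m2 n" using LIMSEQ_const_iff[of "DV G m1 n - DV G m2 n" 0] by simp
qed

lemma nrm_zero_imp:
  assumes h: "continuous_on J h" and L: "L2 i h" and zero: "nrm i h = 0" and x: "x \<in> J"
  shows "h x = 0"
proof (rule ccontr)
  assume nz: "h x \<noteq> 0"
  have "open (J \<inter> h -` (- {0}))" using open_J h by (intro continuous_open_preimage) auto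
  moreover have "x \<in> J \<inter> h -` (- {0})" using x nz by simp
  ultimately obtain a b where ab: "a < x" "x < b" "{a..b} \<subseteq> J \<inter> h -` (- {0})"
    by (rule open_interval_Icc_around)
  have sub: "{a..b} \<subseteq> J" using ab by auto
  have "0 < (LBINT t:{a..b}. h t ^ 2 * W i t)"
  proof (rule set_integral_pos_Icc)
    show "continuous_on {a..b} (\<lambda>t. h t ^ 2 * W i t)"
      by (intro continuous_intros continuous_on_subset[OF h sub] continuous_on_subset[OF W_cont sub])
    show "0 < h t ^ 2 * W i t" if "t \<in> {a..b}" for t
    proof -
      have "t \<in> J" "h t \<noteq> 0" using that ab(3) by auto
      then show ?thesis using W_pos[of t i] by simp
    qed
  qed (use ab in simp)
  also have "\<dots> \<le> nrm i h"
    by (intro set_integral_mono_set L2_int[OF L] sub) (auto intro!: mult_nonneg_nonneg less_imp_le[OF W_pos])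
  finally show False using zero by simp
qed

text \<open>If the coefficients stop at \<open>K\<close>, the remainder is the same for all
  \<open>N \<ge> K\<close>, so its norm, which tends to 0, is 0, and continuity gives equality on
  \<open>J\<close>. Conversely, the coefficient is a pairing with the \<open>k\<close>-th
  derivative, which kills the polynomial.\<close>

lemma cf_vanish_iff_poly:
  assumes G: "chain n G" and n: "0 < n"
  shows "(\<forall>k>K. cf (G 0) k = 0) \<longleftrightarrow> (\<exists>p. degree p \<le> K \<and> (\<forall>x\<in>J. G 0 x = poly p x))"
proof
  assume z: "\<forall>k>K. cf (G 0) k = 0"
  have R: "rem G N 0 = rem G K 0" if "K \<le> N" for N
  proof -
    have "proj (G 0) N = proj (G 0) K"
      unfolding proj_def
    proof (rule sum.mono_neutral_right)
      show "\<forall>k\<in>{..N} - {..K}. smult (cf (G 0) k / ek k) (Rod 0 k) = 0" using z by simp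
    qed (use that in auto)
    then show ?thesis unfolding rem_def[abs_def] by (simp only:)
  qed
  have "(\<lambda>N. nrm 0 (rem G K 0)) \<longlonglongrightarrow> 0"
  proof (rule Lim_transform_eventually[OF nrm_rem_tendsto[OF G n]])
    show "\<forall>\<^sub>F N in sequentially. nrm 0 (rem G N 0) = nrm 0 (rem G K 0)"
    proof (rule eventually_mono[OF eventually_ge_at_top[of K]])
      fix N assume "K \<le> N"
      then have "rem G N 0 = rem G K 0" by (rule R)
      then show "nrm 0 (rem G N 0) = nrm 0 (rem G K 0)" by (simp only:)
    qed
  qed
  then have zero: "nrm 0 (rem G K 0) = 0" using LIMSEQ_const_iff[of "nrm 0 (rem G K 0)" 0] by simp
  note C = chain_rem[OF G, of K]
  have "abs_cont_deriv_on J (rem G K 0) (rem G K (Suc 0))" using C n by (simp add: chain_def)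
  then have "continuous_on J (rem G K 0)" by (rule abs_cont_continuous[OF _ open_J])
  from nrm_zero_imp[OF this chain_L2[OF C] zero] have "\<forall>x\<in>J. G 0 x = poly (proj (G 0) K) x"
    by (simp add: rem_def)
  then show "\<exists>p. degree p \<le> K \<and> (\<forall>x\<in>J. G 0 x = poly p x)" using degree_proj by blast
next
  assume "\<exists>p. degree p \<le> K \<and> (\<forall>x\<in>J. G 0 x = poly p x)"
  then obtain p where p: "degree p \<le> K" "\<And>x. x \<in> J \<Longrightarrow> G 0 x = poly p x" by blast
  show "\<forall>k>K. cf (G 0) k = 0"
  proof (intro allI impI)
    fix k assume k: "K < k"
    have "cf (G 0) k = cf (poly p) k"
      unfolding cf_def using p(2) by (intro set_lebesgue_integral_cong) auto
    also have "\<dots> = ip k (poly ((pderiv ^^ k) p)) (poly (Rod k 0))"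
      using chain_cf[OF chain_poly[of k p], of k k] by simp
    also have "(pderiv ^^ k) p = 0"
    proof -
      have "coeff ((pderiv ^^ k) p) j = 0" for j
        using p(1) k by (simp add: coeff_higher_pderiv coeff_eq_0)
      then show ?thesis by (simp add: poly_eq_iff)
    qed
    finally show "cf (G 0) k = 0" by simp
  qed
qed

end

section \<open>Integrated Pearson densities\<close>

lemma open_interval_exhaustion:
  fixes J :: "real set"
  assumes "open J" "is_interval J" "J \<noteq> {}"
  obtains l u where "exhausted_interval J l u"
proof -
  let ?a = "Inf (ereal ` J)" and ?b = "Sup (ereal ` J)"
  have around: "?a < ereal x \<and> ereal x < ?b" if "x \<in> J" for x
  proof -
    obtain a b where ab: "a < x" "x < b" "{a..b} \<subseteq> J" using open_interval_Icc_around[OF assms(1) \<open>x \<in> J\<close>] .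
    then have "a \<in> J" "b \<in> J" by auto
    then have "?a \<le> ereal a" "ereal b \<le> ?b" by (auto intro: Inf_lower Sup_upper)
    then show ?thesis using ab by (meson ereal_less_eq(3) le_less_trans less_ereal.simps(1) less_le_trans)
  qed
  have J: "J = einterval ?a ?b"
  proof (intro equalityI subsetI)
    fix x assume "x \<in> einterval ?a ?b"
    then have "?a < ereal x" "ereal x < ?b" by (auto simp: einterval_def)
    then obtain y z where "y \<in> J" "y < x" "z \<in> J" "x < z" by (auto simp: Inf_less_iff less_Sup_iff)
    then show "x \<in> J" using is_interval_Icc_subset[OF assms(2), of y z] by auto
  qed (use around in \<open>auto simp: einterval_def\<close>)
  obtain x where "x \<in> J" using assms(3) by blast
  then have "?a < ?b" using around by (meson less_trans)
  then obtain u l :: "nat \<Rightarrow> real" where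
    "einterval ?a ?b = (\<Union>i. {l i .. u i})" "incseq u" "decseq l" "\<And>i. l i < u i"
    by (rule einterval_Icc_approximation) blast
  then show ?thesis using J assms(1) that[of l u] unfolding exhausted_interval_def by simp
qed

lemma isCont_integral_atMost:
  fixes h :: "real \<Rightarrow> real"
  assumes h: "integrable lborel h"
  shows "isCont (\<lambda>x. LBINT t:{..x}. h t) a"
  unfolding continuous_at_sequentially comp_def
proof (intro allI impI)
  fix X :: "nat \<Rightarrow> real" assume X: "X \<longlonglongrightarrow> a"
  show "(\<lambda>n. LBINT t:{..X n}. h t) \<longlonglongrightarrow> (LBINT t:{..a}. h t)"
    unfolding set_lebesgue_integral_def
  proof (rule integral_dominated_convergence[where w="\<lambda>t. \<bar>h t\<bar>"])
    show "AE t in lborel. (\<lambda>n. indicator {..X n} t *\<^sub>R h t) \<longlonglongrightarrow> indicator {..a} t *\<^sub>R h t"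
      using AE_lborel_singleton[of a]
    proof eventually_elim
      case (elim t)
      have "\<forall>\<^sub>F n in sequentially. indicator {..X n} t *\<^sub>R h t = indicator {..a} t *\<^sub>R h t"
      proof (cases "t < a")
        case True
        have "\<forall>\<^sub>F n in sequentially. t < X n" using order_tendstoD(1)[OF X True] .
        then show ?thesis by eventually_elim (use True in auto)
      next
        case False
        then have "a < t" using elim by simp
        then have "\<forall>\<^sub>F n in sequentially. X n < t" using order_tendstoD(2)[OF X] by blast
        then show ?thesis by eventually_elim (use \<open>a < t\<close> in auto)
      qed
      then show ?case by (rule tendsto_eventually)
    qed
  qed (use h in \<open>auto simp: indicator_def borel_measurable_integrable\<close>)
qed

lemma integrable_imp_set_integrable:
  fixes h :: "real \<Rightarrow> real"
  assumes "integrable lborel h" "A \<in> sets borel"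
  shows "set_integrable lborel A h"
  unfolding set_integrable_def by (rule integrable_mult_indicator) (use assms in auto)

lemma integral_atMost_split:
  fixes h :: "real \<Rightarrow> real"
  assumes h: "integrable lborel h"
  shows "(LBINT t. h t) = (LBINT t:{..x}. h t) + (LBINT t:{x<..}. h t)"
proof -
  have i: "set_integrable lborel A h" if "A \<in> sets borel" for A
    using integrable_imp_set_integrable[OF h that] .
  have "(LBINT t:{..x} \<union> {x<..}. h t) = (LBINT t:{..x}. h t) + (LBINT t:{x<..}. h t)"
    by (rule set_integral_Un) (auto intro: i)
  moreover have "{..x} \<union> {x<..} = UNIV" by auto
  ultimately show ?thesis by (simp add: set_lebesgue_integral_def)
qed

lemma integral_atMost_diff:
  fixes h :: "real \<Rightarrow> real"
  assumes h: "integrable lborel h" and "a \<le> b"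
  shows "(LBINT t:{..b}. h t) - (LBINT t:{..a}. h t) = (LBINT t:{a..b}. h t)"
proof -
  have i: "set_integrable lborel A h" if "A \<in> sets borel" for A
    using integrable_imp_set_integrable[OF h that] .
  have "(LBINT t:{..a} \<union> {a..b}. h t) = (LBINT t:{..a}. h t) + (LBINT t:{a..b}. h t)"
  proof (rule set_integral_Un_AE)
    show "AE t in lborel. \<not> (t \<in> {..a} \<and> t \<in> {a..b})"
      using AE_lborel_singleton[of a] by eventually_elim auto
  qed (auto intro: i)
  moreover have "{..a} \<union> {a..b} = {..b}" using assms(2) by auto
  ultimately show ?thesis by simp
qed

lemma set_integral_zero_imp_AE:
  fixes h :: "real \<Rightarrow> real"
  assumes h: "set_integrable lborel A h" and nonneg: "\<And>t. t \<in> A \<Longrightarrow> 0 \<le> h t"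
    and zero: "(LBINT t:A. h t) = 0"
  shows "AE t in lborel. t \<in> A \<longrightarrow> h t = 0"
proof -
  have "AE t in lborel. indicator A t *\<^sub>R h t = 0"
    using integral_nonneg_eq_0_iff_AE[of lborel "\<lambda>t. indicator A t *\<^sub>R h t"] h nonneg zero
    unfolding set_integrable_def set_lebesgue_integral_def by (auto simp: indicator_def)
  then show ?thesis by eventually_elim auto
qed

locale pearson_density =
  fixes f :: "real \<Rightarrow> real" and \<mu> \<delta> \<beta> \<gamma> :: real
  assumes IP: "integrated_pearson f \<mu> \<delta> \<beta> \<gamma>"
begin

abbreviation "J \<equiv> support_int f"
abbreviation "F \<equiv> cdf_of f"
abbreviation "q \<equiv> qpoly \<delta> \<beta> \<gamma>"
abbreviation "g \<equiv> \<lambda>t. (\<mu> - t) * f t"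

lemma f_nonneg: "0 \<le> f x" and f_int: "integrable lborel f" and f_total: "(LBINT x. f x) = 1"
  and tf_int: "integrable lborel (\<lambda>t. t * f t)" and mean: "(LBINT t. t * f t) = \<mu>"
  and pearson: "(LBINT t:{..x}. g t) = q x * f x"
  using IP by (auto simp: integrated_pearson_def is_density_def mean_of_def)

lemma g_int: "integrable lborel g"
proof -
  have "integrable lborel (\<lambda>t. \<mu> * f t - t * f t)" using f_int tf_int by (intro Bochner_Integration.integrable_diff) auto
  then show ?thesis by (simp add: left_diff_distrib)
qed

lemma g_total: "(LBINT t. g t) = 0"
proof -
  have "(LBINT t. g t) = (LBINT t. \<mu> * f t - t * f t)" by (simp add: left_diff_distrib)
  also have "\<dots> = 0" using f_int tf_int f_total mean by simp
  finally show ?thesis .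
qed

lemmas set_int = integrable_imp_set_integrable

section \<open>The support as a nonempty open interval\<close>

lemma F_cont: "isCont F x"
  unfolding cdf_of_def[abs_def] by (rule isCont_integral_atMost[OF f_int])

lemma F_upper: "1 - F x = (LBINT t:{x<..}. f t)"
  using integral_atMost_split[OF f_int, of x] f_total by (simp add: cdf_of_def)

lemma F_mono: "x \<le> y \<Longrightarrow> F x \<le> F y"
  unfolding cdf_of_def by (intro set_integral_mono_set set_int f_int) (auto simp: f_nonneg)

lemma F_nonneg: "0 \<le> F x"
  unfolding cdf_of_def by (intro set_integral_nonneg_real f_nonneg)

lemma F_le_1: "F x \<le> 1"
proof -
  have "0 \<le> (LBINT t:{x<..}. f t)" by (intro set_integral_nonneg_real f_nonneg)
  then show ?thesis using F_upper[of x] by simp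
qed

lemma F_top: "(\<lambda>n. F (real n)) \<longlonglongrightarrow> 1"
proof -
  have "incseq (\<lambda>n. {..real n})" by (auto simp: incseq_def)
  then have "(\<lambda>n. F (real n)) \<longlonglongrightarrow> (LBINT t:(\<Union>n. {..real n}). f t)"
    unfolding cdf_of_def by (intro set_integral_cont_up set_int f_int) auto
  moreover have "(\<Union>n. {..real n}) = UNIV" by (auto intro: real_arch_simple)
  ultimately show ?thesis using f_total by (simp add: set_lebesgue_integral_def)
qed

lemma F_bot: "(\<lambda>n. F (- real n)) \<longlonglongrightarrow> 0"
proof -
  have "incseq (\<lambda>n. {- real n<..})" by (auto simp: incseq_def)
  then have "(\<lambda>n. LBINT t:{- real n<..}. f t) \<longlonglongrightarrow> (LBINT t:(\<Union>n. {- real n<..}). f t)"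
    by (intro set_integral_cont_up set_int f_int) auto
  moreover have "(\<Union>n. {- real n<..}) = UNIV"
  proof -
    have "\<exists>n. - real n < x" for x using reals_Archimedean2[of "- x"] by (auto simp: minus_less_iff)
    then show ?thesis by auto
  qed
  ultimately have "(\<lambda>n. 1 - F (- real n)) \<longlonglongrightarrow> 1" using f_total by (simp add: F_upper set_lebesgue_integral_def)
  from tendsto_diff[OF tendsto_const[of 1] this] show ?thesis by simp
qed

lemma J_open: "open J"
proof -
  have c: "continuous_on UNIV F" using F_cont by (simp add: continuous_at_imp_continuous_on)
  have "J = F -` {0<..<1}" by (auto simp: support_int_def)
  then show ?thesis using open_vimage[OF _ c, of "{0<..<1}"] by simp
qed

lemma J_interval: "is_interval J"
  unfolding is_interval_1 support_int_def using F_mono by (auto intro: less_le_trans le_less_trans)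

lemma J_nonempty: "J \<noteq> {}"
proof -
  have "\<forall>\<^sub>F n in sequentially. F (- real n) < 1/2" by (rule order_tendstoD(2)[OF F_bot]) simp
  moreover have "\<forall>\<^sub>F n in sequentially. 1/2 < F (real n)" by (rule order_tendstoD(1)[OF F_top]) simp
  ultimately have "\<forall>\<^sub>F n in sequentially. F (- real n) < 1/2 \<and> 1/2 < F (real n)" by (rule eventually_conj)
  then obtain n where "F (- real n) < 1/2" "1/2 < F (real n)" by (auto dest: eventually_happens)
  then have "\<exists>x. - real n \<le> x \<and> x \<le> real n \<and> F x = 1/2"
    by (intro IVT) (auto simp: F_cont)
  then obtain x where "F x = 1/2" by blast
  then have "x \<in> J" by (simp add: support_int_def)
  then show ?thesis by blast
qed

text \<open>Outside \<open>J\<close> the product \<open>q f\<close> vanishes almost everywhere, and \<open>q\<close> has at most two zeros.\<close>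

lemma f_zero_outside: "AE t in lborel. t \<notin> J \<longrightarrow> f t = 0"
proof -
  have zero: "q x * f x = 0" if x: "x \<notin> J" for x
  proof -
    have "F x = 0 \<or> F x = 1" using x F_nonneg[of x] F_le_1[of x] by (auto simp: support_int_def)
    then show ?thesis
    proof
      assume "F x = 0"
      then have "AE t in lborel. t \<in> {..x} \<longrightarrow> f t = 0"
        by (intro set_integral_zero_imp_AE set_int f_int f_nonneg) (auto simp: cdf_of_def)
      then have "AE t in lborel. indicator {..x} t *\<^sub>R g t = 0" by eventually_elim (auto simp: indicator_def)
      then have "(LBINT t:{..x}. g t) = 0" unfolding set_lebesgue_integral_def by (rule integral_eq_zero_AE)
      then show ?thesis by (simp add: pearson)
    next
      assume "F x = 1"
      then have "AE t in lborel. t \<in> {x<..} \<longrightarrow> f t = 0"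
        using F_upper[of x] by (intro set_integral_zero_imp_AE set_int f_int f_nonneg) auto
      then have "AE t in lborel. indicator {x<..} t *\<^sub>R g t = 0" by eventually_elim (auto simp: indicator_def)
      then have "(LBINT t:{x<..}. g t) = 0" unfolding set_lebesgue_integral_def by (rule integral_eq_zero_AE)
      then show ?thesis using integral_atMost_split[OF g_int, of x] g_total by (simp add: pearson)
    qed
  qed
  have "[:\<gamma>, \<beta>, \<delta>:] \<noteq> 0" using IP by (auto simp: integrated_pearson_def)
  then have "finite {x. q x = 0}"
    using poly_roots_finite[of "[:\<gamma>, \<beta>, \<delta>:]"] by (simp add: qpoly_def power2_eq_square algebra_simps)
  then have "AE t in lborel. t \<notin> {x. q x = 0}"
    by (intro AE_not_in finite_imp_null_set_lborel)
  then show ?thesis by eventually_elim (use zero in auto)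
qed

lemma J_borel: "J \<in> sets borel"
  using J_open by simp

lemma integral_J: "integrable lborel (\<lambda>t. k t * f t) \<Longrightarrow> (LBINT t:J. k t * f t) = (LBINT t. k t * f t)"
  for k :: "real \<Rightarrow> real"
  unfolding set_lebesgue_integral_def
proof (rule integral_cong_AE)
  assume i: "integrable lborel (\<lambda>t. k t * f t)"
  show "(\<lambda>t. indicator J t *\<^sub>R (k t * f t)) \<in> borel_measurable lborel"
    using set_int[OF i J_borel] by (auto simp: set_integrable_def)
  show "(\<lambda>t. k t * f t) \<in> borel_measurable lborel" using i by auto
  show "AE t in lborel. indicator J t *\<^sub>R (k t * f t) = k t * f t"
    using f_zero_outside by eventually_elim (auto simp: indicator_def)
qed

lemma mass_J: "(LBINT t:J. f t) = 1"
  using integral_J[of "\<lambda>_. 1"] f_int f_total by simp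

text \<open>\<open>g\<close> vanishes only at \<mu> and where \<open>f\<close> does, so a zero
  integral would leave no mass on \<open>A\<close>. The factor \<open>e\<close> stands for the sign
  of \<open>\<mu> - t\<close> on \<open>A\<close>.\<close>

lemma set_integral_g_pos:
  assumes A: "A \<in> sets borel" and nn: "\<And>t. t \<in> A \<Longrightarrow> 0 \<le> e * g t" and e: "e \<noteq> 0"
    and mass: "(LBINT t:A. f t) \<noteq> 0"
  shows "0 < e * (LBINT t:A. g t)"
proof -
  have int: "set_integrable lborel A (\<lambda>t. e * g t)" using set_int[OF g_int A] by simp
  have "(LBINT t:A. e * g t) \<noteq> 0"
  proof
    assume "(LBINT t:A. e * g t) = 0"
    with int nn have "AE t in lborel. t \<in> A \<longrightarrow> e * g t = 0" by (rule set_integral_zero_imp_AE)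
    then have "AE t in lborel. indicator A t *\<^sub>R f t = 0"
      using AE_lborel_singleton[of \<mu>] by eventually_elim (use e in \<open>auto simp: indicator_def\<close>)
    then have "(LBINT t:A. f t) = 0" unfolding set_lebesgue_integral_def by (rule integral_eq_zero_AE)
    then show False using mass by simp
  qed
  moreover have "0 \<le> (LBINT t:A. e * g t)" by (rule set_integral_nonneg_real[OF nn])
  ultimately show ?thesis by (simp add: less_le)
qed

text \<open>The product is the integral of \<open>g\<close> up to \<open>x\<close> and, the total
  being 0, minus the integral beyond \<open>x\<close>. On the side of \<open>x\<close> away from
  \<mu> the integrand has constant sign.\<close>

lemma qf_pos: "0 < q x * f x" if x: "x \<in> J"
proof (cases "x \<le> \<mu>")
  case True
  have "0 < 1 * (LBINT t:{..x}. g t)"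
    using True x f_nonneg by (intro set_integral_g_pos) (auto simp: support_int_def cdf_of_def)
  then show ?thesis by (simp add: pearson)
next
  case False
  have "0 < - 1 * (LBINT t:{x<..}. g t)"
  proof (rule set_integral_g_pos)
    show "0 \<le> - 1 * g t" if "t \<in> {x<..}" for t using that False f_nonneg[of t] by (simp add: mult_nonpos_nonneg)
    show "(LBINT t:{x<..}. f t) \<noteq> 0" using F_upper[of x] x by (simp add: support_int_def)
  qed auto
  then show ?thesis using integral_atMost_split[OF g_int, of x] g_total by (simp add: pearson)
qed

lemma f_pos_J: "x \<in> J \<Longrightarrow> 0 < f x" and q_pos_J: "x \<in> J \<Longrightarrow> 0 < q x"
  using qf_pos[of x] f_nonneg[of x] by (auto simp: zero_less_mult_iff)

lemma qf_cont: "isCont (\<lambda>x. q x * f x) x"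
  using isCont_integral_atMost[OF g_int, of x] by (simp only: pearson)

text \<open>The density is a priori only measurable, but the Pearson identity holds at every point,
  so \<open>f\<close> is the continuous function \<open>q f\<close> divided by
  \<open>q\<close>.\<close>

lemma f_cont_J: "continuous_on J f"
proof -
  have "continuous_on J (\<lambda>x. q x * f x / q x)"
  proof (intro continuous_on_divide)
    show "continuous_on J (\<lambda>x. q x * f x)" using qf_cont by (simp add: continuous_at_imp_continuous_on)
    show "continuous_on J q" unfolding qpoly_def[abs_def] by (intro continuous_intros)
  qed (use q_pos_J in force)
  then show ?thesis
    by (rule continuous_on_eq) (use q_pos_J in force)
qed

lemma qf_has_derivative: "((\<lambda>x. q x * f x) has_real_derivative g x) (at x)" if x: "x \<in> J"
proof -
  obtain a b where ab: "a < x" "x < b" "{a..b} \<subseteq> J" using open_interval_Icc_around[OF J_open x] .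
  have gc: "continuous_on {a..b} g"
    by (intro continuous_intros continuous_on_subset[OF f_cont_J ab(3)])
  have "((\<lambda>y. integral {a..y} g) has_real_derivative g x) (at x within {a..b})"
    using ab by (intro integral_has_real_derivative gc) auto
  then have D: "((\<lambda>y. q a * f a + integral {a..y} g) has_real_derivative g x) (at x within {a..b})"
    by (auto intro!: derivative_eq_intros)
  have eq: "q y * f y = q a * f a + integral {a..y} g" if y: "y \<in> {a..b}" for y
  proof -
    have i: "set_integrable lborel {a..y} g" by (intro set_int g_int) auto
    have "q y * f y - q a * f a = (LBINT t:{a..y}. g t)"
      using integral_atMost_diff[OF g_int, of a y] y by (simp add: pearson)
    then show ?thesis using set_borel_integral_eq_integral(2)[OF i] by simp
  qed
  have "((\<lambda>y. q y * f y) has_real_derivative g x) (at x within {a..b})"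
    by (rule has_field_derivative_transform_within[OF D zero_less_one]) (use ab eq[symmetric] in simp_all)
  then show ?thesis using ab at_within_interior[of x "{a..b}"] by (simp add: interior_atLeastAtMost_real)
qed

text \<open>The tails of \<open>g\<close> shrink to the complement of \<open>J\<close>, where
  \<open>g\<close> is 0 almost everywhere, so dominated convergence applies. At the right end the
  vanishing total converts the integral up to \<open>u n\<close> into one beyond it.\<close>

lemma qf_vanishes:
  assumes "exhausted_interval J l u"
  shows "(\<lambda>n. q (l n) * f (l n)) \<longlonglongrightarrow> 0" "(\<lambda>n. q (u n) * f (u n)) \<longlonglongrightarrow> 0"
proof -
  interpret exhausted_interval J l u by fact
  have g0: "AE t in lborel. t \<notin> J \<longrightarrow> g t = 0" using f_zero_outside by eventually_elim auto
  have meas: "(\<lambda>t. indicator A t *\<^sub>R g t) \<in> borel_measurable lborel" if "A \<in> sets borel" for A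
    using set_int[OF g_int that] by (auto simp: set_integrable_def)
  have conv: "(\<lambda>n. LBINT t:A n. g t) \<longlonglongrightarrow> 0"
    if A: "\<And>n. A n \<in> sets borel" "\<And>t. t \<in> J \<Longrightarrow> \<forall>\<^sub>F n in sequentially. t \<notin> A n" for A :: "nat \<Rightarrow> real set"
  proof -
    have "(\<lambda>n. LBINT t:A n. g t) \<longlonglongrightarrow> integral\<^sup>L lborel (\<lambda>t::real. 0 :: real)"
      unfolding set_lebesgue_integral_def
    proof (rule integral_dominated_convergence[where w="\<lambda>t. \<bar>g t\<bar>"])
      show "integrable lborel (\<lambda>t. \<bar>g t\<bar>)" using g_int by simp
      show "(\<lambda>t. indicator (A n) t *\<^sub>R g t) \<in> borel_measurable lborel" for n by (rule meas[OF A(1)])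
      show "AE t in lborel. norm (indicator (A n) t *\<^sub>R g t) \<le> \<bar>g t\<bar>" for n
        by (intro AE_I2) (simp add: indicator_def)
      show "AE t in lborel. (\<lambda>n. indicator (A n) t *\<^sub>R g t) \<longlonglongrightarrow> 0"
        using g0
      proof eventually_elim
        case (elim t)
        have "\<forall>\<^sub>F n in sequentially. indicator (A n) t *\<^sub>R g t = 0"
        proof (cases "t \<in> J")
          case True
          from A(2)[OF this] show ?thesis by eventually_elim simp
        next
          case False
          then have "g t = 0" using elim by blast
          then show ?thesis by simp
        qed
        then show ?case by (rule tendsto_eventually)
      qed
    qed simp
    then show ?thesis by simp
  qed
  have "(\<lambda>n. LBINT t:{..l n}. g t) \<longlonglongrightarrow> 0"
  proof (rule conv)
    show "\<forall>\<^sub>F n in sequentially. t \<notin> {..l n}" if "t \<in> J" for t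
      using eventually_surround[OF that] by eventually_elim auto
  qed simp
  then show "(\<lambda>n. q (l n) * f (l n)) \<longlonglongrightarrow> 0" by (simp only: pearson)
  have "(\<lambda>n. LBINT t:{u n<..}. g t) \<longlonglongrightarrow> 0"
  proof (rule conv)
    show "\<forall>\<^sub>F n in sequentially. t \<notin> {u n<..}" if "t \<in> J" for t
      using eventually_surround[OF that] by eventually_elim auto
  qed simp
  then have "(\<lambda>n. - (LBINT t:{u n<..}. g t)) \<longlonglongrightarrow> - 0" by (rule tendsto_minus)
  moreover have "- (LBINT t:{u n<..}. g t) = q (u n) * f (u n)" for n
    using integral_atMost_split[OF g_int, of "u n"] g_total pearson[of "u n"] by simp
  ultimately show "(\<lambda>n. q (u n) * f (u n)) \<longlonglongrightarrow> 0" by simp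
qed

lemma obtain_weight:
  assumes "\<delta> \<le> 0"
  obtains l u where "pearson_weight J l u f \<mu> \<delta> \<beta> \<gamma>"
proof -
  obtain l u where E: "exhausted_interval J l u"
    using open_interval_exhaustion[OF J_open J_interval J_nonempty] .
  have "pearson_weight J l u f \<mu> \<delta> \<beta> \<gamma>"
    unfolding pearson_weight_def pearson_weight_axioms_def
    using E assms f_cont_J f_pos_J q_pos_J qf_has_derivative set_int[OF f_int J_borel]
      qf_vanishes[OF E] mass_J by blast
  then show ?thesis by (rule that)
qed

end

section \<open>Comparison of two residuals and the case of equality\<close>

theorem theorem3p1:
  fixes f :: "real \<Rightarrow> real" and \<mu> \<delta> \<beta> \<gamma> :: real
    and G :: "nat \<Rightarrow> real \<Rightarrow> real" and M :: enat and n m1 m2 :: nat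
  assumes IP: "integrated_pearson f \<mu> \<delta> \<beta> \<gamma>"
    and delta: "\<delta> \<le> 0"
    and npos: "0 < n"
    and Mn: "enat n \<le> M"
    and H: "H_class_enat f \<delta> \<beta> \<gamma> G M n"
    and m12: "m1 < m2" and m2M: "enat m2 \<le> M"
  shows "zeta m1 m2 n \<delta> > 1
    \<and> \<bar>variance_of f (G 0) - S_mn f \<delta> \<beta> \<gamma> G m1 n\<bar>
        \<ge> zeta m1 m2 n \<delta> * \<bar>variance_of f (G 0) - S_mn f \<delta> \<beta> \<gamma> G m2 n\<bar>
    \<and> (\<bar>variance_of f (G 0) - S_mn f \<delta> \<beta> \<gamma> G m1 n\<bar>
          = zeta m1 m2 n \<delta> * \<bar>variance_of f (G 0) - S_mn f \<delta> \<beta> \<gamma> G m2 n\<bar>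
       \<longleftrightarrow> (\<exists>p :: real poly. degree p \<le> n + m1 \<and>
                (\<forall>x\<in>support_int f. G 0 x = poly p x)))"
proof -
  interpret D: pearson_density f \<mu> \<delta> \<beta> \<gamma> by unfold_locales (rule IP)
  obtain l u where "pearson_weight (support_int f) l u f \<mu> \<delta> \<beta> \<gamma>" using D.obtain_weight[OF delta] .
  then interpret P: pearson_weight "support_int f" l u f \<mu> \<delta> \<beta> \<gamma> .
  let ?J = "support_int f"
  \<comment> \<open>The largest order occurring in either residual; membership in the class is used
    at this level, and \<open>L \<le> M\<close> because both \<open>n\<close> and \<open>m2\<close>
    are at most \<open>M\<close>.\<close>
  define L where "L = max m2 n"
  have "enat L \<le> M" using Mn m2M by (simp add: L_def max_def)
  then have "H_class f \<delta> \<beta> \<gamma> G L n" using H by (simp add: H_class_enat_def)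
  moreover have L: "max L n = L" "0 < L" "n \<le> L" "m2 \<le> L" using npos by (auto simp: L_def)
  ultimately have deriv: "\<And>k x. k + 1 < L \<Longrightarrow> x \<in> ?J \<Longrightarrow> (G k has_real_derivative G (Suc k) x) (at x)"
    and cont: "continuous_on ?J (G (L - 1))" and ac: "abs_cont_deriv_on ?J (G (L - 1)) (G L)"
    and meas: "\<And>i. i \<le> L \<Longrightarrow> G i \<in> borel_measurable borel"
    and fin: "finite_exp f (\<lambda>x. qpoly \<delta> \<beta> \<gamma> x ^ n * (G n x)^2)"
    and fin1: "\<And>i. n + 1 \<le> i \<Longrightarrow> i \<le> L \<Longrightarrow> finite_exp f (\<lambda>x. qpoly \<delta> \<beta> \<gamma> x ^ i * \<bar>G i x\<bar>)"
    by (auto simp: H_class_def Let_def)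
  \<comment> \<open>Below order \<open>L\<close> the derivatives are continuous, the one of order
    \<open>L - 1\<close> by assumption, so the earlier steps are of class C1; the step from
    \<open>L - 1\<close> to \<open>L\<close> is only absolutely continuous.\<close>
  have acG: "abs_cont_deriv_on ?J (G k) (G (Suc k))" if k: "k < L" for k
  proof (cases "k + 1 < L")
    case True
    have "continuous_on ?J (G (Suc k))"
    proof (cases "k + 2 < L")
      case True
      then have "isCont (G (Suc k)) x" if "x \<in> ?J" for x
        using deriv[of "Suc k" x] that by (auto intro: DERIV_isCont)
      then show ?thesis by (simp add: continuous_at_imp_continuous_on)
    next
      case False
      then have "Suc k = L - 1" using \<open>k + 1 < L\<close> by simp
      then show ?thesis using cont by simp
    qed
    then show ?thesis
      using deriv True by (intro abs_cont_C1[OF P.interval_J]) (auto intro: has_field_derivative_at_within)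
  next
    case False
    then have "k = L - 1" "Suc k = L" using k by auto
    then show ?thesis using ac by simp
  qed
  have chain: "P.chain n G"
  proof -
    have "(\<lambda>x. indicator ?J x * G n x) \<in> borel_measurable borel"
      using meas[of n] L D.J_borel by (intro borel_measurable_times borel_measurable_indicator) auto
    then have "set_borel_measurable lborel ?J (G n)" by (simp add: set_borel_measurable_def)
    moreover have "set_integrable lborel ?J (\<lambda>x. G n x ^ 2 * P.W n x)"
      using fin by (simp add: finite_exp_def P.W_def mult_ac)
    ultimately show ?thesis using acG L by (simp add: P.chain_def P.L2_def)
  qed
  have int: "set_integrable lborel ?J (\<lambda>x. \<bar>G i x\<bar> * P.W i x)" if "n < i" "i \<le> L" for i
    using fin1[of i] that by (simp add: finite_exp_def P.W_def mult_ac)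
  have e1: "expect f (\<lambda>x. qpoly \<delta> \<beta> \<gamma> x ^ i * G i x) = P.cf (G 0) i" if "i \<le> L" for i
    using P.cf_eq_top_derivative[OF chain acG int that] by (simp add: expect_def P.W_def mult_ac)
  have e2: "expect f (\<lambda>x. qpoly \<delta> \<beta> \<gamma> x ^ i * (G i x)^2) = P.nrm i (G i)" for i
    by (simp add: expect_def P.W_def mult_ac)
  have e3: "expect f (\<lambda>x. qpoly \<delta> \<beta> \<gamma> x ^ i) = (LBINT x:?J. P.W i x)" for i
    by (simp add: expect_def P.W_def)
  have var: "variance_of f (G 0) = P.nrm 0 (G 0) - (P.cf (G 0) 0)^2"
  proof -
    define c where "c = P.cf (G 0) 0"
    have "expect f (G 0) = c" using e1[of 0] by (simp add: c_def)
    then have "variance_of f (G 0) = P.nrm 0 (\<lambda>x. G 0 x - poly [:c:] x)"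
      by (simp add: variance_of_def expect_def P.W_def)
    also have "\<dots> = P.nrm 0 (G 0) - 2 * P.ip 0 (G 0) (poly [:c:]) + P.nrm 0 (poly [:c:])"
      by (rule P.L2_diff(2)[OF P.chain_L2[OF chain] P.L2_poly]) simp
    also have "P.ip 0 (G 0) (poly [:c:]) = c * c"
    proof -
      have "P.ip 0 (G 0) (poly (smult c 1)) = c * c"
        unfolding P.ip_poly_smult by (simp add: c_def P.cf_def)
      then show ?thesis by simp
    qed
    also have "P.nrm 0 (poly [:c:]) = c * c"
      using P.mass by (simp add: P.W_0 power2_eq_square)
    finally show ?thesis by (simp add: c_def power2_eq_square)
  qed
  have a: "coef_a f \<delta> \<beta> \<gamma> m n i = P.RR m n i / P.ek i" if i: "1 \<le> i" "i \<le> m" for m i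
  proof -
    have sets: "{m+i..m+n+i-1} = {m+i..<m+n+i}" "{m..m+n-1} = {m..<m+n}" using npos by auto
    show ?thesis
      unfolding coef_a_def P.RR_eq[OF i(2)] P.ek_eq e3 sets using P.NN_diag[of i] i by (simp add: mult_ac)
  qed
  have VS: "variance_of f (G 0) - S_mn f \<delta> \<beta> \<gamma> G m n = P.VS G m n" if m: "m \<le> L" for m
  proof -
    have "(\<Sum>i=1..m. coef_a f \<delta> \<beta> \<gamma> m n i * (expect f (\<lambda>x. qpoly \<delta> \<beta> \<gamma> x ^ i * G i x))^2) =
      (\<Sum>i=1..m. P.RR m n i / P.ek i * (P.cf (G 0) i)^2)"
      using m by (intro sum.cong) (auto simp: a e1)
    then show ?thesis by (simp only: var S_mn_def P.VS_def e2 P.coef_b_eq)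
  qed
  have m1L: "m1 \<le> L" using m12 L by simp
  have z: "zeta m1 m2 n \<delta> = P.Lam m2 n / P.Lam m1 n" by (rule P.zeta_eq[OF npos])
  have lhs: "\<bar>variance_of f (G 0) - S_mn f \<delta> \<beta> \<gamma> G m1 n\<bar> = P.DV G m1 n / P.Lam m1 n"
    unfolding VS[OF m1L] by (rule P.abs_VS[OF P.DV_nonneg[OF chain]])
  \<comment> \<open>\<open>zeta\<close> is the ratio of the two normalisations, so after
    multiplication both sides carry \<open>P.Lam m1 n\<close> and only \<open>DV\<close> remains to
    be compared.\<close>
  have rhs: "zeta m1 m2 n \<delta> * \<bar>variance_of f (G 0) - S_mn f \<delta> \<beta> \<gamma> G m2 n\<bar> = P.DV G m2 n / P.Lam m1 n"
    unfolding VS[OF L(4)] P.abs_VS[OF P.DV_nonneg[OF chain]] z using P.Lam_pos[of m2 n] by simp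
  have pos: "0 < P.Lam m1 n" by (rule P.Lam_pos)
  have "(P.DV G m1 n / P.Lam m1 n = P.DV G m2 n / P.Lam m1 n) \<longleftrightarrow> (\<forall>k>m1+n. P.cf (G 0) k = 0)"
    using P.DV_eq_iff[OF chain m12 npos] pos by simp
  also have "\<dots> \<longleftrightarrow> (\<exists>p. degree p \<le> n + m1 \<and> (\<forall>x\<in>?J. G 0 x = poly p x))"
    using P.cf_vanish_iff_poly[OF chain npos, of "m1 + n"] by (simp add: add.commute)
  finally have iff: "(P.DV G m1 n / P.Lam m1 n = P.DV G m2 n / P.Lam m1 n) \<longleftrightarrow>
      (\<exists>p. degree p \<le> n + m1 \<and> (\<forall>x\<in>?J. G 0 x = poly p x))" .
  have "zeta m1 m2 n \<delta> > 1" unfolding z using P.Lam_less[OF m12 npos] pos by simp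
  moreover have "P.DV G m2 n / P.Lam m1 n \<le> P.DV G m1 n / P.Lam m1 n"
    using P.DV_mono[OF chain m12 npos] pos by (simp add: divide_right_mono)
  ultimately show ?thesis unfolding lhs rhs iff by blast
qed

end
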